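(* There exists an outer function $f\in\mathcal{B}$ with $1/f\in H^\infty$ such that the set of all weak-star sequential limits in $\mathcal{B}$ of functions of the form $fQ$, with $Q$ an analytic polynomial, is a proper subspace of $\mathcal{B}$.
   Context: $\mathcal{B}$ is the Bloch space of analytic $f$ on $\mathbb{D}$ with $|f(0)|+\sup_z(1-|z|)|f'(z)|<\infty$, identified with the dual of $W^1=\{g \text{ analytic}: |g(0)|+\int_{\mathbb{D}}|g'|dA<\infty\}$ via the pairing $\lim_{r\to1^-}\int_{\partial\mathbb{D}}f(r\zeta)\overline{g(r\zeta)}dm(\zeta)$, with the corresponding weak-star topology. $H^\infty$ is the space of bounded analytic functions on $\mathbb{D}$. *)

theory Defs
  imports "HOL-Analysis.Analysis" "HOL-Computational_Algebra.Polynomial"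
begin

text \<open>Unit disc \<open>\<D> = ball 0 1\<close>. Functions are complex \<Rightarrow> complex; only values on the disc matter.\<close>

definition bloch :: "(complex \<Rightarrow> complex) set" where
  "bloch = {f. f holomorphic_on ball 0 1 \<and>
      (\<exists>C. \<forall>z\<in>ball 0 1. (1 - norm z) * norm (deriv f z) \<le> C)}"

definition W1 :: "(complex \<Rightarrow> complex) set" where
  "W1 = {g. g holomorphic_on ball 0 1 \<and>
      set_integrable lborel (ball 0 1) (\<lambda>z. norm (deriv g z))}"

definition Hinf :: "(complex \<Rightarrow> complex) set" where
  "Hinf = {f. f holomorphic_on ball 0 1 \<and> bounded (f ` ball 0 1)}"

definition bloch_pair :: "(complex \<Rightarrow> complex) \<Rightarrow> (complex \<Rightarrow> complex) \<Rightarrow> complex" where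
  "bloch_pair f g = Lim (at_left 1)
     (\<lambda>r::real. integral {0..2*pi}
        (\<lambda>t. f (of_real r * cis t) * cnj (g (of_real r * cis t))) / of_real (2*pi))"

definition weakstar_tendsto :: "(nat \<Rightarrow> complex \<Rightarrow> complex) \<Rightarrow> (complex \<Rightarrow> complex) \<Rightarrow> bool" where
  "weakstar_tendsto fs F \<longleftrightarrow>
     (\<forall>g\<in>W1. (\<lambda>n. bloch_pair (fs n) g) \<longlonglongrightarrow> bloch_pair F g)"

definition outer :: "(complex \<Rightarrow> complex) \<Rightarrow> bool" where
  "outer f \<longleftrightarrow> (\<exists>c u. norm c = 1 \<and> u absolutely_integrable_on {0..2*pi} \<and>
     (\<forall>z\<in>ball 0 1. f z = c * exp (integral {0..2*pi}
        (\<lambda>t. (cis t + z) / (cis t - z) * of_real (u t)) / of_real (2*pi))))"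

definition poly_mult_limits :: "(complex \<Rightarrow> complex) \<Rightarrow> (complex \<Rightarrow> complex) set" where
  "poly_mult_limits f = {F. F \<in> bloch \<and> (\<exists>Q :: nat \<Rightarrow> complex poly.
      weakstar_tendsto (\<lambda>n z. f z * poly (Q n) z) F)}"

end

theory Submission
  imports Defs "HOL-Complex_Analysis.Complex_Analysis"
begin

text \<open>Let \<open>f = 1 + \<Sum>\<^sub>k \<epsilon>\<^sub>k / (1 + \<epsilon>\<^sub>k - z\<^bsup>N\<^sub>k\<^esup>)\<close> with \<open>\<epsilon>\<^sub>k\<close> summable and \<open>N\<^sub>k\<close> growing very fast. Then \<open>Re f \<ge> 1\<close>,
  and \<open>f\<close> is a Bloch function such that \<open>(1 - \<bar>w\<bar>) \<bar>f'(w)\<bar>\<close> is bounded below at the points with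
  \<open>w\<^bsup>N\<^sub>k\<^esup> = 1 - \<epsilon>\<^sub>k\<close>, which accumulate at every point of the circle.
  If \<open>f Q\<^sub>n\<close> converges weak-star, then the Bloch seminorms of \<open>f Q\<^sub>n\<close> are uniformly bounded
  (uniform boundedness, tested on normalised derivative kernels).
  Near the circle a fixed polynomial \<open>Q\<^sub>n\<close> is almost constant at the hyperbolic scale, so the lower bound on \<open>f'\<close>
  bounds \<open>Q\<^sub>n\<close> on the circle, hence in the disc, uniformly in \<open>n\<close>. Every sequential limit \<open>F\<close> is therefore
  \<open>O(\<bar>f\<bar>)\<close>, whereas \<open>f\<close> grows more slowly than the Bloch function \<open>log (1 - z)\<close> along a sequence tending to 1.\<close>

section \<open>Polar coordinates\<close>

text \<open>\<open>bloch_pair\<close> is a \<open>Lim\<close>, so nothing can be said about it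
  before the limit is known to exist for every Bloch function and every \<open>g\<close> in
  \<open>W1\<close>, and both may be unbounded. Rewriting the circle means as area integrals against
  \<open>deriv g\<close> settles this by domination; polar coordinates on the disc are there for
  that purpose. Uniform boundedness is obtained by exhibiting one explicit bad \<open>g\<close>, an
  absolutely convergent series of derivative kernels, in place of a Baire argument in
  \<open>W1\<close>. The parameters meet three demands. The square roots of \<open>eps k\<close>
  must be summable, both for the Bloch bound and for the integrability of the boundary values. The
  ranges of radii where the bumps are active must be disjoint. Finally \<open>ln (frq k)\<close>
  must outgrow \<open>k\<close>, because \<open>bump_sum\<close> has size at most
  \<open>k + 3\<close> at radius \<open>1 - 1 / frq k\<close>. The quadratic exponent of the base
  \<open>64 = 4 ^ 3\<close> serves the last two demands. The bound \<open>Re \<ge> 1\<close> gives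
  the bounded reciprocal at once. For outerness it makes the logarithms of the partial sums
  nonnegative on the circle, so that they are dominated by the sum of the norms of the
  bumps.\<close>

lemma cball_borel [measurable]: "cball (a::'a::euclidean_space) r \<in> sets borel"
  by simp

text \<open>Uniqueness of Haar measure: evaluate \<open>\<integral>\<integral> f(x) g(x - y)\<close> in both orders for a symmetric \<open>g\<close>.\<close>

lemma translation_invariant_unique:
  fixes M N :: "'a::euclidean_space measure"
  assumes "sigma_finite_measure M" "sigma_finite_measure N"
    and setsM [measurable_cong]: "sets M = sets borel" and setsN [measurable_cong]: "sets N = sets borel"
    and invM: "\<And>a. distr M borel ((+) a) = M" and invN: "\<And>a. distr N borel ((+) a) = N"
    and eq: "emeasure M (ball 0 1) = emeasure N (ball 0 1)"
    and "emeasure N (ball 0 1) \<noteq> 0" "emeasure N (ball 0 1) \<noteq> \<infinity>"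
  shows "M = N"
proof (rule measure_eqI)
  show "sets M = sets N" by (simp add: setsM setsN)
  interpret M: sigma_finite_measure M by fact
  interpret N: sigma_finite_measure N by fact
  interpret P: pair_sigma_finite M N ..
  fix X assume "X \<in> sets M"
  then have [measurable]: "X \<in> sets borel" by (simp add: setsM)
  define f where "f = (indicator X :: 'a \<Rightarrow> ennreal)"
  define g where "g = (indicator (ball 0 1) :: 'a \<Rightarrow> ennreal)"
  have [measurable]: "f \<in> borel_measurable borel" "g \<in> borel_measurable borel"
    unfolding f_def g_def by (auto intro!: borel_measurable_indicator)
  have shiftM: "(\<integral>\<^sup>+y. h (a + y) \<partial>M) = (\<integral>\<^sup>+y. h y \<partial>M)"
    if [measurable]: "h \<in> borel_measurable borel" for h a
  proof -
    have "(\<integral>\<^sup>+y. h y \<partial>M) = (\<integral>\<^sup>+y. h y \<partial>(distr M borel ((+) a)))" by (simp add: invM)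
    also have "\<dots> = (\<integral>\<^sup>+y. h (a + y) \<partial>M)" by (rule nn_integral_distr) auto
    finally show ?thesis by simp
  qed
  have shiftN: "(\<integral>\<^sup>+y. h (a + y) \<partial>N) = (\<integral>\<^sup>+y. h y \<partial>N)"
    if [measurable]: "h \<in> borel_measurable borel" for h a
  proof -
    have "(\<integral>\<^sup>+y. h y \<partial>N) = (\<integral>\<^sup>+y. h y \<partial>(distr N borel ((+) a)))" by (simp add: invN)
    also have "\<dots> = (\<integral>\<^sup>+y. h (a + y) \<partial>N)" by (rule nn_integral_distr) auto
    finally show ?thesis by simp
  qed
  have gsym: "g (x - y) = g (y - x)" for x y
    by (auto simp: g_def indicator_def dist_norm norm_minus_commute)
  have "(\<integral>\<^sup>+x. (\<integral>\<^sup>+y. f x * g (x - y) \<partial>M) \<partial>N) = (\<integral>\<^sup>+x. f x * (\<integral>\<^sup>+y. g y \<partial>M) \<partial>N)"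
  proof (rule nn_integral_cong)
    fix x
    have "(\<integral>\<^sup>+y. f x * g (x - y) \<partial>M) = f x * (\<integral>\<^sup>+y. g (- x + y) \<partial>M)"
      by (subst gsym) (simp add: nn_integral_cmult algebra_simps)
    also have "(\<integral>\<^sup>+y. g (- x + y) \<partial>M) = (\<integral>\<^sup>+y. g y \<partial>M)" by (rule shiftM) simp
    finally show "(\<integral>\<^sup>+y. f x * g (x - y) \<partial>M) = f x * (\<integral>\<^sup>+y. g y \<partial>M)" .
  qed
  also have "\<dots> = emeasure N X * emeasure M (ball 0 1)"
    by (simp add: nn_integral_multc f_def g_def setsM setsN)
  finally have 1: "(\<integral>\<^sup>+x. (\<integral>\<^sup>+y. f x * g (x - y) \<partial>M) \<partial>N) = emeasure N X * emeasure M (ball 0 1)" .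
  have "(\<integral>\<^sup>+x. (\<integral>\<^sup>+y. f x * g (x - y) \<partial>M) \<partial>N) = (\<integral>\<^sup>+y. (\<integral>\<^sup>+x. f x * g (x - y) \<partial>N) \<partial>M)"
    by (rule P.Fubini') measurable
  also have "\<dots> = (\<integral>\<^sup>+y. (\<integral>\<^sup>+x. f (x + y) * g x \<partial>N) \<partial>M)"
  proof (rule nn_integral_cong)
    fix y
    show "(\<integral>\<^sup>+x. f x * g (x - y) \<partial>N) = (\<integral>\<^sup>+x. f (x + y) * g x \<partial>N)"
      using shiftN[of "\<lambda>x. f x * g (x - y)" y] by (simp add: add.commute)
  qed
  also have "\<dots> = (\<integral>\<^sup>+x. (\<integral>\<^sup>+y. f (x + y) * g x \<partial>M) \<partial>N)"
    by (rule P.Fubini'[symmetric]) measurable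
  also have "\<dots> = (\<integral>\<^sup>+x. emeasure M X * g x \<partial>N)"
    by (rule nn_integral_cong) (simp add: nn_integral_multc shiftM, simp add: f_def setsM)
  also have "\<dots> = emeasure M X * emeasure N (ball 0 1)"
    by (simp add: nn_integral_cmult_indicator g_def setsN)
  finally have "emeasure N X * emeasure N (ball 0 1) = emeasure M X * emeasure N (ball 0 1)"
    using 1 eq by simp
  then show "emeasure M X = emeasure N X"
    using assms(8,9) by (simp add: mult.commute[of _ "emeasure N (ball 0 1)"] ennreal_mult_cancel_left)
qed

text \<open>A rotation intertwines translations, \<open>a + c * z = c * (a / c + z)\<close>, so the
  push-forward is again translation invariant. It also preserves the unit disc, and uniqueness
  applies.\<close>

lemma lborel_distr_rotate:
  fixes c :: complex
  assumes c: "norm c = 1"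
  shows "distr lborel borel ((*) c) = lborel"
proof (rule translation_invariant_unique)
  have c0: "c \<noteq> 0" using c by auto
  have ball: "(*) c -` ball 0 1 = ball 0 1" by (auto simp: norm_mult c)
  show e: "emeasure (distr lborel borel ((*) c)) (ball 0 1) = emeasure lborel (ball (0::complex) 1)"
    by (subst emeasure_distr) (auto simp: ball)
  show "emeasure lborel (ball (0::complex) 1) \<noteq> 0" by (simp add: emeasure_ball unit_ball_vol_2)
  show "emeasure lborel (ball (0::complex) 1) \<noteq> \<infinity>"
    using emeasure_lborel_ball_finite[of "0::complex" 1] by simp
  have dp: "distr lborel borel ((+) a) = lborel" for a :: complex
    by (rule lborel_distr_plus)
  then show "distr lborel borel ((+) a) = lborel" for a :: complex .
  show "distr (distr lborel borel ((*) c)) borel ((+) a) = distr lborel borel ((*) c)" for a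
  proof -
    have "distr (distr lborel borel ((*) c)) borel ((+) a) = distr lborel borel (\<lambda>z. a + c * z)"
      by (subst distr_distr) (auto simp: o_def)
    also have "\<dots> = distr (distr lborel borel ((+) (a / c))) borel ((*) c)"
      by (subst distr_distr) (use c0 in \<open>auto simp: o_def distrib_left\<close>)
    finally show ?thesis by (simp add: dp)
  qed
  show "sigma_finite_measure (distr lborel borel ((*) c))"
  proof
    let ?A = "range (\<lambda>n::nat. ball (0::complex) n)"
    have "emeasure (distr lborel borel ((*) c)) (ball 0 (real n)) \<noteq> \<infinity>" for n
    proof -
      have "(*) c -` ball 0 (real n) = ball 0 n" by (auto simp: norm_mult c)
      then show ?thesis using emeasure_lborel_ball_finite[of "0::complex" n]
        by (subst emeasure_distr) auto
    qed
    moreover have "(\<Union>n::nat. ball (0::complex) n) = UNIV"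
      by (auto intro: reals_Archimedean2)
    ultimately show "\<exists>A. countable A \<and> A \<subseteq> sets (distr lborel borel ((*) c)) \<and>
        \<Union> A = space (distr lborel borel ((*) c)) \<and> (\<forall>a\<in>A. emeasure (distr lborel borel ((*) c)) a \<noteq> \<infinity>)"
      by (intro exI[of _ ?A]) auto
  qed
qed (auto simp: sigma_finite_lborel)


text \<open>Both measures are compared on the half-lines \<open>{..a}\<close>, where the left one is
  the area of a disc of radius \<open>min a 1\<close>.\<close>

lemma distr_norm_lborel_disc:
  "distr (density lborel (indicator (cball (0::complex) 1))) borel norm =
   density lborel (\<lambda>s::real. ennreal (2 * pi * s) * indicator {0..1} s)" (is "?M = ?N")
proof (rule measure_eqI_generator_eq)
  let ?E = "range (\<lambda>a::real. {..a})"
  show "Int_stable ?E" by (auto simp: Int_stable_def)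
  show "?E \<subseteq> Pow UNIV" by simp
  show "sets ?M = sigma_sets UNIV ?E" "sets ?N = sigma_sets UNIV ?E"
    by (simp_all add: borel_eq_atMost)
  have M: "emeasure ?M {..a} = ennreal (pi * (max 0 (min a 1))\<^sup>2)" for a
  proof -
    have "emeasure ?M {..a} = (\<integral>\<^sup>+z. indicator (cball (0::complex) 1) z * indicator {z. norm z \<le> a} z \<partial>lborel)"
      by (subst emeasure_distr) (auto simp: emeasure_density vimage_def intro!: nn_integral_cong split: split_indicator)
    also have "\<dots> = (\<integral>\<^sup>+z. indicator (cball (0::complex) (min a 1)) z \<partial>lborel)"
      by (intro nn_integral_cong) (auto split: split_indicator)
    also have "\<dots> = emeasure lborel (cball (0::complex) (min a 1))" by simp
    also have "\<dots> = ennreal (pi * (max 0 (min a 1))\<^sup>2)"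
    proof (cases "a < 0")
      case False
      then show ?thesis by (simp add: emeasure_cball unit_ball_vol_2 mult.commute max_def)
    qed auto
    finally show ?thesis .
  qed
  have N: "emeasure ?N {..a} = ennreal (pi * (max 0 (min a 1))\<^sup>2)" for a
  proof -
    have "emeasure ?N {..a} = (\<integral>\<^sup>+s. ennreal (2 * pi * s) * indicator {0..1} s * indicator {..a} s \<partial>lborel)"
      by (simp add: emeasure_density)
    also have "\<dots> = (\<integral>\<^sup>+s. ennreal (2 * pi * s) * indicator {0..max 0 (min a 1)} s \<partial>lborel)"
      using AE_lborel_singleton[of "0::real"]
      by (intro nn_integral_cong_AE, eventually_elim) (auto split: split_indicator)
    also have "\<dots> = ennreal (pi * (max 0 (min a 1))\<^sup>2 - pi * 0\<^sup>2)"
      by (rule nn_integral_FTC_Icc[where F = "\<lambda>s. pi * s\<^sup>2"])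
         (auto intro!: derivative_eq_intros)
    finally show ?thesis by simp
  qed
  show "emeasure ?M X = emeasure ?N X" if "X \<in> ?E" for X
    using that M N by auto
  show "range (\<lambda>n::nat. {..real n}) \<subseteq> ?E" by auto
  show "(\<Union>n::nat. {..real n}) = UNIV" by (auto intro: real_arch_simple)
  show "emeasure ?M {..real n} \<noteq> \<infinity>" for n by (simp add: M)
qed

text \<open>Periodicity: \<open>\<theta>\<close> is reduced modulo \<open>2 * pi\<close> to
  \<open>a\<close>, and the part of the shifted interval beyond \<open>2 * pi\<close> is moved back
  by one period.\<close>

lemma nn_integral_cis_shift:
  assumes [measurable]: "h \<in> borel_measurable borel"
  shows "(\<integral>\<^sup>+t. h (of_real \<rho> * (cis (t + \<theta>) :: complex)) * indicator {0..2*pi} t \<partial>lborel) =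
         (\<integral>\<^sup>+t. h (of_real \<rho> * cis t) * indicator {0..2*pi} t \<partial>lborel)"
proof -
  define H where "H t = h (of_real \<rho> * cis t)" for t
  have [measurable]: "H \<in> borel_measurable borel" unfolding H_def by (intro measurable_compose[OF _ assms] borel_measurable_continuous_onI continuous_intros)
  define n where "n = \<lfloor>\<theta> / (2*pi)\<rfloor>"
  define a where "a = \<theta> - 2 * pi * n"
  have a: "0 \<le> a" "a < 2 * pi"
    using floor_correct[of "\<theta> / (2*pi)"] unfolding a_def n_def[symmetric] by (auto simp: field_simps)
  have per: "H (t + 2 * pi) = H t" for t
    by (simp add: H_def cis_mult[symmetric])
  have "cis (t + \<theta>) = cis (t + a)" for t
  proof -
    have "cis (2 * pi * of_int n) = 1" by (rule cis_multiple_2pi) simp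
    then have "cis (t + a + 2 * pi * of_int n) = cis (t + a)" by (simp only: cis_mult[symmetric] mult_1_right)
    then show ?thesis by (simp add: a_def)
  qed
  then have "(\<integral>\<^sup>+t. h (of_real \<rho> * cis (t + \<theta>)) * indicator {0..2*pi} t \<partial>lborel) =
     (\<integral>\<^sup>+t. H (t + a) * indicator {0..2*pi} t \<partial>lborel)" by (simp add: H_def)
  also have "\<dots> = (\<integral>\<^sup>+t. H t * indicator {a..a + 2*pi} t \<partial>lborel)"
  proof -
    have "(\<integral>\<^sup>+t. H t * indicator {a..a + 2*pi} t \<partial>lborel) = ennreal \<bar>1\<bar> * (\<integral>\<^sup>+t. H (a + 1 * t) * indicator {a..a + 2*pi} (a + 1 * t) \<partial>lborel)"
      by (rule nn_integral_real_affine) auto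
    also have "\<dots> = (\<integral>\<^sup>+t. H (t + a) * indicator {0..2*pi} t \<partial>lborel)"
      by (simp, intro nn_integral_cong) (auto simp: add.commute split: split_indicator)
    finally show ?thesis by simp
  qed
  also have "\<dots> = (\<integral>\<^sup>+t. H t * indicator {a..2*pi} t + H t * indicator {2*pi<..a + 2*pi} t \<partial>lborel)"
    using a by (intro nn_integral_cong) (auto split: split_indicator)
  also have "\<dots> = (\<integral>\<^sup>+t. H t * indicator {a..2*pi} t \<partial>lborel) + (\<integral>\<^sup>+t. H t * indicator {2*pi<..a + 2*pi} t \<partial>lborel)"
    by (rule nn_integral_add) auto
  also have "(\<integral>\<^sup>+t. H t * indicator {2*pi<..a + 2*pi} t \<partial>lborel) = (\<integral>\<^sup>+t. H t * indicator {0<..a} t \<partial>lborel)"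
  proof -
    have "(\<integral>\<^sup>+t. H t * indicator {2*pi<..a + 2*pi} t \<partial>lborel) = ennreal \<bar>1\<bar> * (\<integral>\<^sup>+t. H (2*pi + 1 * t) * indicator {2*pi<..a + 2*pi} (2*pi + 1 * t) \<partial>lborel)"
      by (rule nn_integral_real_affine) auto
    also have "\<dots> = (\<integral>\<^sup>+t. H t * indicator {0<..a} t \<partial>lborel)"
      using per by (simp, intro nn_integral_cong) (auto simp: add.commute split: split_indicator)
    finally show ?thesis .
  qed
  also have "(\<integral>\<^sup>+t. H t * indicator {a..2*pi} t \<partial>lborel) + (\<integral>\<^sup>+t. H t * indicator {0<..a} t \<partial>lborel) =
      (\<integral>\<^sup>+t. H t * indicator {a..2*pi} t + H t * indicator {0<..a} t \<partial>lborel)"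
    by (rule nn_integral_add[symmetric]) auto
  also have "\<dots> = (\<integral>\<^sup>+t. H t * indicator {0..2*pi} t \<partial>lborel)"
  proof (rule nn_integral_cong_AE)
    show "AE t in lborel. H t * indicator {a..2*pi} t + H t * indicator {0<..a} t = H t * indicator {0..2*pi} t"
      using AE_lborel_singleton[of a] AE_lborel_singleton[of 0]
      by eventually_elim (use a in \<open>auto split: split_indicator\<close>)
  qed
  finally show ?thesis by (simp add: H_def)
qed

text \<open>Averaging over all rotations costs nothing by \<open>lborel_distr_rotate\<close>. After
  Fubini the inner integral is a shifted circle integral, so it depends on \<open>norm z\<close>
  alone and can be integrated against the distribution of the norm. The factor \<open>2 * pi\<close>
  of the average cancels the one in that distribution.\<close>

lemma nn_integral_polar:
  fixes h :: "complex \<Rightarrow> ennreal"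
  assumes [measurable]: "h \<in> borel_measurable borel"
  shows "(\<integral>\<^sup>+z. h z * indicator (cball 0 1) z \<partial>lborel) =
    (\<integral>\<^sup>+s. \<integral>\<^sup>+t. h (of_real s * cis t) * indicator {0..2*pi} t * (ennreal s * indicator {0..1} s) \<partial>lborel \<partial>lborel)"
proof -
  have cis_meas [measurable]: "cis \<in> borel_measurable borel"
    by (intro borel_measurable_continuous_onI continuous_intros)
  define A where "A s = (\<integral>\<^sup>+t. h (of_real s * cis t) * indicator {0..2*pi} t \<partial>lborel)" for s
  have [measurable]: "A \<in> borel_measurable borel" unfolding A_def by measurable
  let ?D = "cball (0::complex) 1"
  have inv: "(\<integral>\<^sup>+z. h (cis t * z) * indicator ?D z \<partial>lborel) = (\<integral>\<^sup>+z. h z * indicator ?D z \<partial>lborel)" for t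
  proof -
    have "(\<integral>\<^sup>+z. h z * indicator ?D z \<partial>lborel) = (\<integral>\<^sup>+z. h z * indicator ?D z \<partial>(distr lborel borel ((*) (cis t))))"
      by (simp add: lborel_distr_rotate)
    also have "\<dots> = (\<integral>\<^sup>+z. h (cis t * z) * indicator ?D (cis t * z) \<partial>lborel)"
      by (rule nn_integral_distr) auto
    also have "\<dots> = (\<integral>\<^sup>+z. h (cis t * z) * indicator ?D z \<partial>lborel)"
      by (intro nn_integral_cong) (auto simp: norm_mult split: split_indicator)
    finally show ?thesis by simp
  qed
  have "(\<integral>\<^sup>+z. h z * indicator ?D z \<partial>lborel) * ennreal (2 * pi) =
      (\<integral>\<^sup>+t. (\<integral>\<^sup>+z. h (cis t * z) * indicator ?D z \<partial>lborel) * indicator {0..2*pi} t \<partial>lborel)"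
    by (simp add: inv nn_integral_cmult)
  also have "\<dots> = (\<integral>\<^sup>+t. \<integral>\<^sup>+z. h (cis t * z) * indicator ?D z * indicator {0..2*pi} t \<partial>lborel \<partial>lborel)"
    by (simp add: nn_integral_multc)
  also have "\<dots> = (\<integral>\<^sup>+z. \<integral>\<^sup>+t. h (cis t * z) * indicator ?D z * indicator {0..2*pi} t \<partial>lborel \<partial>lborel)"
    by (rule lborel_pair.Fubini') measurable
  also have "\<dots> = (\<integral>\<^sup>+z. indicator ?D z * A (norm z) \<partial>lborel)"
  proof (rule nn_integral_cong)
    fix z :: complex
    have z: "cis t * z = of_real (norm z) * cis (t + Arg z)" for t
      by (metis cis_mult mult.left_commute rcis_cmod_Arg rcis_def)
    have "(\<integral>\<^sup>+t. h (cis t * z) * indicator ?D z * indicator {0..2*pi} t \<partial>lborel) =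
        indicator ?D z * (\<integral>\<^sup>+t. h (of_real (norm z) * cis (t + Arg z)) * indicator {0..2*pi} t \<partial>lborel)"
      unfolding z by (subst nn_integral_cmult[symmetric]) (auto simp: mult_ac)
    then show "(\<integral>\<^sup>+t. h (cis t * z) * indicator ?D z * indicator {0..2*pi} t \<partial>lborel) = indicator ?D z * A (norm z)"
      by (simp add: nn_integral_cis_shift A_def)
  qed
  also have "\<dots> = (\<integral>\<^sup>+s. A s \<partial>(distr (density lborel (indicator ?D)) borel norm))"
    by (simp add: nn_integral_distr nn_integral_density)
  also have "\<dots> = (\<integral>\<^sup>+s. ennreal (2 * pi) * (A s * (ennreal s * indicator {0..1} s)) \<partial>lborel)"
    unfolding distr_norm_lborel_disc
    by (subst nn_integral_density) (auto intro!: nn_integral_cong simp: ennreal_mult' mult_ac split: split_indicator)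
  also have "\<dots> = ennreal (2 * pi) * (\<integral>\<^sup>+s. A s * (ennreal s * indicator {0..1} s) \<partial>lborel)"
    by (rule nn_integral_cmult) auto
  finally have "(\<integral>\<^sup>+z. h z * indicator ?D z \<partial>lborel) = (\<integral>\<^sup>+s. A s * (ennreal s * indicator {0..1} s) \<partial>lborel)"
    by (subst (asm) mult.commute) (simp add: ennreal_mult_cancel_left)
  also have "\<dots> = (\<integral>\<^sup>+s. \<integral>\<^sup>+t. h (of_real s * cis t) * indicator {0..2*pi} t * (ennreal s * indicator {0..1} s) \<partial>lborel \<partial>lborel)"
    by (simp add: A_def nn_integral_multc)
  finally show ?thesis .
qed

definition polar_density :: "real \<times> real \<Rightarrow> real" where
  "polar_density p = fst p * indicator ({0..1} \<times> {0..2*pi}) p"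

lemma polar_density_measurable [measurable]: "polar_density \<in> borel_measurable (lborel \<Otimes>\<^sub>M lborel)"
proof -
  have [measurable]: "{0..1::real} \<times> {0..2*pi} \<in> sets (borel \<Otimes>\<^sub>M borel)" by (intro pair_measureI) auto
  show ?thesis unfolding polar_density_def by measurable
qed

text \<open>As an identity of measures, polar coordinates carry over from nonnegative functions to
  Bochner integrals of complex functions.\<close>

lemma lborel_disc_polar:
  "density lborel (indicator (cball (0::complex) 1)) =
   distr (density (lborel \<Otimes>\<^sub>M lborel) (\<lambda>p. ennreal (polar_density p))) borel (\<lambda>(s, t). of_real s * cis t)"
  (is "?M = distr ?P borel ?f")
proof (rule measure_eqI)
  have [measurable]: "cis \<in> borel_measurable borel"
    by (intro borel_measurable_continuous_onI continuous_intros)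
  fix X assume "X \<in> sets ?M"
  then have [measurable]: "X \<in> sets borel" by simp
  have [measurable]: "?f \<in> borel_measurable (lborel \<Otimes>\<^sub>M lborel)" by measurable
  have "emeasure ?M X = (\<integral>\<^sup>+z. indicator X z * indicator (cball 0 1) z \<partial>lborel)"
    by (simp add: emeasure_density mult.commute)
  also have "\<dots> = (\<integral>\<^sup>+s. \<integral>\<^sup>+t. indicator X (?f (s, t)) * ennreal (polar_density (s, t)) \<partial>lborel \<partial>lborel)"
    by (subst nn_integral_polar) (auto simp: polar_density_def intro!: nn_integral_cong split: split_indicator)
  also have "\<dots> = (\<integral>\<^sup>+p. indicator X (?f p) * ennreal (polar_density p) \<partial>(lborel \<Otimes>\<^sub>M lborel))"
    by (rule lborel.nn_integral_fst) measurable
  also have "\<dots> = (\<integral>\<^sup>+p. indicator X (?f p) \<partial>?P)"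
    by (subst nn_integral_density) (auto simp: mult.commute)
  also have "\<dots> = (\<integral>\<^sup>+z. indicator X z \<partial>distr ?P borel ?f)"
    by (subst nn_integral_distr) auto
  finally show "emeasure ?M X = emeasure (distr ?P borel ?f) X" by simp
qed simp

text \<open>The circle integrals enter as \<open>has_integral\<close> facts, so that exact values
  from Cauchy's formula can be inserted.\<close>

lemma set_integral_disc_polar:
  fixes F :: "complex \<Rightarrow> complex"
  assumes F: "set_integrable lborel (ball 0 1) F" and cont: "continuous_on (ball 0 1) F"
    and I: "\<And>s. 0 \<le> s \<Longrightarrow> s < 1 \<Longrightarrow> ((\<lambda>t. F (of_real s * cis t)) has_integral I s) {0..2*pi}"
  shows "(LINT z:ball 0 1|lborel. F z) = (LINT s|lborel. indicator {0..<1} s *\<^sub>R (of_real s * I s))"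
proof -
  have [measurable]: "cis \<in> borel_measurable borel"
    by (intro borel_measurable_continuous_onI continuous_intros)
  define G where "G z = indicator (ball 0 1) z *\<^sub>R F z" for z
  have [measurable]: "G \<in> borel_measurable borel"
    unfolding G_def by (rule borel_measurable_continuous_on_indicator[OF _ cont]) simp
  let ?f = "\<lambda>(s, t). of_real s * cis t :: complex"
  have [measurable]: "?f \<in> borel_measurable (lborel \<Otimes>\<^sub>M lborel)" by measurable
  have dens: "density lborel (indicator (cball (0::complex) 1)) =
      density lborel (\<lambda>z. ennreal (indicator (cball (0::complex) 1) z))"
    by (simp add: ennreal_indicator)
  have G_eq: "indicator (cball (0::complex) 1) z *\<^sub>R G z = G z" for z
    by (auto simp: G_def split: split_indicator)
  have int: "integrable lborel G" using F unfolding set_integrable_def G_def .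
  have pd0: "AE p in lborel \<Otimes>\<^sub>M lborel. 0 \<le> polar_density p"
    by (intro AE_I2) (auto simp: polar_density_def split: split_indicator)
  have "integrable (density lborel (indicator (cball (0::complex) 1))) G"
    unfolding dens by (subst integrable_density) (auto simp: G_eq int)
  then have "integrable (density (lborel \<Otimes>\<^sub>M lborel) (\<lambda>p. ennreal (polar_density p))) (\<lambda>p. G (?f p))"
    unfolding lborel_disc_polar by (subst (asm) integrable_distr_eq) auto
  then have int2: "integrable (lborel \<Otimes>\<^sub>M lborel) (\<lambda>p. polar_density p *\<^sub>R G (?f p))"
    by (subst (asm) integrable_density) (use pd0 in auto)
  have "(LINT z:ball 0 1|lborel. F z) = (LINT z|lborel. G z)"
    by (simp add: set_lebesgue_integral_def G_def)
  also have "\<dots> = (\<integral>z. G z \<partial>(density lborel (indicator (cball (0::complex) 1))))"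
    unfolding dens by (subst integral_density) (auto simp: G_eq)
  also have "\<dots> = (\<integral>p. G (?f p) \<partial>(density (lborel \<Otimes>\<^sub>M lborel) (\<lambda>p. ennreal (polar_density p))))"
    unfolding lborel_disc_polar by (subst integral_distr) auto
  also have "\<dots> = (\<integral>p. polar_density p *\<^sub>R G (?f p) \<partial>(lborel \<Otimes>\<^sub>M lborel))"
    by (subst integral_density) (use pd0 in auto)
  also have "\<dots> = (LINT s|lborel. LINT t|lborel. polar_density (s, t) *\<^sub>R G (?f (s, t)))"
    using lborel_pair.integral_fst'[OF int2] by simp
  also have "\<dots> = (LINT s|lborel. indicator {0..<1} s *\<^sub>R (of_real s * I s))"
  proof (rule Bochner_Integration.integral_cong)
    fix s :: real
    show "(LINT t|lborel. polar_density (s, t) *\<^sub>R G (?f (s, t))) = indicator {0..<1} s *\<^sub>R (of_real s * I s)"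
    proof (cases "s \<in> {0..<1}")
      case True
      then have s: "0 \<le> s" "s < 1" by auto
      have "continuous_on {0..2*pi} (\<lambda>t. F (of_real s * cis t))"
        by (intro continuous_on_compose2[OF cont] continuous_intros) (use s in \<open>auto simp: norm_mult\<close>)
      then have si: "set_integrable lborel {0..2*pi} (\<lambda>t. F (of_real s * cis t))"
        by (rule borel_integrable_atLeastAtMost')
      have "(LINT t|lborel. polar_density (s, t) *\<^sub>R G (?f (s, t))) =
          (LINT t|lborel. of_real s * (indicator {0..2*pi} t *\<^sub>R F (of_real s * cis t)))"
        using s by (intro Bochner_Integration.integral_cong)
          (auto simp: polar_density_def G_def norm_mult scaleR_conv_of_real split: split_indicator)
      also have "\<dots> = of_real s * (LINT t:{0..2*pi}|lborel. F (of_real s * cis t))"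
        unfolding set_lebesgue_integral_def by (rule integral_mult_right_zero)
      also have "\<dots> = of_real s * I s"
        using set_borel_integral_eq_integral(2)[OF si] integral_unique[OF I[OF s]] by simp
      finally show ?thesis using True by simp
    next
      case False
      then have "polar_density (s, t) *\<^sub>R G (?f (s, t)) = 0" for t
        by (auto simp: polar_density_def G_def norm_mult split: split_indicator)
      then show ?thesis using False by (simp del: scaleR_eq_0_iff)
    qed
  qed simp
  finally show ?thesis .
qed

section \<open>Circle integrals from Cauchy's formula\<close>

text \<open>Cauchy's formula for derivatives with \<open>d\<zeta> = \<i> \<zeta> dt\<close>, which
  is the source of the extra factor \<open>of_real s * cis t\<close>. Only continuity is asked on
  the closed disc, so the case \<open>s = 1\<close> is available for the boundary integrals in the
  proof of outerness.\<close>

lemma cauchy_circle_integral: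
  assumes "continuous_on (cball 0 s) h" "h holomorphic_on ball 0 s" "norm w < s"
  shows "((\<lambda>t. h (of_real s * cis t) * (of_real s * cis t) / (of_real s * cis t - w) ^ Suc k)
    has_integral (2 * of_real pi / fact k * (deriv ^^ k) h w)) {0..2*pi}"
proof -
  have "((\<lambda>u. h u / (u - w) ^ Suc k) has_contour_integral ((2 * pi * \<i>) / fact k * (deriv ^^ k) h w))
      (part_circlepath 0 s 0 (2*pi))"
    using Cauchy_has_contour_integral_higher_derivative_circlepath[OF assms(1,2), of w k] assms(3)
    by (simp add: circlepath_def)
  then have "((\<lambda>t. h (0 + s * cis t) / ((0 + s * cis t) - w) ^ Suc k * s * \<i> * cis t)
      has_integral ((2 * pi * \<i>) / fact k * (deriv ^^ k) h w)) {0..2*pi}"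
    by (subst (asm) has_contour_integral_part_circlepath_iff) auto
  from has_integral_mult_right[OF this, of "-\<i>"]
  show ?thesis by (simp add: mult_ac del: power_Suc)
qed

text \<open>On the circle \<open>\<zeta> * cnj \<zeta> = s ^ 2\<close>, hence
  \<open>\<zeta> ^ k * cnj (g \<zeta>)\<close> is \<open>s ^ (2 * k)\<close> times the conjugate of
  \<open>g \<zeta> / \<zeta> ^ k\<close>, and Cauchy's formula picks out a Taylor coefficient of
  \<open>g\<close>.\<close>

lemma circle_integral_power_cnj:
  assumes g: "g holomorphic_on ball 0 1" and s: "0 \<le> s" "s < 1"
  shows "((\<lambda>t. (of_real s * cis t) ^ k * cnj (g (of_real s * cis t)))
    has_integral (2 * of_real pi * of_real s ^ (2*k) * cnj ((deriv ^^ k) g 0 / fact k))) {0..2*pi}"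
proof (cases "s = 0")
  case True
  have "((\<lambda>t::real. 0 ^ k * cnj (g 0)) has_integral (2*pi - 0) *\<^sub>R (0 ^ k * cnj (g 0))) {0..2*pi}"
    using has_integral_const_real[of "0 ^ k * cnj (g 0)" 0 "2*pi"] by simp
  then show ?thesis using True by (cases k) (auto simp: scaleR_conv_of_real)
next
  case False
  with s have "s > 0" by simp
  have "continuous_on (cball 0 s) g" "g holomorphic_on ball 0 s"
    using s by (auto intro!: holomorphic_on_imp_continuous_on intro: holomorphic_on_subset[OF g])
  from cauchy_circle_integral[OF this, of 0 k] \<open>s > 0\<close>
  have "((\<lambda>t. g (of_real s * cis t) * (of_real s * cis t) / (of_real s * cis t) ^ Suc k)
    has_integral (2 * of_real pi / fact k * (deriv ^^ k) g 0)) {0..2*pi}" by (simp del: power_Suc)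
  from has_integral_mult_right[OF has_integral_cnj[THEN iffD2, OF this], of "of_real s ^ (2*k)"]
  have *: "((\<lambda>t. of_real s ^ (2*k) * cnj (g (of_real s * cis t) * (of_real s * cis t) / (of_real s * cis t) ^ Suc k))
    has_integral (of_real s ^ (2*k) * cnj (2 * of_real pi / fact k * (deriv ^^ k) g 0))) {0..2*pi}"
    by (simp add: o_def)
  have "of_real s ^ (2*k) * cnj (g (of_real s * cis t) * (of_real s * cis t) / (of_real s * cis t) ^ Suc k) =
      (of_real s * cis t) ^ k * cnj (g (of_real s * cis t))" for t
  proof -
    define \<zeta> where "\<zeta> = of_real s * cis t"
    have "\<zeta> \<noteq> 0" using \<open>s > 0\<close> by (simp add: \<zeta>_def)
    have "\<zeta> * cnj \<zeta> = of_real s ^ 2"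
      by (simp add: \<zeta>_def cis_cnj cis_mult power2_eq_square field_simps)
    then have "of_real s ^ (2*k) = \<zeta> ^ k * cnj \<zeta> ^ k"
      by (simp add: power_mult power_mult_distrib[symmetric])
    then show ?thesis using \<open>\<zeta> \<noteq> 0\<close>
      unfolding \<zeta>_def[symmetric] by (simp add: field_simps)
  qed
  with * show ?thesis by (simp add: mult_ac)
qed

section \<open>The pairing as an area integral\<close>

text \<open>The mean value inequality on the disc of radius \<open>norm z\<close>. The bound is
  cruder than a logarithm, but after division by \<open>z\<close> it has the same order as the
  derivative term in \<open>bloch_kernel\<close>.\<close>

lemma bloch_growth:
  assumes F: "F holomorphic_on ball 0 1" and C: "\<And>z. z \<in> ball 0 1 \<Longrightarrow> (1 - norm z) * norm (deriv F z) \<le> C"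
    and z: "z \<in> ball 0 1"
  shows "norm (F z - F 0) \<le> C * norm z / (1 - norm z)"
proof -
  have z1: "norm z < 1" using z by simp
  have "norm (F z - F 0) \<le> C / (1 - norm z) * norm (z - 0)"
  proof (rule field_differentiable_bound[of "cball 0 (norm z)" F "deriv F"])
    fix w assume "w \<in> cball (0::complex) (norm z)"
    then have w: "norm w \<le> norm z" "w \<in> ball 0 1" using z1 by auto
    show "(F has_field_derivative deriv F w) (at w within cball 0 (norm z))"
      using holomorphic_derivI[OF F open_ball w(2)] by (rule has_field_derivative_at_within)
    have "(1 - norm z) * norm (deriv F w) \<le> (1 - norm w) * norm (deriv F w)"
      using w by (intro mult_right_mono) auto
    also have "\<dots> \<le> C" by (rule C[OF w(2)])
    finally show "norm (deriv F w) \<le> C / (1 - norm z)" using z1 by (simp add: field_simps)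
  qed auto
  then show ?thesis by simp
qed

text \<open>This is \<open>((z F(\<rho>z))' - F(0)) / z\<close>, with Taylor coefficients \<open>(k + 2) a\<^bsub>k+1\<^esub> \<rho>\<^bsup>k+1\<^esup>\<close>.
  The factor \<open>k + 2\<close> cancels the one in the moments of \<open>cnj g'\<close> against the weight \<open>1 - \<bar>z\<bar>\<^sup>2\<close>, which
  turns the circle pairing into an absolutely convergent area integral.\<close>

definition bloch_kernel :: "(complex \<Rightarrow> complex) \<Rightarrow> real \<Rightarrow> complex \<Rightarrow> complex" where
  "bloch_kernel F \<rho> z = (F (of_real \<rho> * z) - F 0) / z + of_real \<rho> * deriv F (of_real \<rho> * z)"

text \<open>The bound is uniform in \<open>\<rho>\<close> up to and including 1; this is what
  provides a dominating function when \<open>\<rho>\<close> tends to 1.\<close>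

lemma bloch_kernel_bound:
  assumes F: "F holomorphic_on ball 0 1" and C: "\<And>z. z \<in> ball 0 1 \<Longrightarrow> (1 - norm z) * norm (deriv F z) \<le> C"
    and \<rho>: "0 \<le> \<rho>" "\<rho> \<le> 1" and z: "z \<in> ball 0 1"
  shows "(1 - norm z) * norm (bloch_kernel F \<rho> z) \<le> 2 * C"
proof -
  have z1: "norm z < 1" using z by simp
  let ?w = "of_real \<rho> * z"
  have nw: "norm ?w = \<rho> * norm z" using \<rho> by (simp add: norm_mult)
  have le: "\<rho> * norm z \<le> norm z" using \<rho> by (simp add: mult_left_le_one_le)
  have w: "?w \<in> ball 0 1" using z1 le nw by simp
  have "C \<ge> 0" using C[of 0] order_trans[OF norm_ge_zero[of "deriv F 0"]] by simp
  have "norm ((F ?w - F 0) / z) \<le> C / (1 - norm z)"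
  proof (cases "z = 0")
    case False
    have "norm (F ?w - F 0) \<le> C * (\<rho> * norm z) / (1 - \<rho> * norm z)"
      using bloch_growth[OF F C w] nw by simp
    also have "\<dots> \<le> C * norm z / (1 - norm z)"
      using \<open>C \<ge> 0\<close> le z1 \<rho> by (intro frac_le mult_left_mono) auto
    finally show ?thesis using False by (simp add: norm_divide field_simps)
  qed (use \<open>C \<ge> 0\<close> z1 in auto)
  moreover have "norm (of_real \<rho> * deriv F ?w) \<le> C / (1 - norm z)"
  proof -
    have "norm (of_real \<rho> * deriv F ?w) \<le> norm (deriv F ?w)"
      using \<rho> by (simp add: norm_mult mult_left_le_one_le)
    moreover have "(1 - norm z) * norm (deriv F ?w) \<le> (1 - norm ?w) * norm (deriv F ?w)"
      using nw le by (intro mult_right_mono) auto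
    moreover have "(1 - norm z) * norm (of_real \<rho> * deriv F ?w) \<le> (1 - norm z) * norm (deriv F ?w)"
      using calculation(1) z1 by (intro mult_left_mono) auto
    ultimately have "(1 - norm z) * norm (of_real \<rho> * deriv F ?w) \<le> C"
      using C[OF w] by linarith
    then show ?thesis using z1 by (simp add: field_simps)
  qed
  ultimately have "norm (bloch_kernel F \<rho> z) \<le> C / (1 - norm z) + C / (1 - norm z)"
    unfolding bloch_kernel_def
    using norm_triangle_ineq[of "(F ?w - F 0) / z" "of_real \<rho> * deriv F ?w"] by linarith
  also have "\<dots> = 2 * C / (1 - norm z)" by (simp add: add_divide_distrib[symmetric])
  finally show ?thesis using z1 by (simp add: field_simps)
qed

lemma power_series_zero:
  assumes "F holomorphic_on ball 0 1" "z \<in> ball 0 1"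
  shows "(\<lambda>k. (deriv ^^ k) F 0 / fact k * z ^ k) sums F z"
  using holomorphic_power_series[OF assms] by simp

lemma power_series_deriv_zero:
  assumes "F holomorphic_on ball 0 1" "z \<in> ball 0 1"
  shows "(\<lambda>k. of_nat (Suc k) * ((deriv ^^ Suc k) F 0 / fact (Suc k)) * z ^ k) sums deriv F z"
proof -
  have "deriv F holomorphic_on ball 0 1" using assms by (intro holomorphic_deriv) auto
  from power_series_zero[OF this assms(2)]
  show ?thesis by (simp add: funpow_swap1 del: of_nat_Suc)
qed

lemma bloch_kernel_sums:
  fixes F
  defines "a \<equiv> \<lambda>k. (deriv ^^ k) F 0 / fact k"
  assumes F: "F holomorphic_on ball 0 1" and \<rho>: "0 \<le> \<rho>" "\<rho> < 1" and z: "z \<in> ball 0 1" "z \<noteq> 0"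
  shows "(\<lambda>k. of_nat (k + 2) * a (Suc k) * of_real \<rho> ^ Suc k * z ^ k) sums bloch_kernel F \<rho> z"
proof -
  let ?w = "of_real \<rho> * z"
  have w: "?w \<in> ball 0 1" using z \<rho>
    by (simp add: norm_mult) (metis mult_left_le_one_le norm_ge_zero order_le_less_trans less_imp_le)
  have "(\<lambda>k. a (Suc k) * ?w ^ Suc k) sums (F ?w - F 0)"
    using power_series_zero[OF F w] by (subst sums_Suc_iff) (simp add: a_def)
  from sums_divide[OF this, of z]
  have "(\<lambda>k. a (Suc k) * of_real \<rho> ^ Suc k * z ^ k) sums ((F ?w - F 0) / z)"
    using z by (simp add: power_mult_distrib field_simps)
  moreover have "(\<lambda>k. of_real \<rho> * (of_nat (Suc k) * a (Suc k) * ?w ^ k)) sums (of_real \<rho> * deriv F ?w)"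
    using sums_mult[OF power_series_deriv_zero[OF F w]] by (simp add: a_def)
  ultimately have "(\<lambda>k. a (Suc k) * of_real \<rho> ^ Suc k * z ^ k + of_real \<rho> * (of_nat (Suc k) * a (Suc k) * ?w ^ k))
     sums bloch_kernel F \<rho> z"
    unfolding bloch_kernel_def by (rule sums_add)
  moreover have "a (Suc k) * of_real \<rho> ^ Suc k * z ^ k + of_real \<rho> * (of_nat (Suc k) * a (Suc k) * ?w ^ k)
     = of_nat (k + 2) * a (Suc k) * of_real \<rho> ^ Suc k * z ^ k" for k
    by (simp add: power_mult_distrib algebra_simps)
  ultimately show ?thesis by simp
qed

lemma bloch_kernel_summable:
  fixes F
  defines "a \<equiv> \<lambda>k. (deriv ^^ k) F 0 / fact k"
  assumes F: "F holomorphic_on ball 0 1" and \<rho>: "0 \<le> \<rho>" "\<rho> < 1"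
  shows "summable (\<lambda>k. norm (a k * of_real \<rho> ^ k))"
    and "summable (\<lambda>k. norm (of_nat (k + 2) * a (Suc k) * of_real \<rho> ^ Suc k))"
proof -
  obtain x where x: "\<rho> < x" "x < 1" using \<rho>(2) dense by blast
  have xb: "of_real x \<in> ball (0::complex) 1" using x \<rho> by simp
  have nx: "norm (of_real \<rho> :: complex) < norm (of_real x :: complex)" using x \<rho> by simp
  show 1: "summable (\<lambda>k. norm (a k * of_real \<rho> ^ k))"
    using powser_insidea[OF sums_summable[OF power_series_zero[OF F xb]] nx] by (simp add: a_def)
  have 2: "summable (\<lambda>k. norm (of_nat (Suc k) * a (Suc k) * of_real \<rho> ^ k))"
    using powser_insidea[OF sums_summable[OF power_series_deriv_zero[OF F xb]] nx] by (simp add: a_def)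
  have "summable (\<lambda>k. norm (a (Suc k) * of_real \<rho> ^ Suc k) + \<rho> * norm (of_nat (Suc k) * a (Suc k) * of_real \<rho> ^ k))"
    using 1 2 by (intro summable_add summable_mult) (simp_all only: summable_Suc_iff[of "\<lambda>k. norm (a k * of_real \<rho> ^ k)"])
  then show "summable (\<lambda>k. norm (of_nat (k + 2) * a (Suc k) * of_real \<rho> ^ Suc k))"
  proof (rule summable_comparison_test'[of _ 0])
    fix k
    have "of_nat (k + 2) * a (Suc k) * of_real \<rho> ^ Suc k =
       a (Suc k) * of_real \<rho> ^ Suc k + of_real \<rho> * (of_nat (Suc k) * a (Suc k) * of_real \<rho> ^ k)"
      by (simp add: algebra_simps)
    also have "norm \<dots> \<le> norm (a (Suc k) * of_real \<rho> ^ Suc k) + \<rho> * norm (of_nat (Suc k) * a (Suc k) * of_real \<rho> ^ k)"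
      by (rule order_trans[OF norm_triangle_ineq]) (use \<rho> in \<open>simp add: norm_mult\<close>)
    finally show "norm (norm (of_nat (k + 2) * a (Suc k) * of_real \<rho> ^ Suc k)) \<le>
       norm (a (Suc k) * of_real \<rho> ^ Suc k) + \<rho> * norm (of_nat (Suc k) * a (Suc k) * of_real \<rho> ^ k)" by simp
  qed
qed

section \<open>Area integrals against the derivative of a function in \<open>W1\<close>\<close>

lemma W1_holo: "g \<in> W1 \<Longrightarrow> g holomorphic_on ball 0 1"
  by (simp add: W1_def)

lemma W1_int: "g \<in> W1 \<Longrightarrow> set_integrable lborel (ball 0 1) (\<lambda>z. norm (deriv g z))"
  by (simp add: W1_def)

lemma W1_deriv_cont: "g \<in> W1 \<Longrightarrow> continuous_on (ball 0 1) (deriv g)"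
  by (intro holomorphic_on_imp_continuous_on holomorphic_deriv W1_holo) auto

text \<open>Continuity is required on the punctured disc only: division by zero gives the quotient
  in \<open>bloch_kernel\<close> the value 0 at the origin, which need not be its limit
  there.\<close>

lemma W1_set_integrable_mult:
  assumes g: "g \<in> W1" and P: "continuous_on (ball 0 1 - {0}) P"
    and B: "\<And>z. z \<in> ball 0 1 \<Longrightarrow> z \<noteq> 0 \<Longrightarrow> norm (P z) \<le> B"
  shows "set_integrable lborel (ball 0 1) (\<lambda>z. P z * cnj (deriv g z))"
proof -
  have i: "set_integrable lborel (ball 0 1 - {0}) (\<lambda>z. B * norm (deriv g z))"
    using set_integrable_mult_right[OF set_integrable_subset[OF W1_int[OF g], of "ball 0 1 - {0}"]] by auto
  have "set_integrable lborel (ball 0 1 - {0}) (\<lambda>z. P z * cnj (deriv g z))"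
  proof (rule set_integrable_bound[OF i])
    show "set_borel_measurable lborel (ball 0 1 - {0}) (\<lambda>z. P z * cnj (deriv g z))"
    proof -
      have "(\<lambda>z. indicator (ball 0 1 - {0}) z *\<^sub>R (P z * cnj (deriv g z))) \<in> borel_measurable borel"
        by (intro borel_measurable_continuous_on_indicator continuous_intros P
          continuous_on_subset[OF W1_deriv_cont[OF g]]) auto
      then show ?thesis unfolding set_borel_measurable_def by simp
    qed
    have "norm (P z * cnj (deriv g z)) \<le> norm (B * norm (deriv g z))" if "z \<in> ball 0 1 - {0}" for z
    proof -
      have "norm (P z) \<le> \<bar>B\<bar>" using B[of z] that by auto
      then show ?thesis by (auto simp: norm_mult abs_mult intro!: mult_right_mono)
    qed
    then show "AE x in lborel. x \<in> ball 0 1 - {0} \<longrightarrow> norm (P x * cnj (deriv g x)) \<le> norm (B * norm (deriv g x))"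
      by auto
  qed
  moreover have "set_integrable lborel {0} (\<lambda>z. P z * cnj (deriv g z))"
  proof -
    have "(\<lambda>z. indicator {0} z *\<^sub>R (P z * cnj (deriv g z))) = (\<lambda>z. indicator {0} z *\<^sub>R (P 0 * cnj (deriv g 0)))"
      by (auto split: split_indicator)
    then show ?thesis unfolding set_integrable_def by (simp only:) simp
  qed
  ultimately have "set_integrable lborel ((ball 0 1 - {0}) \<union> {0}) (\<lambda>z. P z * cnj (deriv g z))"
    by (intro set_integrable_Un) auto
  then show ?thesis by (simp add: insert_absorb)
qed

abbreviation tcoeff :: "(complex \<Rightarrow> complex) \<Rightarrow> nat \<Rightarrow> complex" where
  "tcoeff F k \<equiv> (deriv ^^ k) F 0 / fact k"

text \<open>The radial integral of \<open>(1 - s ^ 2) * s ^ (2 * k + 1)\<close> is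
  \<open>1 / (2 * (k + 1) * (k + 2))\<close>. Its factor \<open>k + 1\<close> cancels the one in the
  Taylor coefficients of \<open>deriv g\<close>, and \<open>k + 2\<close> stays behind.\<close>

lemma W1_moment:
  assumes g: "g \<in> W1"
  shows "(LINT z:ball 0 1|lborel. of_real (1 - (norm z)\<^sup>2) * z ^ k * cnj (deriv g z)) =
    of_real pi * cnj (tcoeff g (Suc k)) / of_nat (k + 2)"
proof -
  define c where "c = cnj ((deriv ^^ k) (deriv g) 0 / fact k)"
  have c: "c = of_nat (Suc k) * cnj (tcoeff g (Suc k))"
    unfolding c_def by (simp add: funpow_swap1 del: of_nat_Suc)
  let ?F = "\<lambda>z. of_real (1 - (norm z)\<^sup>2) * z ^ k * cnj (deriv g z)"
  define J where "J s = of_real (1 - s\<^sup>2) * (2 * of_real pi * of_real s ^ (2*k) * c)" for s :: real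
  have cont: "continuous_on (ball 0 1) ?F"
    by (intro continuous_intros W1_deriv_cont g)
  have i: "set_integrable lborel (ball 0 1) ?F"
  proof (rule W1_set_integrable_mult[OF g, of _ 1])
    fix z :: complex assume "z \<in> ball 0 1"
    then have "norm z < 1" by simp
    then have "\<bar>1 - (norm z)\<^sup>2\<bar> \<le> 1" "norm z ^ k \<le> 1"
      by (auto simp: abs_le_iff power_le_one intro: power_le_one)
    then show "norm (of_real (1 - (norm z)\<^sup>2) * z ^ k) \<le> 1"
      by (simp add: norm_mult norm_power mult_le_one del: of_real_diff)
  qed (intro continuous_intros)
  have "(LINT z:ball 0 1|lborel. ?F z) = (LINT s|lborel. indicator {0..<1} s *\<^sub>R (of_real s * J s))"
  proof (rule set_integral_disc_polar[OF i cont])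
    fix s :: real assume s: "0 \<le> s" "s < 1"
    have "deriv g holomorphic_on ball 0 1" by (intro holomorphic_deriv W1_holo g) auto
    from has_integral_mult_right[OF circle_integral_power_cnj[OF this s, of k], of "of_real (1 - s\<^sup>2)"]
    show "((\<lambda>t. ?F (of_real s * cis t)) has_integral J s) {0..2*pi}"
      unfolding J_def c_def using s by (simp add: norm_mult mult.assoc)
  qed
  also have "\<dots> = (LINT s|lborel. (2 * of_real pi * c) * of_real (indicator {0..1} s *\<^sub>R (s ^ (2*k+1) - s ^ (2*k+3))))"
    by (intro Bochner_Integration.integral_cong)
       (auto simp: J_def algebra_simps power2_eq_square power3_eq_cube power_add split: split_indicator)
  also have "\<dots> = (2 * of_real pi * c) * of_real (LINT s|lborel. indicator {0..1} s *\<^sub>R (s ^ (2*k+1) - s ^ (2*k+3)))"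
    by (subst integral_mult_right_zero) (simp only: integral_complex_of_real)
  also have "(LINT s|lborel. indicator {0..1} s *\<^sub>R (s ^ (2*k+1) - s ^ (2*k+3))) =
     ((\<lambda>s::real. s ^ (2*k+2) / real (2*k+2) - s ^ (2*k+4) / real (2*k+4)) 1
        - (\<lambda>s::real. s ^ (2*k+2) / real (2*k+2) - s ^ (2*k+4) / real (2*k+4)) 0)"
  proof (rule integral_FTC_atLeastAtMost)
    fix s :: real
    have D: "((\<lambda>s::real. s ^ Suc m / real (Suc m)) has_real_derivative s ^ m) (at s within {0..1})" for m
      using DERIV_cdivide[OF DERIV_pow[of "Suc m" s "{0..1}"], of "real (Suc m)"] by (simp del: of_nat_Suc power_Suc)
    have "2*k+2 = Suc (2*k+1)" "2*k+4 = Suc (2*k+3)" by auto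
    then show "((\<lambda>s::real. s ^ (2*k+2) / real (2*k+2) - s ^ (2*k+4) / real (2*k+4)) has_vector_derivative
        s ^ (2*k+1) - s ^ (2*k+3)) (at s within {0..1})"
      unfolding has_real_derivative_iff_has_vector_derivative[symmetric]
      by (simp only:) (intro DERIV_diff D)
  qed (auto intro!: continuous_intros)
  also have "\<dots> = 1 / real (2*k+2) - 1 / real (2*k+4)" by simp
  also have "2 * of_real pi * c * of_real (1 / real (2*k+2) - 1 / real (2*k+4)) =
      of_real pi * cnj (tcoeff g (Suc k)) / of_nat (k + 2)"
  proof -
    define x where "x = real k + 1"
    have "x > 0" by (simp add: x_def)
    then have x: "x \<noteq> 0" "x + 1 \<noteq> 0" by auto
    then have "of_real x \<noteq> (0::complex)" "of_real (x + 1) \<noteq> (0::complex)" by (simp_all only: of_real_eq_0_iff not_False_eq_True)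
    then have xc: "of_real x \<noteq> (0::complex)" "of_real x + 1 \<noteq> (0::complex)" by simp_all
    have r: "real (2*k+2) = 2 * x" "real (2*k+4) = 2 * (x + 1)"
      "of_nat (Suc k) = (of_real x :: complex)" "of_nat (k + 2) = (of_real x + 1 :: complex)"
      by (simp_all add: x_def algebra_simps)
    have "1 / (2 * x) - 1 / (2 * (x + 1)) = 1 / (2 * x * (x + 1))"
      using x(1,2) by (simp add: divide_simps)
    then show ?thesis unfolding c r using xc by (simp only:) (simp add: divide_simps)
  qed
  finally show ?thesis .
qed

text \<open>Parseval's formula. Only \<open>F\<close> is expanded, its series being absolutely
  convergent on the circle; the coefficients of \<open>g\<close> come from Cauchy's formula.\<close>

lemma circle_pairing_sums:
  assumes F: "F holomorphic_on ball 0 1" and g: "g holomorphic_on ball 0 1" and r: "0 \<le> r" "r < 1"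
  shows "(\<lambda>k. tcoeff F k * of_real r ^ (2*k) * cnj (tcoeff g k)) sums
    (integral {0..2*pi} (\<lambda>t. F (of_real r * cis t) * cnj (g (of_real r * cis t))) / of_real (2*pi))"
proof -
  have in_ball: "of_real r * cis t \<in> ball 0 1" for t using r by (simp add: norm_mult)
  have pi_nz: "complex_of_real (2*pi) \<noteq> 0" by simp
  have contF: "continuous_on {0..2*pi} (\<lambda>t. F (of_real r * cis t))"
    and contg: "continuous_on {0..2*pi} (\<lambda>t. g (of_real r * cis t))"
    using in_ball by (auto intro!: continuous_on_compose2[OF holomorphic_on_imp_continuous_on[OF F]]
        continuous_on_compose2[OF holomorphic_on_imp_continuous_on[OF g]] continuous_intros)
  define G where "G t = cnj (g (of_real r * cis t))" for t
  have contG: "continuous_on {0..2*pi} G" unfolding G_def by (intro continuous_intros contg)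
  have "compact (G ` {0..2*pi})" by (intro compact_continuous_image contG) auto
  then obtain B where B: "\<And>t. t \<in> {0..2*pi} \<Longrightarrow> norm (G t) \<le> B"
    by (meson bounded_iff compact_imp_bounded imageI)
  have "B \<ge> 0" using B[of 0] order_trans[OF norm_ge_zero] by auto
  define f where "f k t = indicator {0..2*pi} t *\<^sub>R (tcoeff F k * (of_real r * cis t) ^ k * G t)" for k t
  have si: "set_integrable lborel {0..2*pi} (\<lambda>t. tcoeff F k * (of_real r * cis t) ^ k * G t)" for k
    by (intro borel_integrable_atLeastAtMost' continuous_intros contG)
  have i: "integrable lborel (f k)" for k using si[of k] unfolding f_def set_integrable_def .
  have Ik: "(LINT t|lborel. f k t) = of_real (2*pi) * (tcoeff F k * of_real r ^ (2*k) * cnj (tcoeff g k))" for k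
  proof -
    have "(LINT t|lborel. f k t) = integral {0..2*pi} (\<lambda>t. tcoeff F k * (of_real r * cis t) ^ k * G t)"
      using set_borel_integral_eq_integral(2)[OF si[of k]] unfolding f_def set_lebesgue_integral_def .
    also have "((\<lambda>t. tcoeff F k * ((of_real r * cis t) ^ k * G t)) has_integral
        tcoeff F k * (2 * of_real pi * of_real r ^ (2*k) * cnj (tcoeff g k))) {0..2*pi}"
      unfolding G_def by (intro has_integral_mult_right circle_integral_power_cnj g r)
    then have "integral {0..2*pi} (\<lambda>t. tcoeff F k * (of_real r * cis t) ^ k * G t) =
        tcoeff F k * (2 * of_real pi * of_real r ^ (2*k) * cnj (tcoeff g k))"
      by (intro integral_unique) (simp only: mult.assoc)
    finally show ?thesis by (simp add: mult_ac)
  qed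
  have nf: "norm (f k t) \<le> norm (tcoeff F k * of_real r ^ k) * (B * indicator {0..2*pi} t)" for k t
    using B[of t] by (auto simp: f_def norm_mult norm_power norm_divide abs_of_nonneg intro!: mult_left_mono mult_right_mono divide_right_mono split: split_indicator)
  have sm: "summable (\<lambda>k. norm (tcoeff F k * of_real r ^ k))"
    by (rule bloch_kernel_summable(1)[OF F r])
  have sumF: "(\<Sum>k. f k t) = indicator {0..2*pi} t *\<^sub>R (F (of_real r * cis t) * G t)" for t
  proof -
    have "(\<lambda>k. f k t) sums (indicator {0..2*pi} t *\<^sub>R (F (of_real r * cis t) * G t))"
      unfolding f_def by (intro sums_scaleR_right sums_mult2 power_series_zero[OF F in_ball])
    then show ?thesis by (simp add: sums_iff)
  qed
  have "(\<lambda>k. LINT t|lborel. f k t) sums (LINT t|lborel. (\<Sum>k. f k t))"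
  proof (rule sums_integral[OF i])
    show "AE t in lborel. summable (\<lambda>k. norm (f k t))"
      using nf by (intro AE_I2 summable_comparison_test'[OF summable_mult2[OF sm], of 0]) auto
    show "summable (\<lambda>k. LINT t|lborel. norm (f k t))"
    proof (rule summable_comparison_test'[OF summable_mult2[OF sm, of "B * (2*pi)"], of 0])
      fix k
      have "(LINT t|lborel. norm (f k t)) \<le> (LINT t|lborel. norm (tcoeff F k * of_real r ^ k) * (B * indicator {0..2*pi} t))"
        by (intro integral_mono integrable_norm i nf) auto
      then show "norm (LINT t|lborel. norm (f k t)) \<le> norm (tcoeff F k * of_real r ^ k) * (B * (2*pi))"
        by (simp add: mult_ac)
    qed
  qed
  then have "(\<lambda>k. of_real (2*pi) * (tcoeff F k * of_real r ^ (2*k) * cnj (tcoeff g k))) sums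
      (LINT t:{0..2*pi}|lborel. F (of_real r * cis t) * G t)"
    unfolding Ik sumF set_lebesgue_integral_def .
  also have "(LINT t:{0..2*pi}|lborel. F (of_real r * cis t) * G t) = integral {0..2*pi} (\<lambda>t. F (of_real r * cis t) * G t)"
    by (intro set_borel_integral_eq_integral borel_integrable_atLeastAtMost' continuous_intros contF contG)
  finally have "(\<lambda>k. of_real (2*pi) * (tcoeff F k * of_real r ^ (2*k) * cnj (tcoeff g k))) sums
      integral {0..2*pi} (\<lambda>t. F (of_real r * cis t) * G t)" .
  from sums_divide[OF this, of "of_real (2*pi)"] show ?thesis
    unfolding G_def nonzero_mult_div_cancel_left[OF pi_nz] .
qed

lemma W1_measurable_mult:
  assumes g: "g \<in> W1" and P: "continuous_on (ball 0 1 - {0}) P"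
  shows "(\<lambda>z. indicator (ball 0 1) z *\<^sub>R (P z * cnj (deriv g z))) \<in> borel_measurable lborel"
proof -
  let ?h = "\<lambda>z. P z * cnj (deriv g z)"
  have m: "(\<lambda>z. indicator (ball 0 1 - {0}) z *\<^sub>R ?h z) \<in> borel_measurable borel"
    by (intro borel_measurable_continuous_on_indicator continuous_intros P
        continuous_on_subset[OF W1_deriv_cont[OF g]]) auto
  have "(\<lambda>z. indicator (ball 0 1) z *\<^sub>R ?h z) =
      (\<lambda>z. indicator (ball 0 1 - {0}) z *\<^sub>R ?h z + indicator {0} z *\<^sub>R ?h 0)"
    by (auto split: split_indicator)
  also have "\<dots> \<in> borel_measurable lborel" using m by simp
  finally show ?thesis .
qed

text \<open>At \<open>\<rho> = r ^ 2\<close> this is the circle mean of radius \<open>r\<close>, at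
  \<open>\<rho> = 1\<close> it is the limit. The dilation is put on \<open>F\<close> alone, so the
  integrable function \<open>norm (deriv g z)\<close> remains the same for all
  \<open>\<rho>\<close>.\<close>

definition bloch_area_pair :: "(complex \<Rightarrow> complex) \<Rightarrow> real \<Rightarrow> (complex \<Rightarrow> complex) \<Rightarrow> complex" where
  "bloch_area_pair F \<rho> g = F 0 * cnj (g 0) +
     (LINT z:ball 0 1|lborel. of_real (1 - (norm z)\<^sup>2) * bloch_kernel F \<rho> z * cnj (deriv g z)) / of_real pi"

lemma bloch_kernel_continuous:
  assumes F: "F holomorphic_on ball 0 1" and \<rho>: "0 \<le> \<rho>" "\<rho> \<le> 1"
  shows "continuous_on (ball 0 1 - {0}) (bloch_kernel F \<rho>)"
proof -
  have "norm (of_real \<rho> * z) < 1" if "norm z < 1" for z :: complex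
    using that \<rho> mult_left_le_one_le[of "norm z" \<rho>] by (simp add: norm_mult)
  then show ?thesis unfolding bloch_kernel_def
    by (intro continuous_intros continuous_on_compose2[OF holomorphic_on_imp_continuous_on[OF F]]
       continuous_on_compose2[OF holomorphic_on_imp_continuous_on[OF holomorphic_deriv[OF F open_ball]]]) auto
qed

text \<open>Both sides are sums of the same series with terms
  \<open>tcoeff F k * r ^ (2 * k) * cnj (tcoeff g k)\<close>. On the area side \<open>r < 1\<close>
  makes the coefficients of the kernel absolutely summable, so integration may be carried out term
  by term.\<close>

lemma circle_pairing_eq_area:
  assumes F: "F holomorphic_on ball 0 1" and g: "g \<in> W1" and r: "0 \<le> r" "r < 1"
  shows "integral {0..2*pi} (\<lambda>t. F (of_real r * cis t) * cnj (g (of_real r * cis t))) / of_real (2*pi) =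
    bloch_area_pair F (r\<^sup>2) g"
proof -
  have \<rho>: "0 \<le> r\<^sup>2" "r\<^sup>2 < 1" using r by (auto simp: power_less_one_iff)
  define c where "c k = of_nat (k + 2) * tcoeff F (Suc k) * of_real (r\<^sup>2) ^ Suc k" for k
  have sm: "summable (\<lambda>k. norm (c k))"
    using bloch_kernel_summable(2)[OF F \<rho>] by (simp add: c_def)
  define f where "f k z = indicator (ball 0 1) z *\<^sub>R (c k * (of_real (1 - (norm z)\<^sup>2) * z ^ k * cnj (deriv g z)))" for k z
  have wt: "norm (of_real (1 - (norm z)\<^sup>2) * z ^ k) \<le> 1" if "z \<in> ball 0 1" for z :: complex and k
  proof -
    have "norm z < 1" using that by simp
    then have "\<bar>1 - (norm z)\<^sup>2\<bar> \<le> 1" "norm z ^ k \<le> 1"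
      by (auto simp: abs_le_iff power_le_one intro: power_le_one)
    then show ?thesis
      by (simp add: norm_mult norm_power mult_le_one del: of_real_diff)
  qed
  have si: "set_integrable lborel (ball 0 1) (\<lambda>z. of_real (1 - (norm z)\<^sup>2) * z ^ k * cnj (deriv g z))" for k
    by (rule W1_set_integrable_mult[OF g _ wt]) (auto intro!: continuous_intros)
  have i: "integrable lborel (f k)" for k
    using set_integrable_mult_right[OF si[of k], of "c k"] unfolding f_def set_integrable_def by simp
  have ig: "integrable lborel (\<lambda>z. indicator (ball 0 1) z * norm (deriv g z))"
    using W1_int[OF g] by (simp add: set_integrable_def)
  have nf: "norm (f k z) \<le> norm (c k) * (indicator (ball 0 1) z * norm (deriv g z))" for k z
  proof (cases "z \<in> ball 0 1")
    case True
    have "norm (of_real (1 - (norm z)\<^sup>2) * z ^ k) * norm (deriv g z) \<le> 1 * norm (deriv g z)"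
      by (intro mult_right_mono wt[OF True]) auto
    then show ?thesis using True
      by (simp add: f_def norm_mult[of "c k"] norm_mult[of _ "cnj _"] mult_left_mono del: of_real_diff)
  qed (simp add: f_def)
  have Ik: "(LINT z|lborel. f k z) = of_real pi * (tcoeff F (Suc k) * of_real r ^ (2 * Suc k) * cnj (tcoeff g (Suc k)))" for k
  proof -
    have "(LINT z|lborel. f k z) = c k * (LINT z:ball 0 1|lborel. of_real (1 - (norm z)\<^sup>2) * z ^ k * cnj (deriv g z))"
      unfolding f_def set_lebesgue_integral_def by (subst integral_mult_right_zero[symmetric]) (simp add: mult_ac)
    also have "\<dots> = c k * (of_real pi * cnj (tcoeff g (Suc k)) / of_nat (k + 2))"
      by (simp only: W1_moment[OF g])
    also have "\<dots> = (of_nat (k + 2) / of_nat (k + 2)) *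
        (of_real pi * (tcoeff F (Suc k) * of_real (r\<^sup>2) ^ Suc k * cnj (tcoeff g (Suc k))))"
      by (simp only: c_def divide_inverse mult_ac)
    also have "of_nat (k + 2) / of_nat (k + 2) = (1::complex)"
      by (rule divide_self) (simp only: of_nat_eq_0_iff)
    also have "of_real (r\<^sup>2) ^ Suc k = (of_real r :: complex) ^ (2 * Suc k)"
      by (simp only: of_real_power power_mult)
    finally show ?thesis by simp
  qed
  \<comment> \<open>The origin has to be left out, since the value of \<open>bloch_kernel\<close>
    there need not be the sum of its series.\<close>
  have AEs: "AE z in lborel. (\<lambda>k. f k z) sums (indicator (ball 0 1) z *\<^sub>R
      (of_real (1 - (norm z)\<^sup>2) * bloch_kernel F (r\<^sup>2) z * cnj (deriv g z)))"
    using AE_lborel_singleton[of "0::complex"]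
  proof eventually_elim
    fix z :: complex assume z: "z \<noteq> 0"
    show "(\<lambda>k. f k z) sums (indicator (ball 0 1) z *\<^sub>R
      (of_real (1 - (norm z)\<^sup>2) * bloch_kernel F (r\<^sup>2) z * cnj (deriv g z)))"
    proof (cases "z \<in> ball 0 1")
      case True
      have "(\<lambda>k. (of_real (1 - (norm z)\<^sup>2) * cnj (deriv g z)) * (c k * z ^ k)) sums
          ((of_real (1 - (norm z)\<^sup>2) * cnj (deriv g z)) * bloch_kernel F (r\<^sup>2) z)"
        using bloch_kernel_sums[OF F \<rho> True z] unfolding c_def by (rule sums_mult)
      then show ?thesis using True by (simp add: f_def mult_ac)
    qed (simp add: f_def)
  qed
  have "(\<lambda>k. LINT z|lborel. f k z) sums (LINT z|lborel. (\<Sum>k. f k z))"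
  proof (rule sums_integral[OF i])
    show "AE z in lborel. summable (\<lambda>k. norm (f k z))"
      using nf by (intro AE_I2 summable_comparison_test'[OF summable_mult2[OF sm], of 0]) auto
    show "summable (\<lambda>k. LINT z|lborel. norm (f k z))"
    proof (rule summable_comparison_test'[OF summable_mult2[OF sm, of "LINT z|lborel. indicator (ball 0 1) z * norm (deriv g z)"], of 0])
      fix k
      have "(LINT z|lborel. norm (f k z)) \<le> (LINT z|lborel. norm (c k) * (indicator (ball 0 1) z * norm (deriv g z)))"
        by (intro integral_mono integrable_norm i nf integrable_mult_right ig)
      then show "norm (LINT z|lborel. norm (f k z)) \<le> norm (c k) * (LINT z|lborel. indicator (ball 0 1) z * norm (deriv g z))"
        by simp
    qed
  qed
  also have "(LINT z|lborel. (\<Sum>k. f k z)) = (LINT z:ball 0 1|lborel. of_real (1 - (norm z)\<^sup>2) * bloch_kernel F (r\<^sup>2) z * cnj (deriv g z))"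
    unfolding set_lebesgue_integral_def
  proof (rule integral_cong_AE)
    show AEe: "AE z in lborel. (\<Sum>k. f k z) = indicator (ball 0 1) z *\<^sub>R
      (of_real (1 - (norm z)\<^sup>2) * bloch_kernel F (r\<^sup>2) z * cnj (deriv g z))"
      using AEs by eventually_elim (simp add: sums_iff)
    show "(\<lambda>z. \<Sum>k. f k z) \<in> borel_measurable lborel"
      using i by (intro borel_measurable_suminf) auto
    show "(\<lambda>z. indicator (ball 0 1) z *\<^sub>R
      (of_real (1 - (norm z)\<^sup>2) * bloch_kernel F (r\<^sup>2) z * cnj (deriv g z))) \<in> borel_measurable lborel"
      by (rule W1_measurable_mult[OF g]) (use \<rho> in \<open>auto intro!: continuous_intros bloch_kernel_continuous[OF F]\<close>)
  qed
  finally have "(\<lambda>k. of_real pi * (tcoeff F (Suc k) * of_real r ^ (2 * Suc k) * cnj (tcoeff g (Suc k)))) sums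
    (LINT z:ball 0 1|lborel. of_real (1 - (norm z)\<^sup>2) * bloch_kernel F (r\<^sup>2) z * cnj (deriv g z))" 
    unfolding Ik .
  from sums_divide[OF this, of "of_real pi"]
  have "(\<lambda>k. tcoeff F (Suc k) * of_real r ^ (2 * Suc k) * cnj (tcoeff g (Suc k))) sums
    ((LINT z:ball 0 1|lborel. of_real (1 - (norm z)\<^sup>2) * bloch_kernel F (r\<^sup>2) z * cnj (deriv g z)) / of_real pi)"
    by simp
  then have "(\<lambda>k. tcoeff F k * of_real r ^ (2 * k) * cnj (tcoeff g k)) sums bloch_area_pair F (r\<^sup>2) g"
    unfolding bloch_area_pair_def by (subst (asm) sums_Suc_iff) (simp add: add.commute)
  with circle_pairing_sums[OF F W1_holo[OF g] r] show ?thesis by (rule sums_unique2)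
qed


lemma bloch_weighted_kernel_bound:
  assumes F: "F holomorphic_on ball 0 1" and C: "\<And>z. z \<in> ball 0 1 \<Longrightarrow> (1 - norm z) * norm (deriv F z) \<le> C"
    and \<rho>: "0 \<le> \<rho>" "\<rho> \<le> 1" and z: "z \<in> ball 0 1"
  shows "norm (of_real (1 - (norm z)\<^sup>2) * bloch_kernel F \<rho> z) \<le> 4 * C"
proof -
  have z1: "norm z < 1" using z by simp
  have "1 - (norm z)\<^sup>2 = (1 + norm z) * (1 - norm z)" by (simp add: algebra_simps power2_eq_square)
  moreover have "\<bar>1 - (norm z)\<^sup>2\<bar> = 1 - (norm z)\<^sup>2" using z1 by (simp add: power_le_one)
  ultimately have "norm (of_real (1 - (norm z)\<^sup>2) * bloch_kernel F \<rho> z) =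
      (1 + norm z) * ((1 - norm z) * norm (bloch_kernel F \<rho> z))"
    by (simp only: norm_mult norm_of_real mult.assoc)
  also have "\<dots> \<le> 2 * ((1 - norm z) * norm (bloch_kernel F \<rho> z))"
    using z1 by (intro mult_right_mono) auto
  also have "\<dots> \<le> 2 * (2 * C)" using bloch_kernel_bound[OF F C \<rho> z] by simp
  finally show ?thesis by simp
qed

text \<open>Without convergence the \<open>Lim\<close> in \<open>bloch_pair\<close> would be an
  unspecified value. The dominating function is \<open>4 * C * norm (deriv g z)\<close>, integrable
  by membership of \<open>g\<close> in \<open>W1\<close>.\<close>

lemma bloch_pair_tendsto:
  assumes F: "F \<in> bloch" and g: "g \<in> W1"
  shows "((\<lambda>r. integral {0..2*pi} (\<lambda>t. F (of_real r * cis t) * cnj (g (of_real r * cis t))) / of_real (2*pi))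
    \<longlongrightarrow> bloch_area_pair F 1 g) (at_left 1)"
proof (rule tendsto_at_left_sequentially)
  show "(0::real) < 1" by simp
  fix S :: "nat \<Rightarrow> real" assume S: "\<And>n. S n < 1" "\<And>n. 0 < S n" "S \<longlonglongrightarrow> 1"
  have hF: "F holomorphic_on ball 0 1" using F by (simp add: bloch_def)
  obtain C where C: "\<And>z. z \<in> ball 0 1 \<Longrightarrow> (1 - norm z) * norm (deriv F z) \<le> C"
    using F unfolding bloch_def by blast
  let ?f = "\<lambda>\<rho> z. indicator (ball 0 1) z *\<^sub>R (of_real (1 - (norm z)\<^sup>2) * bloch_kernel F \<rho> z * cnj (deriv g z))"
  have S2: "0 \<le> (S n)\<^sup>2" "(S n)\<^sup>2 \<le> 1" for n using S by (auto simp: power_le_one less_imp_le)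
  have "(\<lambda>n. LINT z|lborel. ?f ((S n)\<^sup>2) z) \<longlonglongrightarrow> (LINT z|lborel. ?f 1 z)"
  proof (rule integral_dominated_convergence)
    show "integrable lborel (\<lambda>z. (4 * C) * (indicator (ball 0 1) z * norm (deriv g z)))"
      using W1_int[OF g] by (intro integrable_mult_right) (simp add: set_integrable_def)
    show "?f 1 \<in> borel_measurable lborel" "?f ((S n)\<^sup>2) \<in> borel_measurable lborel" for n
      by (intro W1_measurable_mult g continuous_intros bloch_kernel_continuous hF S2; simp)+
    show "AE z in lborel. norm (?f ((S n)\<^sup>2) z) \<le> (4 * C) * (indicator (ball 0 1) z * norm (deriv g z))" for n
    proof (rule AE_I2)
      fix z :: complex
      show "norm (?f ((S n)\<^sup>2) z) \<le> (4 * C) * (indicator (ball 0 1) z * norm (deriv g z))"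
      proof (cases "z \<in> ball 0 1")
        case True
        have "norm (of_real (1 - (norm z)\<^sup>2) * bloch_kernel F ((S n)\<^sup>2) z) * norm (cnj (deriv g z))
           \<le> 4 * C * norm (cnj (deriv g z))"
          by (intro mult_right_mono bloch_weighted_kernel_bound[OF hF C S2 True]) auto
        then show ?thesis using True by (simp add: norm_mult[of _ "cnj (deriv g z)"] del: of_real_diff)
      qed simp
    qed
    show "AE z in lborel. (\<lambda>n. ?f ((S n)\<^sup>2) z) \<longlonglongrightarrow> ?f 1 z"
    proof (rule AE_I2)
      fix z :: complex
      show "(\<lambda>n. ?f ((S n)\<^sup>2) z) \<longlonglongrightarrow> ?f 1 z"
      proof (cases "z \<in> ball 0 1")
        case True
        have "(\<lambda>n. of_real ((S n)\<^sup>2) * z) \<longlonglongrightarrow> of_real (1\<^sup>2) * z"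
          by (intro tendsto_intros S)
        then have t: "(\<lambda>n. of_real ((S n)\<^sup>2) * z) \<longlonglongrightarrow> z" by simp
        have c: "isCont F z" "isCont (deriv F) z"
          using True hF by (auto intro!: continuous_on_interior holomorphic_on_imp_continuous_on holomorphic_deriv
              simp: interior_open)
        have "(\<lambda>n. bloch_kernel F ((S n)\<^sup>2) z) \<longlonglongrightarrow> (F z - F 0) / z + of_real (1\<^sup>2) * deriv F z"
          unfolding bloch_kernel_def divide_inverse
          by (intro tendsto_intros isCont_tendsto_compose[OF c(1) t] isCont_tendsto_compose[OF c(2) t] S)
        then have "(\<lambda>n. bloch_kernel F ((S n)\<^sup>2) z) \<longlonglongrightarrow> bloch_kernel F 1 z"
          by (simp add: bloch_kernel_def)
        then show ?thesis by (intro tendsto_intros)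
      qed simp
    qed
  qed
  then have "(\<lambda>n. bloch_area_pair F ((S n)\<^sup>2) g) \<longlonglongrightarrow> bloch_area_pair F 1 g"
    unfolding bloch_area_pair_def set_lebesgue_integral_def by (intro tendsto_intros) auto
  then show "(\<lambda>n. integral {0..2*pi} (\<lambda>t. F (of_real (S n) * cis t) * cnj (g (of_real (S n) * cis t))) / of_real (2*pi))
      \<longlonglongrightarrow> bloch_area_pair F 1 g"
    using circle_pairing_eq_area[OF hF g less_imp_le[OF S(2)] S(1)] by simp
qed

lemma bloch_pair_eqI:
  assumes "((\<lambda>r. integral {0..2*pi} (\<lambda>t. F (of_real r * cis t) * cnj (g (of_real r * cis t))) / of_real (2*pi)) \<longlongrightarrow> L) (at_left 1)"
  shows "bloch_pair F g = L"
  unfolding bloch_pair_def by (rule tendsto_Lim[OF _ assms]) simp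

lemma bloch_pair_eq:
  assumes "F \<in> bloch" "g \<in> W1"
  shows "bloch_pair F g = bloch_area_pair F 1 g"
  by (intro bloch_pair_eqI bloch_pair_tendsto assms)

lemma bloch_pair_lim:
  assumes "F \<in> bloch" "g \<in> W1"
  shows "((\<lambda>r. integral {0..2*pi} (\<lambda>t. F (of_real r * cis t) * cnj (g (of_real r * cis t))) / of_real (2*pi))
    \<longlongrightarrow> bloch_pair F g) (at_left 1)"
  using bloch_pair_tendsto[OF assms] bloch_pair_eq[OF assms] by simp

text \<open>For \<open>g 0 = 0\<close> the bound contains only the Bloch seminorm of
  \<open>F\<close>. The test functions vanish at 0, so no control of the values \<open>F 0\<close>
  is called for later.\<close>

lemma bloch_pair_bound:
  assumes F: "F holomorphic_on ball 0 1" and C: "\<And>z. z \<in> ball 0 1 \<Longrightarrow> (1 - norm z) * norm (deriv F z) \<le> C"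
    and g: "g \<in> W1"
  shows "norm (bloch_pair F g) \<le> norm (F 0) * norm (g 0) + 4 * C / pi * (LINT z:ball 0 1|lborel. norm (deriv g z))"
proof -
  have Fb: "F \<in> bloch" using F C unfolding bloch_def by blast
  let ?h = "\<lambda>z. of_real (1 - (norm z)\<^sup>2) * bloch_kernel F 1 z * cnj (deriv g z)"
  have si: "set_integrable lborel (ball 0 1) ?h"
    by (rule W1_set_integrable_mult[OF g _ bloch_weighted_kernel_bound[OF F C]])
       (auto intro!: continuous_intros bloch_kernel_continuous F)
  have "norm (LINT z:ball 0 1|lborel. ?h z) \<le> (LINT z:ball 0 1|lborel. norm (?h z))"
    by (rule set_integral_norm_bound[OF si])
  also have "\<dots> \<le> (LINT z:ball 0 1|lborel. 4 * C * norm (deriv g z))"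
  proof (rule set_integral_mono)
    show "set_integrable lborel (ball 0 1) (\<lambda>z. norm (?h z))" using si by (rule set_integrable_norm)
    show "set_integrable lborel (ball 0 1) (\<lambda>z. 4 * C * norm (deriv g z))"
      by (intro set_integrable_mult_right W1_int g)
    fix z :: complex assume z: "z \<in> ball 0 1"
    have "norm (of_real (1 - (norm z)\<^sup>2) * bloch_kernel F 1 z) * norm (cnj (deriv g z)) \<le> 4 * C * norm (cnj (deriv g z))"
      by (intro mult_right_mono bloch_weighted_kernel_bound[OF F C _ _ z]) auto
    then show "norm (?h z) \<le> 4 * C * norm (deriv g z)"
      by (simp only: norm_mult[of _ "cnj _"] complex_mod_cnj)
  qed
  finally have "norm ((LINT z:ball 0 1|lborel. ?h z) / of_real pi) \<le> 4 * C / pi * (LINT z:ball 0 1|lborel. norm (deriv g z))"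
    by (simp add: norm_divide field_simps)
  then show ?thesis unfolding bloch_pair_eq[OF Fb g] bloch_area_pair_def
    by (intro order_trans[OF norm_triangle_ineq] add_mono) (simp_all add: norm_mult)
qed

section \<open>Sesquilinearity of the pairing\<close>

lemma continuous_on_circle:
  assumes "F holomorphic_on ball 0 1" "0 \<le> r" "r < 1"
  shows "continuous_on A (\<lambda>t. F (of_real r * cis t))"
  using assms by (intro continuous_on_compose2[OF holomorphic_on_imp_continuous_on[OF assms(1)]] continuous_intros)
    (auto simp: norm_mult)

lemma eventually_at_left_1_interval: "\<forall>\<^sub>F r in at_left (1::real). 0 < r \<and> r < 1"
  using eventually_at_left_real[of 0 1] by simp

lemma bloch_pair_linear_left:
  assumes F: "F \<in> bloch" and G: "G \<in> bloch" and g: "g \<in> W1"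
  shows "bloch_pair (\<lambda>z. a * F z + G z) g = a * bloch_pair F g + bloch_pair G g"
proof (rule bloch_pair_eqI)
  let ?I = "\<lambda>F r. integral {0..2*pi} (\<lambda>t. F (of_real r * cis t) * cnj (g (of_real r * cis t))) / of_real (2*pi)"
  have "((\<lambda>r. a * ?I F r + ?I G r) \<longlongrightarrow> a * bloch_pair F g + bloch_pair G g) (at_left 1)"
    by (intro tendsto_intros bloch_pair_lim assms)
  moreover have "\<forall>\<^sub>F r in at_left 1. ?I (\<lambda>z. a * F z + G z) r = a * ?I F r + ?I G r"
    using eventually_at_left_1_interval
  proof eventually_elim
    fix r :: real assume r: "0 < r \<and> r < 1"
    have c: "(\<lambda>t. F (of_real r * cis t) * cnj (g (of_real r * cis t))) integrable_on {0..2*pi}"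
      "(\<lambda>t. G (of_real r * cis t) * cnj (g (of_real r * cis t))) integrable_on {0..2*pi}"
      using assms r by (auto intro!: integrable_continuous_interval continuous_intros continuous_on_circle simp: bloch_def W1_def)
    have "integral {0..2*pi} (\<lambda>t. (a * F (of_real r * cis t) + G (of_real r * cis t)) * cnj (g (of_real r * cis t))) =
      integral {0..2*pi} (\<lambda>t. a * (F (of_real r * cis t) * cnj (g (of_real r * cis t))) + G (of_real r * cis t) * cnj (g (of_real r * cis t)))"
      by (simp add: algebra_simps)
    also have "\<dots> = a * integral {0..2*pi} (\<lambda>t. F (of_real r * cis t) * cnj (g (of_real r * cis t))) +
       integral {0..2*pi} (\<lambda>t. G (of_real r * cis t) * cnj (g (of_real r * cis t)))"
      using c by (subst integral_add) (auto intro!: integrable_on_mult_right)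
    finally show "?I (\<lambda>z. a * F z + G z) r = a * ?I F r + ?I G r"
      by (simp add: add_divide_distrib)
  qed
  ultimately show "(?I (\<lambda>z. a * F z + G z) \<longlongrightarrow> a * bloch_pair F g + bloch_pair G g) (at_left 1)"
    by (rule Lim_transform_eventually[OF _ eventually_mono]) simp
qed

lemma bloch_pair_linear_right:
  assumes F: "F \<in> bloch" and g: "g \<in> W1" and h: "h \<in> W1"
  shows "bloch_pair F (\<lambda>z. a * g z + h z) = cnj a * bloch_pair F g + bloch_pair F h"
proof (rule bloch_pair_eqI)
  let ?I = "\<lambda>g r. integral {0..2*pi} (\<lambda>t. F (of_real r * cis t) * cnj (g (of_real r * cis t))) / of_real (2*pi)"
  have "((\<lambda>r. cnj a * ?I g r + ?I h r) \<longlongrightarrow> cnj a * bloch_pair F g + bloch_pair F h) (at_left 1)"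
    by (intro tendsto_intros bloch_pair_lim assms)
  moreover have "\<forall>\<^sub>F r in at_left 1. ?I (\<lambda>z. a * g z + h z) r = cnj a * ?I g r + ?I h r"
    using eventually_at_left_1_interval
  proof eventually_elim
    fix r :: real assume r: "0 < r \<and> r < 1"
    have c: "(\<lambda>t. F (of_real r * cis t) * cnj (g (of_real r * cis t))) integrable_on {0..2*pi}"
      "(\<lambda>t. F (of_real r * cis t) * cnj (h (of_real r * cis t))) integrable_on {0..2*pi}"
      using assms r by (auto intro!: integrable_continuous_interval continuous_intros continuous_on_circle simp: bloch_def W1_def)
    have "integral {0..2*pi} (\<lambda>t. F (of_real r * cis t) * cnj (a * g (of_real r * cis t) + h (of_real r * cis t))) =
      integral {0..2*pi} (\<lambda>t. cnj a * (F (of_real r * cis t) * cnj (g (of_real r * cis t))) + F (of_real r * cis t) * cnj (h (of_real r * cis t)))"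
      by (simp add: algebra_simps)
    also have "\<dots> = cnj a * integral {0..2*pi} (\<lambda>t. F (of_real r * cis t) * cnj (g (of_real r * cis t))) +
       integral {0..2*pi} (\<lambda>t. F (of_real r * cis t) * cnj (h (of_real r * cis t)))"
      using c by (subst integral_add) (auto intro!: integrable_on_mult_right)
    finally show "?I (\<lambda>z. a * g z + h z) r = cnj a * ?I g r + ?I h r"
      by (simp add: add_divide_distrib)
  qed
  ultimately show "(?I (\<lambda>z. a * g z + h z) \<longlongrightarrow> cnj a * bloch_pair F g + bloch_pair F h) (at_left 1)"
    by (rule Lim_transform_eventually[OF _ eventually_mono]) simp
qed

lemma bloch_zero: "(\<lambda>z. 0) \<in> bloch"
  by (auto simp: bloch_def intro!: exI[of _ 0])

lemma bloch_pair_zero_right: "bloch_pair F (\<lambda>z. 0) = 0"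
  by (rule bloch_pair_eqI) simp

lemma bloch_linear:
  assumes "F \<in> bloch" "G \<in> bloch"
  shows "(\<lambda>z. a * F z + G z) \<in> bloch"
proof -
  have hF: "F holomorphic_on ball 0 1" "G holomorphic_on ball 0 1" using assms by (auto simp: bloch_def)
  obtain C D where C: "\<forall>z\<in>ball 0 1. (1 - norm z) * norm (deriv F z) \<le> C"
    and D: "\<forall>z\<in>ball 0 1. (1 - norm z) * norm (deriv G z) \<le> D"
    using assms unfolding bloch_def by blast
  have "(1 - norm z) * norm (deriv (\<lambda>z. a * F z + G z) z) \<le> norm a * C + D" if z: "z \<in> ball 0 1" for z
  proof -
    have "deriv (\<lambda>z. a * F z + G z) z = a * deriv F z + deriv G z"
      using holomorphic_derivI[OF hF(1) open_ball z] holomorphic_derivI[OF hF(2) open_ball z]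
      by (intro DERIV_imp_deriv derivative_eq_intros) auto
    moreover have "norm (a * deriv F z + deriv G z) \<le> norm a * norm (deriv F z) + norm (deriv G z)"
      by (metis norm_mult norm_triangle_ineq)
    ultimately have "(1 - norm z) * norm (deriv (\<lambda>z. a * F z + G z) z) \<le>
       (1 - norm z) * (norm a * norm (deriv F z) + norm (deriv G z))"
      using z by (simp add: mult_left_mono)
    also have "\<dots> = norm a * ((1 - norm z) * norm (deriv F z)) + (1 - norm z) * norm (deriv G z)"
      by (simp add: algebra_simps)
    also have "\<dots> \<le> norm a * C + D" using C D z by (intro add_mono mult_left_mono) auto
    finally show ?thesis .
  qed
  moreover have "(\<lambda>z. a * F z + G z) holomorphic_on ball 0 1" by (intro holomorphic_intros hF)
  ultimately show ?thesis unfolding bloch_def by blast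
qed

section \<open>Test functions and uniform boundedness\<close>

text \<open>On the circle of radius \<open>r\<close> one has
  \<open>cnj \<zeta> = r ^ 2 / \<zeta>\<close>, which turns the conjugated kernel into a Cauchy
  kernel with pole at \<open>w * r ^ 2\<close>; the pole moves to \<open>w\<close> as
  \<open>r\<close> tends to 1. The case \<open>k = 0\<close> represents evaluation at
  \<open>w\<close>, the case \<open>k = 1\<close> the derivative.\<close>

lemma bloch_pair_cauchy_kernel:
  assumes F: "F holomorphic_on ball 0 1" and w: "norm w < 1"
  shows "bloch_pair F (\<lambda>z. z ^ k / (1 - cnj w * z) ^ Suc k) = (deriv ^^ k) F w / fact k"
proof (rule bloch_pair_eqI)
  let ?I = "\<lambda>r. integral {0..2*pi} (\<lambda>t. F (of_real r * cis t) *
      cnj ((of_real r * cis t) ^ k / (1 - cnj w * (of_real r * cis t)) ^ Suc k)) / of_real (2*pi)"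
  have I: "of_real r ^ (2*k) * ((deriv ^^ k) F (w * of_real r ^ 2) / fact k) = ?I r" if r: "0 < r" "r < 1" for r
  proof -
    have cont: "continuous_on (cball 0 r) F" "F holomorphic_on ball 0 r"
      using r by (auto intro!: holomorphic_on_imp_continuous_on intro: holomorphic_on_subset[OF F])
    have wr: "norm (w * of_real r ^ 2) < r"
    proof -
      have "norm w * (r * r) \<le> 1 * (r * r)" using w by (intro mult_right_mono) auto
      also have "\<dots> < r" using r by simp
      finally show ?thesis using r by (simp add: norm_mult norm_power power2_eq_square)
    qed
    have eq: "F (of_real r * cis t) * cnj ((of_real r * cis t) ^ k / (1 - cnj w * (of_real r * cis t)) ^ Suc k) =
        of_real r ^ (2*k) * (F (of_real r * cis t) * (of_real r * cis t) / (of_real r * cis t - w * of_real r ^ 2) ^ Suc k)" for t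
    proof -
      define \<zeta> where "\<zeta> = of_real r * cis t"
      have \<zeta>0: "\<zeta> \<noteq> 0" using r by (simp add: \<zeta>_def)
      have n\<zeta>: "norm \<zeta> = r" using r by (simp add: \<zeta>_def norm_mult)
      have cn: "cnj \<zeta> = of_real r ^ 2 / \<zeta>"
        using \<zeta>0 complex_norm_square[of \<zeta>] n\<zeta> by (simp add: field_simps)
      have d: "\<zeta> - w * of_real r ^ 2 \<noteq> 0" using wr n\<zeta> by auto
      have "cnj (\<zeta> ^ k / (1 - cnj w * \<zeta>) ^ Suc k) = (of_real r ^ 2 / \<zeta>) ^ k / ((\<zeta> - w * of_real r ^ 2) / \<zeta>) ^ Suc k"
        using \<zeta>0 by (simp add: cn diff_divide_distrib del: power_Suc)
      also have "\<dots> = of_real r ^ (2*k) * (\<zeta> / (\<zeta> - w * of_real r ^ 2) ^ Suc k)"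
        using \<zeta>0 d by (simp add: power_divide power_mult)
      finally show ?thesis unfolding \<zeta>_def[symmetric] by simp
    qed
    have "((\<lambda>t. F (of_real r * cis t) * cnj ((of_real r * cis t) ^ k / (1 - cnj w * (of_real r * cis t)) ^ Suc k))
       has_integral of_real r ^ (2*k) * (2 * of_real pi / fact k * (deriv ^^ k) F (w * of_real r ^ 2))) {0..2*pi}"
      unfolding eq by (intro has_integral_mult_right cauchy_circle_integral cont wr)
    then show ?thesis by (simp add: integral_unique)
  qed
  have "(deriv ^^ k) F holomorphic_on ball 0 1" by (intro holomorphic_higher_deriv F) auto
  then have c: "isCont ((deriv ^^ k) F) w"
    using w by (auto intro!: continuous_on_interior holomorphic_on_imp_continuous_on simp: interior_open)
  have id: "((\<lambda>r::real. r) \<longlongrightarrow> 1) (at_left 1)" by (simp add: tendsto_ident_at)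
  have "((\<lambda>r::real. w * of_real r ^ 2) \<longlongrightarrow> w * of_real 1 ^ 2) (at_left 1)"
    by (intro tendsto_intros id)
  then have "((\<lambda>r::real. w * of_real r ^ 2) \<longlongrightarrow> w) (at_left 1)" by simp
  from isCont_tendsto_compose[OF c this]
  have "((\<lambda>r. of_real r ^ (2*k) * ((deriv ^^ k) F (w * of_real r ^ 2) / fact k)) \<longlongrightarrow>
     of_real 1 ^ (2*k) * ((deriv ^^ k) F w / fact k)) (at_left 1)"
    by (intro tendsto_intros id) auto
  then have "((\<lambda>r. of_real r ^ (2*k) * ((deriv ^^ k) F (w * of_real r ^ 2) / fact k)) \<longlongrightarrow>
     (deriv ^^ k) F w / fact k) (at_left 1)" by simp
  then show "(?I \<longlongrightarrow> (deriv ^^ k) F w / fact k) (at_left 1)"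
    by (rule Lim_transform_eventually)
       (rule eventually_mono[OF eventually_at_left_1_interval], use I in auto)
qed

lemma holomorphic_imp_W1:
  assumes g: "g holomorphic_on ball 0 R" and R: "R > 1"
  shows "g \<in> W1"
proof -
  have "continuous_on (cball 0 1) (deriv g)"
    using R by (intro continuous_on_subset[OF holomorphic_on_imp_continuous_on[OF holomorphic_deriv[OF g]]]) auto
  then have "integrable lborel (\<lambda>z. indicator (cball 0 1) z *\<^sub>R norm (deriv g z))"
    by (intro borel_integrable_compact continuous_intros) auto
  then have "set_integrable lborel (ball 0 1) (\<lambda>z. norm (deriv g z))"
    unfolding set_integrable_def[symmetric] by (rule set_integrable_subset) auto
  then show ?thesis using R by (auto simp: W1_def intro: holomorphic_on_subset[OF g])
qed

lemma cauchy_kernel_W1: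
  assumes w: "norm w < 1"
  shows "(\<lambda>z. z ^ k / (1 - cnj w * z) ^ Suc k) \<in> W1"
proof -
  obtain R where R: "R > 1" "norm w * R < 1"
  proof (cases "w = 0")
    case False
    with w have "1 < 1 / norm w" by simp
    then obtain R where "1 < R" "R < 1 / norm w" using dense by blast
    then show ?thesis using False that by (simp add: field_simps)
  qed (use that[of 2] in auto)
  have "1 - cnj w * z \<noteq> 0" if "z \<in> ball 0 R" for z
  proof
    assume "1 - cnj w * z = 0"
    then have "norm (cnj w * z) = 1" by simp
    moreover have "norm w * norm z \<le> norm w * R" using that by (intro mult_left_mono) auto
    ultimately show False using R by (simp add: norm_mult)
  qed
  then have "(\<lambda>z. z ^ k / (1 - cnj w * z) ^ Suc k) holomorphic_on ball 0 R"
    by (intro holomorphic_intros) auto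
  then show ?thesis using R(1) by (rule holomorphic_imp_W1)
qed

text \<open>The pairing of \<open>F\<close> with this function is the Bloch quotient
  \<open>(1 - norm w) * deriv F w\<close>. The same factor \<open>1 - norm w\<close> keeps the area
  integral of the derivative bounded uniformly in \<open>w\<close>.\<close>

definition bloch_test :: "complex \<Rightarrow> complex \<Rightarrow> complex" where
  "bloch_test w z = of_real (1 - norm w) * (z / (1 - cnj w * z)\<^sup>2)"

lemma W1_linear:
  assumes g: "g \<in> W1" and h: "h \<in> W1"
  shows "(\<lambda>z. a * g z + h z) \<in> W1"
proof -
  have d: "deriv (\<lambda>z. a * g z + h z) z = a * deriv g z + deriv h z" if "z \<in> ball 0 1" for z
    using holomorphic_derivI[OF W1_holo[OF g] open_ball that] holomorphic_derivI[OF W1_holo[OF h] open_ball that]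
    by (intro DERIV_imp_deriv derivative_eq_intros) auto
  have "set_integrable lborel (ball 0 1) (\<lambda>z. norm (deriv (\<lambda>z. a * g z + h z) z))"
  proof (rule set_integrable_bound)
    show "set_integrable lborel (ball 0 1) (\<lambda>z. norm a * norm (deriv g z) + norm (deriv h z))"
      by (intro set_integral_add set_integrable_mult_right W1_int g h)
    show "set_borel_measurable lborel (ball 0 1) (\<lambda>z. norm (deriv (\<lambda>z. a * g z + h z) z))"
    proof -
      have "(\<lambda>z. a * g z + h z) holomorphic_on ball 0 1" by (intro holomorphic_intros W1_holo g h)
      then have "continuous_on (ball 0 1) (deriv (\<lambda>z. a * g z + h z))"
        by (intro holomorphic_on_imp_continuous_on holomorphic_deriv) auto
      then have "(\<lambda>z. indicator (ball 0 1) z *\<^sub>R norm (deriv (\<lambda>z. a * g z + h z) z)) \<in> borel_measurable borel"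
        by (intro borel_measurable_continuous_on_indicator continuous_intros) auto
      then show ?thesis by (simp add: set_borel_measurable_def)
    qed
    show "AE z in lborel. z \<in> ball 0 1 \<longrightarrow> norm (norm (deriv (\<lambda>z. a * g z + h z) z)) \<le> norm (norm a * norm (deriv g z) + norm (deriv h z))"
    proof (intro AE_I2 impI)
      fix z :: complex assume z: "z \<in> ball 0 1"
      have "norm (a * deriv g z + deriv h z) \<le> norm a * norm (deriv g z) + norm (deriv h z)"
        by (metis norm_mult norm_triangle_ineq)
      then show "norm (norm (deriv (\<lambda>z. a * g z + h z) z)) \<le> norm (norm a * norm (deriv g z) + norm (deriv h z))"
        using d[OF z] by simp
    qed
  qed
  moreover have "(\<lambda>z. a * g z + h z) holomorphic_on ball 0 1" by (intro holomorphic_intros W1_holo g h)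
  ultimately show ?thesis by (simp add: W1_def)
qed

lemma W1_zero: "(\<lambda>z. 0) \<in> W1"
  by (rule holomorphic_imp_W1[of _ 2]) auto

lemma bloch_test_W1:
  assumes w: "norm w < 1"
  shows "bloch_test w \<in> W1"
  using W1_linear[OF cauchy_kernel_W1[OF w, of 1] W1_zero, of "of_real (1 - norm w)"]
  by (simp add: bloch_test_def[abs_def] power2_eq_square)

lemma bloch_pair_test:
  assumes F: "F \<in> bloch" and w: "norm w < 1"
  shows "bloch_pair F (bloch_test w) = of_real (1 - norm w) * deriv F w"
proof -
  have "bloch_pair F (\<lambda>z. of_real (1 - norm w) * (z ^ 1 / (1 - cnj w * z) ^ Suc 1) + 0) =
      cnj (of_real (1 - norm w)) * bloch_pair F (\<lambda>z. z ^ 1 / (1 - cnj w * z) ^ Suc 1) + bloch_pair F (\<lambda>z. 0)"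
    by (intro bloch_pair_linear_right F cauchy_kernel_W1 w W1_zero)
  then have "bloch_pair F (bloch_test w) = of_real (1 - norm w) * bloch_pair F (\<lambda>z. z ^ 1 / (1 - cnj w * z) ^ Suc 1)"
    by (simp add: bloch_test_def[abs_def] bloch_pair_zero_right power2_eq_square)
  then show ?thesis using bloch_pair_cauchy_kernel[of F w 1] F w by (simp add: bloch_def)
qed

lemma one_minus_cnj_mult_lower:
  assumes "norm w < 1" "norm z < 1"
  shows "1 - norm w * norm z \<le> norm (1 - cnj w * z)" "0 < 1 - norm w * norm z" "1 - norm z \<le> norm (1 - cnj w * z)"
proof -
  show 1: "1 - norm w * norm z \<le> norm (1 - cnj w * z)"
    using norm_triangle_ineq2[of 1 "cnj w * z"] by (simp add: norm_mult)
  have 2: "norm w * norm z \<le> norm z" using assms by (intro mult_left_le_one_le) auto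
  then show "0 < 1 - norm w * norm z" using assms by linarith
  show "1 - norm z \<le> norm (1 - cnj w * z)" using 1 2 by linarith
qed

lemma deriv_bloch_test:
  assumes w: "norm w < 1" and z: "norm z < 1"
  shows "(bloch_test w has_field_derivative of_real (1 - norm w) * ((1 + cnj w * z) / (1 - cnj w * z) ^ 3)) (at z)"
proof -
  define u where "u = 1 - cnj w * z"
  have u: "u \<noteq> 0" unfolding u_def using one_minus_cnj_mult_lower[OF w z] by auto
  have "((\<lambda>z. z / (1 - cnj w * z)\<^sup>2) has_field_derivative
      (1 * (1 - cnj w * z)\<^sup>2 - z * (2 * (1 - cnj w * z) * (- cnj w))) / ((1 - cnj w * z)\<^sup>2 * (1 - cnj w * z)\<^sup>2)) (at z)"
    using u unfolding u_def by (auto intro!: derivative_eq_intros)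
  also have "(1 * (1 - cnj w * z)\<^sup>2 - z * (2 * (1 - cnj w * z) * (- cnj w))) / ((1 - cnj w * z)\<^sup>2 * (1 - cnj w * z)\<^sup>2)
      = (u * (1 + cnj w * z)) / (u * u ^ 3)"
    unfolding u_def by (simp add: algebra_simps power2_eq_square power3_eq_cube)
  also have "\<dots> = (1 + cnj w * z) / u ^ 3" using u by simp
  finally show ?thesis unfolding bloch_test_def[abs_def] u_def by (rule DERIV_cmult)
qed

text \<open>In the first bound one of the three factors \<open>norm (1 - cnj w * z)\<close> is
  replaced by the radial \<open>1 - norm w * norm z\<close>, and the remaining square has an
  explicit integral over circles. The other two bounds do not involve \<open>w\<close> and serve the
  convergence of series of test functions.\<close>

lemma norm_deriv_bloch_test:
  assumes w: "norm w < 1" and z: "norm z < 1"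
  shows "norm (deriv (bloch_test w) z) \<le> 2 * (1 - norm w) * (1 / ((1 - norm w * norm z) * (norm (1 - cnj w * z))\<^sup>2))"
    and "norm (deriv (bloch_test w) z) \<le> 2 / (1 - norm z) ^ 3"
    and "norm (bloch_test w z) \<le> 1 / (1 - norm z)\<^sup>2"
proof -
  note l = one_minus_cnj_mult_lower[OF w z]
  have d: "deriv (bloch_test w) z = of_real (1 - norm w) * ((1 + cnj w * z) / (1 - cnj w * z) ^ 3)"
    by (rule DERIV_imp_deriv[OF deriv_bloch_test[OF w z]])
  have n: "norm (1 + cnj w * z) \<le> 2"
  proof -
    have "norm w * norm z \<le> 1" using l(2) by simp
    then show ?thesis using norm_triangle_ineq[of 1 "cnj w * z"] by (simp add: norm_mult)
  qed
  have D: "norm (deriv (bloch_test w) z) = (1 - norm w) * (norm (1 + cnj w * z) / norm (1 - cnj w * z) ^ 3)"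
    unfolding d using w by (simp add: norm_mult norm_divide norm_power del: of_real_diff)
  have "norm (1 + cnj w * z) / norm (1 - cnj w * z) ^ 3 \<le> 2 / ((1 - norm w * norm z) * (norm (1 - cnj w * z))\<^sup>2)"
  proof (rule frac_le)
    show "(1 - norm w * norm z) * (norm (1 - cnj w * z))\<^sup>2 \<le> norm (1 - cnj w * z) ^ 3"
      using mult_right_mono[OF l(1), of "(norm (1 - cnj w * z))\<^sup>2"] by (simp add: power3_eq_cube power2_eq_square)
    have "1 - cnj w * z \<noteq> 0" using l by auto
    then show "0 < (1 - norm w * norm z) * (norm (1 - cnj w * z))\<^sup>2" using l by simp
  qed (use n in auto)
  from mult_left_mono[OF this, of "1 - norm w"] w
  show "norm (deriv (bloch_test w) z) \<le> 2 * (1 - norm w) * (1 / ((1 - norm w * norm z) * (norm (1 - cnj w * z))\<^sup>2))"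
    unfolding D by (simp add: mult.commute)
  have "norm (1 + cnj w * z) / norm (1 - cnj w * z) ^ 3 \<le> 2 / (1 - norm z) ^ 3"
    using l n z by (intro frac_le power_mono) auto
  then show "norm (deriv (bloch_test w) z) \<le> 2 / (1 - norm z) ^ 3"
    unfolding D using w mult_mono[of "1 - norm w" 1 "norm (1 + cnj w * z) / norm (1 - cnj w * z) ^ 3" "2 / (1 - norm z) ^ 3"]
    by auto
  have "norm (bloch_test w z) = (1 - norm w) * (norm z / norm (1 - cnj w * z) ^ 2)"
    unfolding bloch_test_def using w by (simp add: norm_mult norm_divide norm_power del: of_real_diff)
  also have "\<dots> \<le> 1 * (1 / (1 - norm z)\<^sup>2)"
    using l z w by (intro mult_mono frac_le power_mono) auto
  finally show "norm (bloch_test w z) \<le> 1 / (1 - norm z)\<^sup>2" by simp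
qed


text \<open>The mean of a Poisson kernel: on the circle the integrand equals
  \<open>h \<zeta> * \<zeta> / (\<zeta> - w * s ^ 2)\<close> with
  \<open>h u = 1 / (1 - cnj w * u)\<close>, so Cauchy's formula gives
  \<open>h (w * s ^ 2)\<close>.\<close>

lemma circle_integral_poisson:
  assumes w: "norm w < 1" and s: "0 \<le> s" "s < 1"
  shows "((\<lambda>t. of_real (1 / (norm (1 - cnj w * (of_real s * cis t)))\<^sup>2) :: complex)
    has_integral of_real (2 * pi / (1 - (norm w)\<^sup>2 * s\<^sup>2))) {0..2*pi}"
proof (cases "s = 0")
  case True
  then show ?thesis using has_integral_const_real[of "1::complex" 0 "2*pi"] by (simp add: scaleR_conv_of_real)
next
  case False
  with s have s0: "s > 0" by simp
  define h where "h u = 1 / (1 - cnj w * u)" for u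
  have nz: "1 - cnj w * u \<noteq> 0" if "norm u < 1" for u
    using one_minus_cnj_mult_lower[OF w that] by auto
  have hh: "h holomorphic_on ball 0 1" unfolding h_def using nz by (intro holomorphic_intros) auto
  have cont: "continuous_on (cball 0 s) h" "h holomorphic_on ball 0 s"
    using s by (auto intro!: holomorphic_on_imp_continuous_on intro: holomorphic_on_subset[OF hh])
  have ws: "norm (w * of_real s ^ 2) < s"
  proof -
    have "norm w * (s * s) \<le> 1 * (s * s)" using w by (intro mult_right_mono) auto
    also have "\<dots> < s" using s s0 by simp
    finally show ?thesis using s by (simp add: norm_mult norm_power power2_eq_square)
  qed
  have eq: "h (of_real s * cis t) * (of_real s * cis t) / (of_real s * cis t - w * of_real s ^ 2) ^ Suc 0 =
     of_real (1 / (norm (1 - cnj w * (of_real s * cis t)))\<^sup>2)" for t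
  proof -
    define \<zeta> where "\<zeta> = of_real s * cis t"
    have \<zeta>0: "\<zeta> \<noteq> 0" using s0 by (simp add: \<zeta>_def)
    have n\<zeta>: "norm \<zeta> = s" using s by (simp add: \<zeta>_def norm_mult)
    have cn: "w * of_real s ^ 2 = w * \<zeta> * cnj \<zeta>"
      using complex_norm_square[of \<zeta>] n\<zeta> by simp
    have "\<zeta> - w * of_real s ^ 2 = \<zeta> * cnj (1 - cnj w * \<zeta>)"
      unfolding cn by (simp add: algebra_simps)
    moreover have "of_real (1 / (norm (1 - cnj w * \<zeta>))\<^sup>2) = 1 / ((1 - cnj w * \<zeta>) * cnj (1 - cnj w * \<zeta>))"
      using complex_norm_square[of "1 - cnj w * \<zeta>"] by simp
    ultimately show ?thesis using \<zeta>0 unfolding \<zeta>_def[symmetric] h_def by simp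
  qed
  have "h (w * of_real s ^ 2) = 1 / (1 - of_real ((norm w)\<^sup>2 * s\<^sup>2))"
    unfolding h_def using complex_norm_square[of w] by (simp add: mult_ac)
  then have "2 * of_real pi / fact 0 * (deriv ^^ 0) h (w * of_real s ^ 2) = of_real (2 * pi / (1 - (norm w)\<^sup>2 * s\<^sup>2))"
    by simp
  with cauchy_circle_integral[OF cont ws, of 0] show ?thesis unfolding eq by simp
qed

text \<open>With \<open>a = norm w\<close> the circle integrals leave a radial integrand of at most
  \<open>2 * pi / (1 - a * s) ^ 2\<close>, whose integral is \<open>2 * pi / (1 - a)\<close>. The
  prefactor \<open>2 * (1 - a)\<close> cancels the singularity.\<close>

lemma bloch_test_W1_norm:
  assumes w: "norm w < 1"
  shows "(LINT z:ball 0 1|lborel. norm (deriv (bloch_test w) z)) \<le> 4 * pi"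
proof -
  define a where "a = norm w"
  have a: "0 \<le> a" "a < 1" using w by (auto simp: a_def)
  have as: "0 < 1 - a * s" "1 - a * s \<le> 1 - a\<^sup>2 * s\<^sup>2" "0 < 1 - a\<^sup>2 * s\<^sup>2" if "0 \<le> s" "s \<le> 1" for s
  proof -
    have "a * s \<le> a" using a that by (simp add: mult_left_le)
    then show 1: "0 < 1 - a * s" using a by linarith
    have "(a * s) * (a * s) \<le> a * s" using 1 a that by (intro mult_left_le_one_le) auto
    then show "1 - a * s \<le> 1 - a\<^sup>2 * s\<^sup>2" by (simp add: power2_eq_square mult_ac)
    with 1 show "0 < 1 - a\<^sup>2 * s\<^sup>2" by linarith
  qed
  define P where "P z = 1 / ((1 - a * norm z) * (norm (1 - cnj w * z))\<^sup>2)" for z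
  have Pnz: "1 - a * norm z \<noteq> 0" "norm (1 - cnj w * z) \<noteq> 0" if "norm z \<le> 1" for z
  proof -
    show 1: "1 - a * norm z \<noteq> 0" using as[of "norm z"] that by auto
    have "a * norm z < 1" using as[of "norm z"] that by auto
    then show "norm (1 - cnj w * z) \<noteq> 0"
      using norm_triangle_ineq2[of 1 "cnj w * z"] by (auto simp: norm_mult a_def)
  qed
  have P0: "P z \<ge> 0" if "norm z < 1" for z
    using as[of "norm z"] that by (simp add: P_def)
  have contP: "continuous_on (cball 0 1) P"
    unfolding P_def using Pnz by (intro continuous_intros) auto
  have "integrable lborel (\<lambda>z. indicator (cball 0 1) z *\<^sub>R P z)"
    using contP by (intro borel_integrable_compact) auto
  then have siP: "set_integrable lborel (ball 0 1) P"
    unfolding set_integrable_def[symmetric] by (rule set_integrable_subset) auto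
  define I where "I s = complex_of_real (1 / (1 - a * s) * (2 * pi / (1 - a\<^sup>2 * s\<^sup>2)))" for s
  have "(LINT z:ball 0 1|lborel. complex_of_real (P z)) = (LINT s|lborel. indicator {0..<1} s *\<^sub>R (of_real s * I s))"
  proof (rule set_integral_disc_polar)
    show "set_integrable lborel (ball 0 1) (\<lambda>z. complex_of_real (P z))"
    proof -
      have "complex_integrable lborel (\<lambda>z. complex_of_real (indicator (ball 0 1) z *\<^sub>R P z))"
        using siP by (simp only: complex_of_real_integrable_eq set_integrable_def)
      then show ?thesis by (simp add: set_integrable_def scaleR_conv_of_real)
    qed
    show "continuous_on (ball 0 1) (\<lambda>z. complex_of_real (P z))"
      by (intro continuous_intros continuous_on_subset[OF contP]) auto
    fix s :: real assume s: "0 \<le> s" "s < 1"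
    have "((\<lambda>t. complex_of_real (1 / (1 - a * s)) * of_real (1 / (norm (1 - cnj w * (of_real s * cis t)))\<^sup>2))
       has_integral complex_of_real (1 / (1 - a * s)) * of_real (2 * pi / (1 - (norm w)\<^sup>2 * s\<^sup>2))) {0..2*pi}"
      by (intro has_integral_mult_right circle_integral_poisson w s)
    then show "((\<lambda>t. complex_of_real (P (of_real s * cis t))) has_integral I s) {0..2*pi}"
      unfolding P_def I_def a_def[symmetric] using s by (simp add: norm_mult)
  qed
  moreover have "(LINT z:ball 0 1|lborel. complex_of_real (P z)) = of_real (LINT z:ball 0 1|lborel. P z)"
    by (rule set_integral_complex_of_real)
  ultimately have "(LINT z:ball 0 1|lborel. P z) \<le> norm (LINT s|lborel. indicator {0..<1} s *\<^sub>R (of_real s * I s))"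
    by (metis abs_ge_self norm_of_real)
  also have "\<dots> \<le> (LINT s|lborel. norm (indicator {0..<1} s *\<^sub>R (of_real s * I s)))"
    by (rule integral_norm_bound)
  also have "\<dots> \<le> (LINT s|lborel. indicator {0..1} s *\<^sub>R (2 * pi / (1 - a * s)\<^sup>2))"
  proof (rule Bochner_Integration.integral_mono')
    show "integrable lborel (\<lambda>s. indicator {0..1} s *\<^sub>R (2 * pi / (1 - a * s)\<^sup>2))"
      using as by (intro borel_integrable_compact continuous_intros) (auto simp: less_imp_neq[symmetric])
    fix s :: real
    show "0 \<le> indicator {0..1} s *\<^sub>R (2 * pi / (1 - a * s)\<^sup>2)" by (auto split: split_indicator)
    show "norm (indicator {0..<1} s *\<^sub>R (of_real s * I s)) \<le> indicator {0..1} s *\<^sub>R (2 * pi / (1 - a * s)\<^sup>2)"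
    proof (cases "s \<in> {0..<1}")
      case True
      then have s: "0 \<le> s" "s \<le> 1" by auto
      note l = as[OF s]
      have "norm (of_real s * I s) = s * (1 / (1 - a * s) * (2 * pi / (1 - a\<^sup>2 * s\<^sup>2)))"
        unfolding I_def using s l by (simp add: norm_mult norm_divide del: of_real_mult of_real_diff of_real_divide)
      also have "\<dots> \<le> 1 * (1 / (1 - a * s) * (2 * pi / (1 - a * s)))"
        using s l by (intro mult_mono frac_le mult_nonneg_nonneg divide_nonneg_pos) auto
      finally show ?thesis using True by (simp add: power2_eq_square)
    qed (auto split: split_indicator)
  qed
  also have "(LINT s|lborel. indicator {0..1} s *\<^sub>R (2 * pi / (1 - a * s)\<^sup>2)) =
      (\<lambda>s. 2 * pi * (s / (1 - a * s))) 1 - (\<lambda>s. 2 * pi * (s / (1 - a * s))) 0"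
  proof (rule integral_FTC_atLeastAtMost)
    fix s :: real assume s: "0 \<le> s" "s \<le> 1"
    have "1 - a * s \<noteq> 0" using as[OF s] by simp
    then have "((\<lambda>s. 2 * pi * (s / (1 - a * s))) has_real_derivative
       2 * pi * ((1 * (1 - a * s) - s * (- a)) / ((1 - a * s) * (1 - a * s)))) (at s within {0..1})"
      by (intro DERIV_cmult DERIV_divide) (auto intro!: derivative_eq_intros)
    also have "2 * pi * ((1 * (1 - a * s) - s * (- a)) / ((1 - a * s) * (1 - a * s))) = 2 * pi / (1 - a * s)\<^sup>2"
      by (simp add: power2_eq_square mult.commute)
    finally show "((\<lambda>s. 2 * pi * (s / (1 - a * s))) has_vector_derivative 2 * pi / (1 - a * s)\<^sup>2) (at s within {0..1})"
      by (simp only: has_real_derivative_iff_has_vector_derivative)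
  qed (use as in \<open>auto intro!: continuous_intros simp: less_imp_neq[symmetric]\<close>)
  finally have IP: "(LINT z:ball 0 1|lborel. P z) \<le> 2 * pi / (1 - a)" by simp
  have "(LINT z:ball 0 1|lborel. norm (deriv (bloch_test w) z)) \<le> (LINT z:ball 0 1|lborel. 2 * (1 - a) * P z)"
  proof (rule set_integral_mono)
    show "set_integrable lborel (ball 0 1) (\<lambda>z. norm (deriv (bloch_test w) z))"
      by (intro W1_int bloch_test_W1 w)
    show "set_integrable lborel (ball 0 1) (\<lambda>z. 2 * (1 - a) * P z)"
      by (intro set_integrable_mult_right siP)
    show "norm (deriv (bloch_test w) z) \<le> 2 * (1 - a) * P z" if "z \<in> ball 0 1" for z
      using norm_deriv_bloch_test(1)[OF w, of z] that by (simp add: P_def a_def)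
  qed
  also have "\<dots> = 2 * (1 - a) * (LINT z:ball 0 1|lborel. P z)" by simp
  also have "\<dots> \<le> 2 * (1 - a) * (2 * pi / (1 - a))" using a IP by (intro mult_left_mono) auto
  also have "\<dots> = 4 * pi" using a by (simp add: field_simps)
  finally show ?thesis .
qed

text \<open>This takes the place of completeness of \<open>W1\<close>: absolutely summable
  combinations of test functions stay in the space, with the expected bound on the area
  integral.\<close>

lemma W1_test_series:
  fixes c :: "nat \<Rightarrow> complex"
  assumes w: "\<And>m. norm (w m) < 1" and c: "summable (\<lambda>m. norm (c m))"
  defines "g \<equiv> \<lambda>z. \<Sum>m. c m * bloch_test (w m) z"
  shows "g \<in> W1" and "(LINT z:ball 0 1|lborel. norm (deriv g z)) \<le> 4 * pi * (\<Sum>m. norm (c m))"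
    and "z \<in> ball 0 1 \<Longrightarrow> summable (\<lambda>m. c m * bloch_test (w m) z)" and "g 0 = 0"
proof -
  have hol: "bloch_test (w m) holomorphic_on ball 0 1" for m by (intro W1_holo bloch_test_W1 w)
  have "\<exists>g g'. \<forall>x\<in>ball 0 1. ((\<lambda>m. c m * bloch_test (w m) x) sums g x) \<and>
      ((\<lambda>m. c m * deriv (bloch_test (w m)) x) sums g' x) \<and> (g has_field_derivative g' x) (at x)"
  proof (rule series_and_derivative_comparison_local)
    show "open (ball (0::complex) 1)" by simp
    show "((\<lambda>x. c m * bloch_test (w m) x) has_field_derivative c m * deriv (bloch_test (w m)) x) (at x)"
      if "x \<in> ball 0 1" for m x
      by (intro DERIV_cmult holomorphic_derivI[OF hol open_ball that])
    fix x :: complex assume x: "x \<in> ball 0 1"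
    define \<rho> where "\<rho> = (1 - norm x) / 2"
    have \<rho>: "\<rho> > 0" using x by (simp add: \<rho>_def)
    have "norm (c m * bloch_test (w m) y) \<le> norm (c m) * (1 / \<rho>\<^sup>2)" if y: "y \<in> ball x \<rho>" for m y
    proof -
      have ny: "\<rho> \<le> 1 - norm y"
        using y norm_triangle_ineq2[of y x] by (simp add: dist_norm norm_minus_commute \<rho>_def field_simps)
      then have "norm y < 1" using \<rho> by linarith
      have "norm (bloch_test (w m) y) \<le> 1 / (1 - norm y)\<^sup>2"
        by (rule norm_deriv_bloch_test(3)[OF w \<open>norm y < 1\<close>])
      also have "\<dots> \<le> 1 / \<rho>\<^sup>2" using ny \<rho> by (intro frac_le power_mono) auto
      finally show ?thesis by (simp only: norm_mult) (rule mult_left_mono, auto)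
    qed
    moreover have "summable (\<lambda>m. norm (c m) * (1 / \<rho>\<^sup>2))" using c by (rule summable_mult2)
    ultimately show "\<exists>d h. 0 < d \<and> summable h \<and> (\<forall>\<^sub>F n in sequentially. \<forall>y\<in>ball x d \<inter> ball 0 1. norm (c n * bloch_test (w n) y) \<le> h n)"
      using \<rho> by (intro exI[of _ \<rho>] exI[of _ "\<lambda>m. norm (c m) * (1 / \<rho>\<^sup>2)"]) auto
  qed
  then obtain G G' where G: "\<And>x. x \<in> ball 0 1 \<Longrightarrow> (\<lambda>m. c m * bloch_test (w m) x) sums G x"
    "\<And>x. x \<in> ball 0 1 \<Longrightarrow> (\<lambda>m. c m * deriv (bloch_test (w m)) x) sums G' x"
    "\<And>x. x \<in> ball 0 1 \<Longrightarrow> (G has_field_derivative G' x) (at x)" by blast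
  show "z \<in> ball 0 1 \<Longrightarrow> summable (\<lambda>m. c m * bloch_test (w m) z)" using G(1) by (auto simp: sums_iff)
  have gG: "g x = G x" if "x \<in> ball 0 1" for x using G(1)[OF that] by (simp add: g_def sums_iff)
  have dg: "(g has_field_derivative G' x) (at x)" if "x \<in> ball 0 1" for x
    by (rule has_field_derivative_transform_within_open[OF G(3)[OF that] open_ball that]) (simp add: gG)
  then have hg: "g holomorphic_on ball 0 1"
    unfolding holomorphic_on_def field_differentiable_def by (blast intro: has_field_derivative_at_within)
  have G': "deriv g x = G' x" if "x \<in> ball 0 1" for x by (rule DERIV_imp_deriv[OF dg[OF that]])
  show "g 0 = 0" by (simp add: g_def bloch_test_def)
  define f where "f m z = indicator (ball 0 1) z *\<^sub>R norm (c m * deriv (bloch_test (w m)) z)" for m z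
  have fint: "integrable lborel (f m)" for m
    using set_integrable_mult_right[OF W1_int[OF bloch_test_W1[OF w]], of "norm (c m)" m]
    unfolding f_def set_integrable_def by (simp add: norm_mult)
  have f0: "f m z \<ge> 0" for m z by (simp add: f_def)
  have fle: "f m z \<le> norm (c m) * (indicator (ball 0 1) z * (2 / (1 - norm z) ^ 3))" for m z
  proof (cases "z \<in> ball 0 1")
    case True
    then have "norm (c m) * norm (deriv (bloch_test (w m)) z) \<le> norm (c m) * (2 / (1 - norm z) ^ 3)"
      by (intro mult_left_mono norm_deriv_bloch_test w) auto
    then show ?thesis using True by (simp add: f_def norm_mult)
  qed (simp add: f_def)
  have fs: "summable (\<lambda>m. f m z)" for z
    by (rule summable_comparison_test'[OF summable_mult2[OF c, of "indicator (ball 0 1) z * (2 / (1 - norm z) ^ 3)"], of 0])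
       (simp only: real_norm_def abs_of_nonneg[OF f0] fle)
  have If: "(LINT z|lborel. f m z) \<le> norm (c m) * (4 * pi)" for m
  proof -
    have "(LINT z|lborel. f m z) = norm (c m) * (LINT z:ball 0 1|lborel. norm (deriv (bloch_test (w m)) z))"
      unfolding set_lebesgue_integral_def integral_mult_right_zero[symmetric]
      by (intro Bochner_Integration.integral_cong) (auto simp: f_def norm_mult)
    then show ?thesis by (simp only:) (intro mult_left_mono bloch_test_W1_norm w norm_ge_zero)
  qed
  have Isum: "summable (\<lambda>m. LINT z|lborel. norm (f m z))"
    by (rule summable_comparison_test'[OF summable_mult2[OF c, of "4*pi"], of 0])
       (use If f0 in \<open>auto intro: integral_nonneg\<close>)
  have S: "integrable lborel (\<lambda>z. \<Sum>m. f m z)" "(\<lambda>m. LINT z|lborel. f m z) sums (LINT z|lborel. (\<Sum>m. f m z))"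
    using fs f0 by (intro integrable_suminf sums_integral fint Isum AE_I2; simp)+
  have dle: "indicator (ball 0 1) z *\<^sub>R norm (deriv g z) \<le> (\<Sum>m. f m z)" for z
  proof (cases "z \<in> ball 0 1")
    case True
    have "summable (\<lambda>m. norm (c m * deriv (bloch_test (w m)) z))" using fs[of z] True by (simp add: f_def)
    then have "norm (\<Sum>m. c m * deriv (bloch_test (w m)) z) \<le> (\<Sum>m. norm (c m * deriv (bloch_test (w m)) z))"
      by (rule summable_norm)
    then show ?thesis using True G(2)[OF True] by (simp add: G' f_def sums_iff)
  qed (simp add: f_def)
  have meas: "(\<lambda>z. indicator (ball 0 1) z *\<^sub>R norm (deriv g z)) \<in> borel_measurable borel"
    by (intro borel_measurable_continuous_on_indicator continuous_intros
        holomorphic_on_imp_continuous_on[OF holomorphic_deriv[OF hg open_ball]]) auto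
  have "norm (indicator (ball 0 1) z *\<^sub>R norm (deriv g z)) \<le> norm (\<Sum>m. f m z)" for z
    using order_trans[OF dle[of z] abs_ge_self] by simp
  then have int: "integrable lborel (\<lambda>z. indicator (ball 0 1) z *\<^sub>R norm (deriv g z))"
    using meas by (intro Bochner_Integration.integrable_bound[OF S(1)] AE_I2) auto
  then show "g \<in> W1" using hg by (simp add: W1_def set_integrable_def)
  have "(LINT z:ball 0 1|lborel. norm (deriv g z)) \<le> (LINT z|lborel. (\<Sum>m. f m z))"
    unfolding set_lebesgue_integral_def by (intro integral_mono int S(1) dle)
  also have "\<dots> = (\<Sum>m. LINT z|lborel. f m z)" using S(2) by (simp add: sums_iff)
  also have "\<dots> \<le> (\<Sum>m. norm (c m) * (4 * pi))"
    using S(2) by (intro suminf_le If summable_mult2 c) (auto simp: sums_iff)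
  also have "\<dots> = 4 * pi * (\<Sum>m. norm (c m))" using suminf_mult2[OF c, of "4*pi"] by (simp only: mult.commute)
  finally show "(LINT z:ball 0 1|lborel. norm (deriv g z)) \<le> 4 * pi * (\<Sum>m. norm (c m))" .
qed


text \<open>Choosing each sign so that the diagonal term is not cancelled by the earlier ones replaces
  the usual sliding-hump bookkeeping.\<close>

function signs :: "(nat \<Rightarrow> nat \<Rightarrow> complex) \<Rightarrow> nat \<Rightarrow> complex" where
  "signs A n = (if norm ((\<Sum>m<n. signs A m * A n m) + A n n) \<ge> norm (A n n) then 1 else -1)"
  by auto
termination by (relation "Wellfounded.measure snd") auto

declare signs.simps [simp del]

lemma norm_signs: "norm (signs A n) = 1"
  by (simp add: signs.simps[of A n])

text \<open>The vectors \<open>S + a\<close> and \<open>S - a\<close> differ by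
  \<open>2 * a\<close>, so they cannot both be shorter than \<open>a\<close>.\<close>

lemma norm_signs_sum_ge: "norm (A n n) \<le> norm (\<Sum>m<Suc n. signs A m * A n m)"
proof (cases "norm (A n n) \<le> norm ((\<Sum>m<n. signs A m * A n m) + A n n)")
  case True
  then have "signs A n = 1" by (simp add: signs.simps[of A n])
  with True show ?thesis by simp
next
  case False
  then have "signs A n = -1" by (simp add: signs.simps[of A n])
  moreover have "norm (A n n) \<le> norm ((\<Sum>m<n. signs A m * A n m) - A n n)"
    using False norm_triangle_ineq4[of "(\<Sum>m<n. signs A m * A n m) + A n n" "(\<Sum>m<n. signs A m * A n m) - A n n"]
    by (simp add: norm_mult[of 2, simplified] mult_2[symmetric] algebra_simps)
  ultimately show ?thesis by simp
qed


lemma bloch_pair_cong_right: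
  assumes "F \<in> bloch" "g \<in> W1" and "\<And>z. z \<in> ball 0 1 \<Longrightarrow> g z = h z"
  shows "bloch_pair F g = bloch_pair F h"
proof (rule bloch_pair_eqI[symmetric])
  show "((\<lambda>r. integral {0..2*pi} (\<lambda>t. F (of_real r * cis t) * cnj (h (of_real r * cis t))) / of_real (2*pi))
      \<longlongrightarrow> bloch_pair F g) (at_left 1)"
    by (rule Lim_transform_eventually[OF bloch_pair_lim[OF assms(1,2)]],
        rule eventually_mono[OF eventually_at_left_1_interval]) (simp add: assms(3) norm_mult)
qed

text \<open>Here \<open>h\<close> is the tail of a series, so that finite additivity is enough to
  split an infinite combination of test functions.\<close>

lemma bloch_pair_sum_right:
  fixes k :: nat
  assumes F: "F \<in> bloch" and g: "\<And>m. g m \<in> W1" and h: "h \<in> W1"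
  shows "(\<lambda>z. (\<Sum>m<k. c m * g m z) + h z) \<in> W1 \<and>
    bloch_pair F (\<lambda>z. (\<Sum>m<k. c m * g m z) + h z) = (\<Sum>m<k. cnj (c m) * bloch_pair F (g m)) + bloch_pair F h"
proof (induction k)
  case (Suc k)
  have eq: "(\<lambda>z. (\<Sum>m<Suc k. c m * g m z) + h z) = (\<lambda>z. c k * g k z + ((\<Sum>m<k. c m * g m z) + h z))"
    by (simp add: fun_eq_iff algebra_simps)
  show ?case unfolding eq
    using Suc.IH g[of k] by (simp add: W1_linear bloch_pair_linear_right[OF F])
qed (use h in simp)

text \<open>A gliding hump. If the seminorms \<open>N i\<close> were unbounded, then one function
  \<open>g 0 = (\<Sum>m. c m * bloch_test (w m))\<close> with \<open>norm (c m) = q ^ m\<close>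
  would have unbounded pairings: for the \<open>n\<close>-th chosen functional the terms up to
  \<open>n\<close> contribute at least \<open>q ^ n * N (idx n) / 2\<close>, by the choice of the
  signs, and the tail takes away only a fraction of that.\<close>

theorem bloch_uniform_boundedness:
  assumes F: "\<And>i::nat. F i \<in> bloch" and bdd: "\<And>g. g \<in> W1 \<Longrightarrow> Bseq (\<lambda>i. bloch_pair (F i) g)"
  shows "\<exists>C. \<forall>i. \<forall>z\<in>ball 0 1. (1 - norm z) * norm (deriv (F i) z) \<le> C"
proof (rule ccontr)
  assume neg: "\<not> ?thesis"
  \<comment> \<open>The tail beyond \<open>n\<close> pairs to at most
    \<open>16 * q / (1 - q) = 16 / 99\<close> times \<open>q ^ n * N (idx n)\<close>. Subtracted
    from the main part \<open>1 / 2\<close>, this leaves more than \<open>1 / 4\<close>.\<close>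
  define q :: real where "q = 1 / 100"
  have q: "0 < q" "q < 1" by (auto simp: q_def)
  define b where "b i z = (1 - norm z) * norm (deriv (F i) z)" for i z
  define N where "N i = (SUP z\<in>ball 0 1. b i z)" for i
  have bd: "bdd_above (b i ` ball 0 1)" for i
    using F[of i] unfolding bloch_def bdd_above_def b_def by blast
  have bN: "b i z \<le> N i" if "z \<in> ball 0 1" for i z
    unfolding N_def using that bd by (rule cSUP_upper)
  \<comment> \<open>The factor 4 compensates the remaining quarter, and the summand 1 makes the
    supremum positive also for \<open>n = 0\<close>.\<close>
  have "\<exists>i. real n / q ^ n * 4 + 1 < N i" for n
  proof (rule ccontr)
    assume "\<nexists>i. real n / q ^ n * 4 + 1 < N i"
    then have "\<forall>i. \<forall>z\<in>ball 0 1. b i z \<le> real n / q ^ n * 4 + 1" using bN by (meson not_less order_trans)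
    then show False using neg unfolding b_def by blast
  qed
  then obtain idx where idx: "\<And>n. real n / q ^ n * 4 + 1 < N (idx n)" by metis
  have Npos: "N (idx n) > 0" for n
  proof -
    have "0 \<le> real n / q ^ n * 4" using q by simp
    then show ?thesis using idx[of n] by linarith
  qed
  have "\<exists>w\<in>ball 0 1. N (idx n) / 2 < b (idx n) w" for n
    using less_cSUP_iff[OF _ bd, of "N (idx n) / 2" "idx n"] Npos[of n] unfolding N_def by auto
  then obtain w where w: "\<And>n. w n \<in> ball 0 1" "\<And>n. N (idx n) / 2 < b (idx n) (w n)" by metis
  have nw: "norm (w n) < 1" for n using w(1)[of n] by simp
  define A where "A n m = of_real (q ^ m) * bloch_pair (F (idx n)) (bloch_test (w m))" for n m
  \<comment> \<open>The signs are conjugated because the pairing is conjugate linear in its second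
    argument.\<close>
  define c where "c m = cnj (signs A m) * of_real (q ^ m)" for m
  have nc: "norm (c m) = q ^ m" for m using q by (simp add: c_def norm_mult norm_power norm_signs)
  have sc: "summable (\<lambda>m. norm (c (m + k)))" for k
    using q by (simp add: nc power_add summable_mult2)
  \<comment> \<open>The tail from index \<open>k\<close>; the function that refutes boundedness is
    \<open>g 0\<close>.\<close>
  define g where "g k z = (\<Sum>m. c (m + k) * bloch_test (w (m + k)) z)" for k z
  have g: "g k \<in> W1" "(LINT z:ball 0 1|lborel. norm (deriv (g k) z)) \<le> 4 * pi * (\<Sum>m. norm (c (m + k)))" "g k 0 = 0" for k
    using W1_test_series[of "\<lambda>m. w (m + k)" "\<lambda>m. c (m + k)", OF nw sc] by (simp_all add: g_def[abs_def])
  have tail: "(\<Sum>m. norm (c (m + k))) = q ^ k / (1 - q)" for k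
    using suminf_mult2[OF summable_geometric[of q], of "q ^ k"] suminf_geometric[of q] q
    by (simp add: nc power_add)
  have big: "real n \<le> norm (bloch_pair (F (idx n)) (g 0))" for n
  proof -
    let ?T = "bloch_pair (F (idx n))"
    have split: "(\<Sum>m<Suc n. c m * bloch_test (w m) z) + g (Suc n) z = g 0 z" if "z \<in> ball 0 1" for z
      using suminf_split_initial_segment[OF W1_test_series(3)[where w = w and c = c, OF nw sc[of 0, simplified] that], of "Suc n"]
      by (simp add: g_def add.commute)
    have "?T (g 0) = ?T (\<lambda>z. (\<Sum>m<Suc n. c m * bloch_test (w m) z) + g (Suc n) z)"
      using split by (intro bloch_pair_cong_right F g) simp
    also have "\<dots> = (\<Sum>m<Suc n. cnj (c m) * ?T (bloch_test (w m))) + ?T (g (Suc n))"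
      using bloch_pair_sum_right[where k = "Suc n" and c = c and g = "\<lambda>m. bloch_test (w m)",
          OF F[of "idx n"] bloch_test_W1[OF nw] g(1)[of "Suc n"]] by blast
    also have "(\<Sum>m<Suc n. cnj (c m) * ?T (bloch_test (w m))) = (\<Sum>m<Suc n. signs A m * A n m)"
      by (simp add: c_def A_def mult_ac)
    finally have T: "norm (?T (g 0)) \<ge> norm (\<Sum>m<Suc n. signs A m * A n m) - norm (?T (g (Suc n)))"
      by (metis norm_diff_ineq)
    have "norm (A n n) = q ^ n * b (idx n) (w n)"
      unfolding A_def bloch_pair_test[OF F nw] b_def using q nw[of n] 
      by (simp add: norm_mult norm_power del: of_real_diff)
    with norm_signs_sum_ge[of A n] have h: "q ^ n * b (idx n) (w n) \<le> norm (\<Sum>m<Suc n. signs A m * A n m)" by simp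
    have "norm (?T (g (Suc n))) \<le> norm (F (idx n) 0) * norm (g (Suc n) 0) + 4 * N (idx n) / pi * (LINT z:ball 0 1|lborel. norm (deriv (g (Suc n)) z))"
      using F[of "idx n"] bN[of _ "idx n"] by (intro bloch_pair_bound g) (auto simp: bloch_def b_def)
    also have "\<dots> \<le> 4 * N (idx n) / pi * (4 * pi * (q ^ Suc n / (1 - q)))"
    proof -
      have "4 * N (idx n) / pi * (LINT z:ball 0 1|lborel. norm (deriv (g (Suc n)) z)) \<le>
          4 * N (idx n) / pi * (4 * pi * (q ^ Suc n / (1 - q)))"
        using g(2)[of "Suc n"] less_imp_le[OF Npos[of n]] unfolding tail by (intro mult_left_mono) auto
      then show ?thesis by (simp only: g(3) norm_zero mult_zero_right add_0)
    qed
    also have "\<dots> = q ^ n * (N (idx n) * (16 / 99))"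
      by (simp add: q_def)
    finally have t: "norm (?T (g (Suc n))) \<le> q ^ n * (N (idx n) * (16 / 99))" .
    have "real n \<le> q ^ n * (N (idx n) * (1 / 4))"
    proof -
      have qn: "0 < q ^ n" using q by simp
      have "q ^ n * (real n / q ^ n * 4 + 1) < q ^ n * N (idx n)"
        using idx[of n] qn by (rule mult_strict_left_mono)
      also have "q ^ n * (real n / q ^ n * 4 + 1) = real n * 4 + q ^ n" using q by (simp add: distrib_left)
      finally show ?thesis using qn by linarith
    qed
    also have "\<dots> \<le> q ^ n * (b (idx n) (w n) - N (idx n) * (16 / 99))"
      using w(2)[of n] Npos[of n] q by (intro mult_left_mono) auto
    also have "\<dots> \<le> norm (?T (g 0))" using T h t by (simp add: right_diff_distrib)
    finally show ?thesis .
  qed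
  obtain K where K: "\<And>i. norm (bloch_pair (F i) (g 0)) \<le> K"
    using bdd[OF g(1)] by (auto simp: Bseq_def)
  obtain n where "K < real n" using reals_Archimedean2 by blast
  with K[of "idx n"] big[of n] show False by linarith
qed

section \<open>The lacunary sum of bumps\<close>

text \<open>The value is 1 at the \<open>N\<close>-th roots of unity and at most
  \<open>e / norm (1 - z ^ N)\<close> elsewhere in the disc for \<open>e > 0\<close>; the poles lie
  just outside the closed disc.\<close>

definition bump :: "real \<Rightarrow> nat \<Rightarrow> complex \<Rightarrow> complex" where
  "bump e N z = of_real e / (1 + of_real e - z ^ N)"

lemma bump_denom:
  assumes e: "e > 0" and z: "norm z \<le> 1"
  shows "1 + e - norm z ^ N \<le> norm (1 + of_real e - z ^ N)" "e \<le> Re (1 + of_real e - z ^ N)"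
    "1 + of_real e - z ^ N \<noteq> 0" "0 \<le> 1 - norm z ^ N"
proof -
  show zN: "0 \<le> 1 - norm z ^ N" using z by (simp add: power_le_one)
  have "norm (1 + of_real e :: complex) = 1 + e" using e norm_of_real[of "1 + e", where ?'a = complex] by simp
  then show 1: "1 + e - norm z ^ N \<le> norm (1 + of_real e - z ^ N)"
    using norm_triangle_ineq2[of "1 + of_real e" "z ^ N"] by (simp add: norm_power)
  then show "1 + of_real e - z ^ N \<noteq> 0" using e zN by auto
  show "e \<le> Re (1 + of_real e - z ^ N)"
    using complex_Re_le_cmod[of "z ^ N"] zN by (simp add: norm_power)
qed

lemma bump_norm:
  assumes e: "e > 0" and z: "norm z \<le> 1"
  shows "norm (bump e N z) \<le> e / (1 + e - norm z ^ N)"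
  unfolding bump_def using bump_denom[OF assms, of N] e by (auto simp: norm_divide intro!: frac_le)

lemma bump_norm_le_1:
  assumes e: "e > 0" and z: "norm z \<le> 1"
  shows "norm (bump e N z) \<le> 1"
proof -
  have "e / (1 + e - norm z ^ N) \<le> 1" using bump_denom[OF assms, of N] e by simp
  with bump_norm[OF assms, of N] show ?thesis by linarith
qed

text \<open>If \<open>Re D \<ge> e\<close> then \<open>Re (e / D) = e * Re D / norm D ^ 2\<close> is
  at least \<open>e ^ 2 / norm D ^ 2\<close>. Besides positivity this controls the mean square on
  the circle, since the mean of the real part is its value at 0.\<close>

lemma bump_Re:
  assumes e: "e > 0" and z: "norm z \<le> 1"
  shows "(norm (bump e N z))\<^sup>2 \<le> Re (bump e N z)"
proof -
  define D where "D = 1 + of_real e - z ^ N"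
  have D: "e \<le> Re D" "D \<noteq> 0" using bump_denom[OF assms, of N] by (auto simp: D_def)
  have "(norm (of_real e / D))\<^sup>2 = e * e / (norm D)\<^sup>2"
    using e by (simp add: norm_divide power_divide power2_eq_square)
  also have "\<dots> \<le> e * Re D / (norm D)\<^sup>2" using D e by (intro divide_right_mono mult_left_mono) auto
  also have "\<dots> = Re (of_real e / D)"
    by (simp add: Re_divide cmod_power2)
  finally show ?thesis by (simp add: bump_def D_def)
qed

lemma bump_deriv:
  assumes e: "e > 0" and z: "norm z \<le> 1"
  shows "(bump e N has_field_derivative (of_real e * of_nat N * z ^ (N - 1) / (1 + of_real e - z ^ N)\<^sup>2)) (at z)"
  unfolding bump_def[abs_def] using bump_denom(3)[OF assms, of N]
  by (auto intro!: derivative_eq_intros simp: power2_eq_square)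

text \<open>The geometric sum lies between \<open>N\<close> copies of its last term and
  \<open>N\<close> copies of its first.\<close>

lemma one_minus_power_ge:
  fixes \<rho> :: real
  assumes "0 \<le> \<rho>" "\<rho> \<le> 1"
  shows "(1 - \<rho>) * (real N * \<rho> ^ (N - 1)) \<le> 1 - \<rho> ^ N" "1 - \<rho> ^ N \<le> real N * (1 - \<rho>)"
proof -
  have s: "1 - \<rho> ^ N = (1 - \<rho>) * (\<Sum>i<N. \<rho> ^ i)" by (rule one_diff_power_eq)
  have "real N * \<rho> ^ (N - 1) = (\<Sum>i<N. \<rho> ^ (N - 1))" by simp
  also have "\<dots> \<le> (\<Sum>i<N. \<rho> ^ i)" using assms by (intro sum_mono power_decreasing) auto
  finally show "(1 - \<rho>) * (real N * \<rho> ^ (N - 1)) \<le> 1 - \<rho> ^ N"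
    unfolding s using assms by (intro mult_left_mono) auto
  have "(\<Sum>i<N. \<rho> ^ i) \<le> (\<Sum>i<N. 1)" using assms by (intro sum_mono power_le_one) auto
  then show "1 - \<rho> ^ N \<le> real N * (1 - \<rho>)"
    unfolding s using assms mult_left_mono[of "\<Sum>i<N. \<rho> ^ i" "real N" "1 - \<rho>"] by (simp add: mult.commute)
qed

text \<open>The majorant depends on the radius alone. As a function of \<open>x\<close> it peaks at
  \<open>x = e\<close> with value \<open>1 / 4\<close> and is at most \<open>x / e\<close> and
  \<open>e / x\<close>, so a bump is active only at radii where \<open>1 - norm z ^ N\<close> is
  comparable to \<open>e\<close>.\<close>

lemma norm_bump_deriv:
  fixes N :: nat
  assumes e: "e > 0" and z: "norm z \<le> 1"
  defines "x \<equiv> 1 - norm z ^ N"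
  shows "(1 - norm z) * norm (deriv (bump e N) z) \<le> x * e / (x + e)\<^sup>2"
proof -
  note d = bump_denom[OF e z, of N]
  have "norm (deriv (bump e N) z) = e * (real N * norm z ^ (N - 1)) / (norm (1 + of_real e - z ^ N))\<^sup>2"
    unfolding DERIV_imp_deriv[OF bump_deriv[OF e z]] using e by (simp add: norm_mult norm_divide norm_power)
  then have "(1 - norm z) * norm (deriv (bump e N) z) = e * ((1 - norm z) * (real N * norm z ^ (N - 1))) / (norm (1 + of_real e - z ^ N))\<^sup>2"
    by simp
  also have "\<dots> \<le> e * x / (x + e)\<^sup>2"
    using e d z one_minus_power_ge(1)[of "norm z" N] unfolding x_def
    by (intro frac_le mult_left_mono power_mono) auto
  finally show ?thesis by (simp add: mult.commute)
qed

text \<open>Bernoulli's inequality bounds \<open>1 + M * y\<close> by \<open>(1 + y) ^ M\<close>,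
  and \<open>(1 - y) * (1 + y) \<le> 1\<close>.\<close>

lemma bernoulli_upper:
  fixes y :: real
  assumes "0 \<le> y" "y \<le> 1"
  shows "(1 - y) ^ M \<le> 1 / (1 + real M * y)"
proof -
  have p: "0 < 1 + real M * y" using assms by (simp add: add_pos_nonneg)
  have "(1 - y) ^ M * (1 + real M * y) \<le> (1 - y) ^ M * (1 + y) ^ M"
    using assms Bernoulli_inequality[of y M] by (intro mult_left_mono) auto
  also have "\<dots> = (1 - y\<^sup>2) ^ M" by (simp add: power_mult_distrib[symmetric] algebra_simps power2_eq_square)
  also have "\<dots> \<le> 1" using assms by (intro power_le_one) (auto simp: power_le_one)
  finally show ?thesis using p by (simp add: field_simps)
qed

section \<open>The choice of heights and frequencies\<close>

definition eps :: "nat \<Rightarrow> real" where "eps k = (1 / 16) ^ Suc k"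

text \<open>Consecutive frequencies have ratio \<open>64 ^ (2 * k + 3)\<close>, which beats the
  width of the active range of bump \<open>k\<close>. The logarithm grows quadratically in
  \<open>k\<close>, which beats the linear growth of \<open>bump_sum\<close> at these
  scales.\<close>

definition frq :: "nat \<Rightarrow> nat" where "frq k = 64 ^ (Suc k)\<^sup>2"

lemma eps_pos: "eps k > 0" by (simp add: eps_def)
lemma eps_le: "eps k \<le> 1 / 16" unfolding eps_def using power_decreasing[of 1 "Suc k" "1/16::real"] by simp
lemma frq_pos: "frq k > 0" by (simp add: frq_def)

lemma eps_sqrt: "eps k = ((1 / 4) ^ Suc k)\<^sup>2"
proof -
  have "((1 / 4 :: real) ^ Suc k)\<^sup>2 = ((1 / 4)\<^sup>2) ^ Suc k" by (metis power_mult mult.commute)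
  also have "(1 / 4 :: real)\<^sup>2 = 1 / 16" by (simp add: power2_eq_square)
  finally show ?thesis by (simp only: eps_def)
qed

lemma eps_summable: "summable eps"
  unfolding eps_def[abs_def] by (simp add: summable_geometric)

lemma eps_tail: "(\<Sum>j. eps (j + K)) = eps K * (16 / 15)" "summable (\<lambda>j. eps (j + K))"
proof -
  have e: "eps (j + K) = eps K * (1 / 16) ^ j" for j by (simp add: eps_def power_add)
  show "summable (\<lambda>j. eps (j + K))" unfolding e by (intro summable_mult summable_geometric) auto
  show "(\<Sum>j. eps (j + K)) = eps K * (16 / 15)"
    unfolding e by (subst suminf_mult) (auto simp: suminf_geometric)
qed

lemma frq_factor:
  assumes "k < l"
  obtains M where "frq l = frq k * M" "64 ^ (2 * k + 3) \<le> M"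
proof
  have le: "(Suc k)\<^sup>2 + (2 * k + 3) \<le> (Suc l)\<^sup>2"
  proof -
    have "(Suc k)\<^sup>2 + (2 * k + 3) = (Suc (Suc k))\<^sup>2" by (simp add: power2_eq_square)
    also have "\<dots> \<le> (Suc l)\<^sup>2" using assms by (intro power_mono) auto
    finally show ?thesis .
  qed
  show "frq l = frq k * 64 ^ ((Suc l)\<^sup>2 - (Suc k)\<^sup>2)"
    unfolding frq_def power_add[symmetric] using le by simp
  show "64 ^ (2 * k + 3) \<le> (64::nat) ^ ((Suc l)\<^sup>2 - (Suc k)\<^sup>2)"
    using le by (intro power_increasing) auto
qed

lemma frq_mono: "k \<le> l \<Longrightarrow> frq k \<le> frq l"
  unfolding frq_def by (intro power_increasing power_mono) auto

text \<open>The frequencies are so sparse that at most one bump is active at any given radius; the exponent 3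
  leaves room because \<^term>\<open>eps k\<close> is the square of \<^term>\<open>(1 / 4 :: real) ^ Suc k\<close>.\<close>

lemma later_scale:
  fixes \<rho> :: real
  assumes \<rho>: "0 \<le> \<rho>" "\<rho> \<le> 1" and kl: "k < l" and x: "((1 / 4) ^ Suc k) ^ 3 \<le> 1 - \<rho> ^ frq k"
  shows "1 / 2 \<le> 1 - \<rho> ^ frq l"
proof -
  define y where "y = 1 - \<rho> ^ frq k"
  have y: "0 \<le> y" "y \<le> 1" using \<rho> by (auto simp: y_def power_le_one)
  obtain M where M: "frq l = frq k * M" "64 ^ (2 * k + 3) \<le> M" using frq_factor[OF kl] .
  have "(1::real) \<le> 64 ^ (2 * k + 3) * ((1 / 4) ^ Suc k) ^ 3"
  proof -
    have "((1 / 4::real) ^ Suc k) ^ 3 = ((1 / 4) ^ 3) ^ Suc k" by (metis power_mult mult.commute)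
    also have "(1 / 4::real) ^ 3 = 1 / 64" by (simp add: power3_eq_cube)
    finally have "((1 / 4::real) ^ Suc k) ^ 3 = (1 / 64) ^ Suc k" .
    moreover have "(64::real) ^ (2 * k + 3) = 64 ^ (k + 2) * 64 ^ Suc k"
      by (simp only: power_add[symmetric], rule arg_cong[where f = "power 64"], simp)
    ultimately have "(64::real) ^ (2 * k + 3) * ((1 / 4) ^ Suc k) ^ 3 = 64 ^ (k + 2)"
      by (simp only: mult.assoc power_mult_distrib[symmetric]) simp
    then show ?thesis by (simp only:) (rule one_le_power, simp)
  qed
  also have "\<dots> \<le> real M * y"
    using M(2) x y unfolding y_def[symmetric] of_nat_le_iff[symmetric, where ?'a = real]
    by (intro mult_mono) auto
  finally have My: "1 \<le> real M * y" .
  have "\<rho> ^ frq l = (1 - y) ^ M" by (simp add: M(1) y_def power_mult)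
  also have "\<dots> \<le> 1 / (1 + real M * y)" by (rule bernoulli_upper[OF y])
  also have "\<dots> \<le> 1 / 2" using My by (intro frac_le) auto
  finally show ?thesis by simp
qed

definition bump_term :: "nat \<Rightarrow> complex \<Rightarrow> complex" where "bump_term k = bump (eps k) (frq k)"

definition bump_sum :: "complex \<Rightarrow> complex" where "bump_sum z = 1 + (\<Sum>k. bump_term k z)"

lemma bump_term_norm:
  assumes z: "norm z < 1"
  shows "norm (bump_term k z) \<le> eps k / (1 - norm z ^ frq k)" and "norm (bump_term k z) \<le> eps k / (1 - norm z)"
proof -
  have p: "norm z ^ frq k \<le> norm z ^ 1" using z frq_pos[of k] by (intro power_decreasing) auto
  have "norm (bump_term k z) \<le> eps k / (1 + eps k - norm z ^ frq k)"
    unfolding bump_term_def using z by (intro bump_norm eps_pos) auto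
  also have "\<dots> \<le> eps k / (1 - norm z ^ frq k)"
    using p z eps_pos[of k] by (intro divide_left_mono mult_pos_pos) auto
  finally show 1: "norm (bump_term k z) \<le> eps k / (1 - norm z ^ frq k)" .
  also have "\<dots> \<le> eps k / (1 - norm z)"
    using p z eps_pos[of k] by (intro divide_left_mono mult_pos_pos) auto
  finally show "norm (bump_term k z) \<le> eps k / (1 - norm z)" .
qed

lemma bump_term_summable: "norm z < 1 \<Longrightarrow> summable (\<lambda>k. norm (bump_term k z))"
  by (rule summable_comparison_test'[OF summable_mult2[OF eps_summable, of "1 / (1 - norm z)"], of 0])
     (simp add: bump_term_norm)

lemma bump_sum_derivative:
  assumes z: "z \<in> ball 0 1"
  shows "(bump_sum has_field_derivative deriv bump_sum z) (at z)" "(\<lambda>k. deriv (bump_term k) z) sums deriv bump_sum z"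
proof -
  have "\<exists>g g'. \<forall>x\<in>ball 0 1. ((\<lambda>k. bump_term k x) sums g x) \<and>
      ((\<lambda>k. deriv (bump_term k) x) sums g' x) \<and> (g has_field_derivative g' x) (at x)"
  proof (rule series_and_derivative_comparison_local)
    show "open (ball (0::complex) 1)" by simp
    show "(bump_term k has_field_derivative deriv (bump_term k) x) (at x)" if "x \<in> ball 0 1" for k x
      using bump_deriv[OF eps_pos, of x k "frq k"] that unfolding bump_term_def by (auto simp: DERIV_imp_deriv)
    fix x :: complex assume x: "x \<in> ball 0 1"
    define \<rho> where "\<rho> = (1 - norm x) / 2"
    have \<rho>: "\<rho> > 0" using x by (simp add: \<rho>_def)
    have "norm (bump_term k y) \<le> eps k * (1 / \<rho>)" if y: "y \<in> ball x \<rho>" for k y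
    proof -
      have ny: "\<rho> \<le> 1 - norm y"
        using y norm_triangle_ineq2[of y x] by (simp add: dist_norm norm_minus_commute \<rho>_def field_simps)
      then have "norm (bump_term k y) \<le> eps k / (1 - norm y)" using \<rho> by (intro bump_term_norm) auto
      also have "\<dots> \<le> eps k / \<rho>" using ny \<rho> eps_pos[of k] by (intro frac_le) auto
      finally show ?thesis by simp
    qed
    moreover have "summable (\<lambda>k. eps k * (1 / \<rho>))" by (intro summable_mult2 eps_summable)
    ultimately show "\<exists>d h. 0 < d \<and> summable h \<and> (\<forall>\<^sub>F n in sequentially. \<forall>y\<in>ball x d \<inter> ball 0 1. norm (bump_term n y) \<le> h n)"
      using \<rho> by (intro exI[of _ \<rho>] exI[of _ "\<lambda>k. eps k * (1 / \<rho>)"]) auto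
  qed
  then obtain G G' where G: "\<And>x. x \<in> ball 0 1 \<Longrightarrow> (\<lambda>k. bump_term k x) sums G x"
    "\<And>x. x \<in> ball 0 1 \<Longrightarrow> (\<lambda>k. deriv (bump_term k) x) sums G' x"
    "\<And>x. x \<in> ball 0 1 \<Longrightarrow> (G has_field_derivative G' x) (at x)" by blast
  have "((\<lambda>x. 1 + G x) has_field_derivative G' z) (at z)"
    using G(3)[OF z] by (auto intro!: derivative_eq_intros)
  then have "(bump_sum has_field_derivative G' z) (at z)"
    by (rule has_field_derivative_transform_within_open[OF _ open_ball z]) (use G(1) in \<open>simp add: bump_sum_def sums_iff\<close>)
  then show "(bump_sum has_field_derivative deriv bump_sum z) (at z)" "(\<lambda>k. deriv (bump_term k) z) sums deriv bump_sum z"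
    using G(2)[OF z] by (auto simp: DERIV_imp_deriv)
qed

lemma bump_sum_holomorphic: "bump_sum holomorphic_on ball 0 1"
  unfolding holomorphic_on_def field_differentiable_def
  using bump_sum_derivative(1) by (blast intro: has_field_derivative_at_within)

lemma bump_sum_Re_ge_1:
  assumes z: "z \<in> ball 0 1"
  shows "1 \<le> Re (bump_sum z)"
proof -
  have s: "summable (\<lambda>k. bump_term k z)" using bump_term_summable[of z] z by (auto intro: summable_norm_cancel)
  have "0 \<le> Re (bump_term k z)" for k
    using bump_Re[OF eps_pos, of z k "frq k"] z unfolding bump_term_def by (smt (verit) zero_le_power2 mem_ball_0)
  then have "0 \<le> (\<Sum>k. Re (bump_term k z))" by (intro suminf_nonneg summable_Re s)
  then show ?thesis using Re_suminf[OF s] by (simp add: bump_sum_def)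
qed

definition bump_weight :: "nat \<Rightarrow> real \<Rightarrow> real" where
  "bump_weight k \<rho> = (1 - \<rho> ^ frq k) * eps k / (1 - \<rho> ^ frq k + eps k)\<^sup>2"

lemma bump_term_deriv_bound:
  "norm z < 1 \<Longrightarrow> (1 - norm z) * norm (deriv (bump_term k) z) \<le> bump_weight k (norm z)"
  unfolding bump_term_def bump_weight_def by (rule norm_bump_deriv) (auto simp: eps_pos)

lemma weight_bounds:
  fixes x e :: real
  assumes "0 \<le> x" "0 < e"
  shows "x * e / (x + e)\<^sup>2 \<le> x / e" "x > 0 \<Longrightarrow> x * e / (x + e)\<^sup>2 \<le> e / x" "x * e / (x + e)\<^sup>2 \<le> 1" "0 \<le> x * e / (x + e)\<^sup>2"
proof -
  have "x * e / (x + e)\<^sup>2 \<le> x * e / e\<^sup>2" using assms by (intro divide_left_mono power_mono mult_pos_pos) auto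
  then show "x * e / (x + e)\<^sup>2 \<le> x / e" using assms by (simp add: power2_eq_square)
  show "x * e / (x + e)\<^sup>2 \<le> e / x" if "x > 0"
  proof -
    have "x * e / (x + e)\<^sup>2 \<le> x * e / x\<^sup>2" using assms that by (intro divide_left_mono power_mono mult_pos_pos) auto
    then show ?thesis using that by (simp add: power2_eq_square)
  qed
  have "x * e \<le> (x + e)\<^sup>2" using assms by (simp add: power2_eq_square algebra_simps)
  then show "x * e / (x + e)\<^sup>2 \<le> 1" using assms by (simp add: divide_le_eq_1)
  show "0 \<le> x * e / (x + e)\<^sup>2" using assms by simp
qed

text \<open>Let \<open>r\<close> be the square root of \<open>eps k\<close> and
  \<open>x = 1 - \<rho> ^ frq k\<close>. The weight is at most \<open>r\<close> if
  \<open>x \<ge> r\<close> or \<open>x \<le> r ^ 3\<close>, and at most 1 in the window between. By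
  \<open>later_scale\<close> an index in its window forces \<open>x \<ge> 1 / 2\<close> for every
  later index, so at most one index is in its window, and the total is at most
  \<open>1 / 3 + 1\<close>.\<close>

lemma bump_weight_sum:
  assumes \<rho>: "0 \<le> \<rho>" "\<rho> < 1"
  shows "summable (\<lambda>k. bump_weight k \<rho>)" "(\<Sum>k. bump_weight k \<rho>) \<le> 2"
proof -
  define r where "r k = ((1 / 4) ^ Suc k :: real)" for k
  define x where "x k = 1 - \<rho> ^ frq k" for k
  have rp: "r k > 0" for k by (simp add: r_def)
  have r1: "r k \<le> 1 / 4" for k unfolding r_def using power_decreasing[of 1 "Suc k" "1/4::real"] by simp
  have er: "eps k = r k * r k" for k by (simp add: eps_sqrt r_def power2_eq_square)
  have x0: "0 \<le> x k" for k using \<rho> by (simp add: x_def power_le_one)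
  define B where "B = {k. r k ^ 3 < x k \<and> x k < r k}"
  have B1: "l \<notin> B" if "k \<in> B" "k < l" for k l
  proof -
    have "1 / 2 \<le> x l" unfolding x_def
      by (rule later_scale[OF \<rho>(1) less_imp_le[OF \<rho>(2)] that(2)]) (use that(1) in \<open>simp add: B_def r_def x_def\<close>)
    then show ?thesis using r1[of l] by (auto simp: B_def)
  qed
  have w: "bump_weight k \<rho> \<le> r k + indicator B k" for k
  proof -
    note wb = weight_bounds[OF x0[of k] eps_pos[of k]]
    have W: "bump_weight k \<rho> = x k * eps k / (x k + eps k)\<^sup>2" by (simp add: bump_weight_def x_def)
    consider "k \<in> B" | "r k \<le> x k" | "x k \<le> r k ^ 3" by (force simp: B_def)
    then show ?thesis
    proof cases
      case 1
      then show ?thesis using wb(3) rp[of k] by (simp add: W)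
    next
      case 2
      then have "x k > 0" using rp[of k] by linarith
      have "eps k / x k \<le> r k" using 2 \<open>x k > 0\<close> rp[of k] by (simp add: er field_simps)
      then show ?thesis using wb(2)[OF \<open>x k > 0\<close>] by (simp add: W) (smt (verit) indicator_pos_le)
    next
      case 3
      have "x k / eps k \<le> r k" using 3 rp[of k] by (simp add: er field_simps power3_eq_cube)
      then show ?thesis using wb(1) by (simp add: W) (smt (verit) indicator_pos_le)
    qed
  qed
  have w0: "0 \<le> bump_weight k \<rho>" for k
    using weight_bounds(4)[OF x0[of k] eps_pos[of k]] by (simp add: bump_weight_def x_def)
  have fin: "finite B" and card: "card B \<le> 1"
  proof -
    have sub: "B \<subseteq> {k}" if "k \<in> B" for k using B1 that by (metis insertI1 linorder_neqE_nat subsetI)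
    then show "finite B" by (metis all_not_in_conv finite.simps finite_subset)
    show "card B \<le> 1" using sub by (metis One_nat_def card.empty card_mono card_1_singleton_iff all_not_in_conv finite.emptyI finite_insert le0 order_trans is_singletonI is_singleton_altdef le_refl)
  qed
  have rs: "r sums (1 / 3)"
    using sums_mult2[OF geometric_sums[of "1/4::real"], of "1/4"] unfolding r_def[abs_def] by (simp add: mult.commute)
  have "(\<lambda>k. indicator B k :: real) sums (\<Sum>k\<in>B. indicator B k)"
    by (rule sums_finite[OF fin]) auto
  then have ind: "(\<lambda>k. indicator B k :: real) sums real (card B)" by simp
  note rsi = sums_add[OF rs ind]
  show s: "summable (\<lambda>k. bump_weight k \<rho>)"
    by (rule summable_comparison_test'[OF sums_summable[OF rsi], of 0])
       (use w w0 in \<open>simp only: real_norm_def abs_of_nonneg\<close>)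
  have "(\<Sum>k. bump_weight k \<rho>) \<le> (\<Sum>k. r k + indicator B k)"
    by (intro suminf_le w s sums_summable[OF rsi])
  also have "\<dots> = 1 / 3 + real (card B)" using rsi by (simp add: sums_iff)
  finally show "(\<Sum>k. bump_weight k \<rho>) \<le> 2" using card by simp
qed

lemma bump_sum_bloch_bound:
  assumes z: "z \<in> ball 0 1"
  shows "(1 - norm z) * norm (deriv bump_sum z) \<le> 2"
proof -
  have z1: "norm z < 1" using z by simp
  have s: "summable (\<lambda>k. (1 - norm z) * norm (deriv (bump_term k) z))"
    by (rule summable_comparison_test'[OF bump_weight_sum(1)[of "norm z"], of 0])
       (use z1 bump_term_deriv_bound[OF z1] in \<open>auto simp: abs_mult\<close>)
  then have s': "summable (\<lambda>k. norm (deriv (bump_term k) z))" using z1 by (simp add: summable_cmult_iff)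
  have "(1 - norm z) * norm (deriv bump_sum z) \<le> (1 - norm z) * (\<Sum>k. norm (deriv (bump_term k) z))"
    using summable_norm[OF s'] bump_sum_derivative(2)[OF z] z1 by (intro mult_left_mono) (auto simp: sums_iff)
  also have "\<dots> = (\<Sum>k. (1 - norm z) * norm (deriv (bump_term k) z))" using s' by (simp add: suminf_mult)
  also have "\<dots> \<le> (\<Sum>k. bump_weight k (norm z))"
    using z1 by (intro suminf_le bump_term_deriv_bound s bump_weight_sum) auto
  also have "\<dots> \<le> 2" using z1 by (intro bump_weight_sum) auto
  finally show ?thesis .
qed


text \<open>Each of the first \<open>K\<close> bumps is at most 1. From \<open>K\<close> on, the
  hypothesis bounds bump \<open>j\<close> by \<open>eps j / eps K\<close>, a geometric series with
  sum \<open>16 / 15\<close>.\<close>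

lemma bump_sum_growth:
  assumes z: "z \<in> ball 0 1" and x: "eps K \<le> 1 - norm z ^ frq K"
  shows "norm (bump_sum z) \<le> real K + 3"
proof -
  have z1: "norm z < 1" using z by simp
  note sm = bump_term_summable[OF z1]
  have tail: "norm (bump_term (j + K) z) \<le> eps (j + K) * (1 / eps K)" for j
  proof -
    have "norm z ^ frq (j + K) \<le> norm z ^ frq K" using z1 by (intro power_decreasing frq_mono) auto
    with x have le: "eps K \<le> 1 - norm z ^ frq (j + K)" by linarith
    have "norm (bump_term (j + K) z) \<le> eps (j + K) / (1 - norm z ^ frq (j + K))" by (rule bump_term_norm(1)[OF z1])
    also have "\<dots> \<le> eps (j + K) / eps K" using le eps_pos[of K] eps_pos[of "j + K"] by (intro frac_le) auto
    finally show ?thesis by simp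
  qed
  have "(\<Sum>k. norm (bump_term k z)) = (\<Sum>j. norm (bump_term (j + K) z)) + (\<Sum>k<K. norm (bump_term k z))"
    by (rule suminf_split_initial_segment[OF sm])
  also have "\<dots> \<le> (\<Sum>j. eps (j + K) * (1 / eps K)) + (\<Sum>k<K. 1)"
    using z1 by (intro add_mono suminf_le sum_mono tail summable_mult2 eps_tail sm[THEN summable_ignore_initial_segment])
      (simp add: bump_term_def bump_norm_le_1 eps_pos)
  also have "\<dots> \<le> 2 + real K" 
    using suminf_mult2[OF eps_tail(2)[of K], of "1 / eps K"] eps_pos[of K] by (simp add: eps_tail(1))
  finally have "norm (\<Sum>k. bump_term k z) \<le> 2 + real K" using summable_norm[OF sm] by linarith
  then show ?thesis unfolding bump_sum_def using norm_triangle_ineq[of 1 "\<Sum>k. bump_term k z"] by simp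
qed

text \<open>At such a point the denominator of bump \<open>k\<close> equals
  \<open>2 * eps k\<close>, and its derivative alone contributes at least \<open>15 / 64\<close>.
  Every other bump contributes at most \<open>2 * eps j\<close>, in total at most
  \<open>2 / 15\<close>, and \<open>15 / 64 - 2 / 15 > 1 / 16\<close>.\<close>

lemma bump_sum_active:
  assumes z: "z \<in> ball 0 1" and zk: "z ^ frq k = of_real (1 - eps k)"
  shows "1 / 16 \<le> (1 - norm z) * norm (deriv bump_sum z)"
proof -
  define \<rho> where "\<rho> = norm z"
  have \<rho>: "0 \<le> \<rho>" "\<rho> < 1" using z by (auto simp: \<rho>_def)
  define N where "N = frq k"
  define e where "e = eps k"
  have e: "0 < e" "e \<le> 1 / 16" using eps_pos[of k] eps_le[of k] by (auto simp: e_def)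
  have N: "N > 0" using frq_pos by (simp add: N_def)
  have \<rho>N: "\<rho> ^ N = 1 - e"
    using zk e norm_power[of z "frq k"] by (simp add: \<rho>_def N_def e_def del: of_real_diff)
  have \<rho>N1: "15 / 16 \<le> \<rho> ^ (N - 1)"
  proof -
    have "\<rho> ^ N \<le> \<rho> ^ (N - 1)" using \<rho> by (intro power_decreasing) auto
    then show ?thesis using \<rho>N e by linarith
  qed
  have NB: "e \<le> real N * (1 - \<rho>)" using one_minus_power_ge(2)[of \<rho> N] \<rho> \<rho>N by simp
  have NU: "real N * (1 - \<rho>) \<le> 2 * e"
  proof -
    have "(real N * (1 - \<rho>)) * (15 / 16) \<le> (real N * (1 - \<rho>)) * \<rho> ^ (N - 1)"
      using \<rho>N1 \<rho> by (intro mult_left_mono) auto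
    also have "\<dots> \<le> e" using one_minus_power_ge(1)[of \<rho> N] \<rho> \<rho>N by (simp add: mult_ac)
    finally show ?thesis using e by linarith
  qed
  have main: "15 / 64 \<le> (1 - \<rho>) * norm (deriv (bump_term k) z)"
  proof -
    have "1 + of_real e - z ^ N = of_real (2 * e)" using zk by (simp add: N_def e_def)
    moreover have "deriv (bump e N) z = of_real e * of_nat N * z ^ (N - 1) / (1 + of_real e - z ^ N)\<^sup>2"
      by (rule DERIV_imp_deriv[OF bump_deriv[OF e(1)]]) (use z in simp)
    ultimately have "deriv (bump_term k) z = of_real e * of_nat N * z ^ (N - 1) / (of_real (2 * e))\<^sup>2"
      by (simp only: bump_term_def N_def[symmetric] e_def[symmetric])
    then have "norm (deriv (bump_term k) z) = e * real N * \<rho> ^ (N - 1) / (2 * e)\<^sup>2"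
      using e by (simp add: norm_mult norm_divide norm_power \<rho>_def del: of_real_mult)
    then have "(1 - \<rho>) * norm (deriv (bump_term k) z) = (real N * (1 - \<rho>)) * \<rho> ^ (N - 1) * (1 / (4 * e))"
      using e by (simp add: power2_eq_square field_simps)
    also have "\<dots> \<ge> e * (15 / 16) * (1 / (4 * e))"
      using NB \<rho>N1 e by (intro mult_mono) auto
    finally show ?thesis using e by simp
  qed
  \<comment> \<open>Write \<open>x\<close> for \<open>1 - \<rho> ^ frq j\<close>. A later bump is
    past its active range, \<open>x \<ge> 1 / 2\<close>, and its weight is at most
    \<open>eps j / x\<close>. An earlier bump has not reached it: the frequency ratio
    \<open>M \<ge> 1 / eps j\<close> forces \<open>x \<le> 2 * (eps j) ^ 2\<close>, and its weight
    is at most \<open>x / eps j\<close>.\<close>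
  have other: "(1 - \<rho>) * norm (deriv (bump_term j) z) \<le> 2 * eps j" if "j \<noteq> k" for j
  proof -
    have x0: "0 \<le> 1 - \<rho> ^ frq j" using \<rho> by (simp add: power_le_one)
    note wb = weight_bounds[OF x0 eps_pos[of j]]
    have b: "(1 - \<rho>) * norm (deriv (bump_term j) z) \<le> (1 - \<rho> ^ frq j) * eps j / (1 - \<rho> ^ frq j + eps j)\<^sup>2"
      using bump_term_deriv_bound[of z j] \<rho> by (simp add: \<rho>_def bump_weight_def)
    show ?thesis
    proof (cases "k < j")
      case True
      have "((1 / 4 :: real) ^ Suc k) ^ 3 \<le> ((1 / 4) ^ Suc k)\<^sup>2"
        by (intro power_decreasing power_le_one) auto
      then have "((1 / 4 :: real) ^ Suc k) ^ 3 \<le> 1 - \<rho> ^ frq k"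
        using \<rho>N eps_sqrt[of k] by (simp add: N_def e_def)
      then have "1 / 2 \<le> 1 - \<rho> ^ frq j" by (rule later_scale[OF \<rho>(1) less_imp_le[OF \<rho>(2)] True])
      moreover from this have "eps j / (1 - \<rho> ^ frq j) \<le> eps j / (1 / 2)"
        using eps_pos[of j] by (intro divide_left_mono) auto
      ultimately show ?thesis using b wb(2) by simp
    next
      case False
      with that have jk: "j < k" by simp
      obtain M where M: "frq k = frq j * M" "64 ^ (2 * j + 3) \<le> M" using frq_factor[OF jk] .
      have "real M * (real (frq j) * (1 - \<rho>)) \<le> 2 * e" using NU by (simp add: N_def M(1) mult_ac)
      also have "e \<le> eps j"
        unfolding e_def eps_def using jk by (intro power_decreasing) auto
      finally have "real M * (real (frq j) * (1 - \<rho>)) \<le> 2 * eps j" by simp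
      moreover have "(1::real) \<le> real M * eps j"
      proof -
        have "(1::real) = 16 ^ Suc j * (1 / 16) ^ Suc j" by (simp add: power_one_over)
        also have "\<dots> \<le> real M * eps j"
        proof -
          have "(16::nat) ^ Suc j \<le> 64 ^ Suc j" by (intro power_mono) auto
          also have "\<dots> \<le> 64 ^ (2 * j + 3)" by (intro power_increasing) auto
          also have "\<dots> \<le> M" by (rule M)
          finally have "real (16 ^ Suc j) \<le> real M" by (simp only: of_nat_le_iff)
          then show ?thesis unfolding eps_def by (intro mult_right_mono) auto
        qed
        finally show ?thesis .
      qed
      ultimately have "real (frq j) * (1 - \<rho>) \<le> (real M * eps j) * (real (frq j) * (1 - \<rho>))"
        and A: "(real M * eps j) * (real (frq j) * (1 - \<rho>)) \<le> eps j * (2 * eps j)"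
        using \<rho> eps_pos[of j] mult_right_mono[of 1 "real M * eps j" "real (frq j) * (1 - \<rho>)"]
          mult_left_mono[of "real M * (real (frq j) * (1 - \<rho>))" "2 * eps j" "eps j"]
        by (simp_all add: mult_ac)
      then have "1 - \<rho> ^ frq j \<le> eps j * (2 * eps j)"
        using one_minus_power_ge(2)[of \<rho> "frq j"] \<rho> by linarith
      then have "(1 - \<rho> ^ frq j) / eps j \<le> 2 * eps j" using eps_pos[of j] by (simp add: field_simps)
      then show ?thesis using b wb(1) by linarith
    qed
  qed
  define t where "t j = (if j = k then 0 else deriv (bump_term j) z)" for j
  have "(\<lambda>j. deriv (bump_term j) z - (if j = k then deriv (bump_term j) z else 0)) sums (deriv bump_sum z - deriv (bump_term k) z)"
    by (intro sums_diff bump_sum_derivative(2) z sums_single)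
  also have "(\<lambda>j. deriv (bump_term j) z - (if j = k then deriv (bump_term j) z else 0)) = t" by (auto simp: t_def)
  finally have ts: "t sums (deriv bump_sum z - deriv (bump_term k) z)" .
  have tb: "norm (of_real (1 - \<rho>) * t j) \<le> 2 * eps j" for j
    using other[of j] \<rho> eps_pos[of j] by (auto simp: t_def norm_mult simp del: of_real_diff)
  have "norm (\<Sum>j. of_real (1 - \<rho>) * t j) \<le> (\<Sum>j. 2 * eps j)"
    by (intro norm_suminf_le tb summable_mult eps_summable)
  also have "(\<Sum>j. 2 * eps j) = 2 * (eps 0 * (16 / 15))" using suminf_mult[OF eps_summable, of 2] eps_tail(1)[of 0] by simp
  also have "\<dots> = 2 / 15" by (simp add: eps_def)
  finally have "norm (of_real (1 - \<rho>) * (deriv bump_sum z - deriv (bump_term k) z)) \<le> 2 / 15"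
    using sums_mult[OF ts, of "of_real (1 - \<rho>)"] by (simp add: sums_iff)
  then have "(1 - \<rho>) * norm (deriv bump_sum z - deriv (bump_term k) z) \<le> 2 / 15"
    using \<rho> by (simp add: norm_mult del: of_real_diff)
  moreover have "(1 - \<rho>) * norm (deriv (bump_term k) z) \<le> (1 - \<rho>) * norm (deriv bump_sum z) + (1 - \<rho>) * norm (deriv bump_sum z - deriv (bump_term k) z)"
    using norm_triangle_ineq3[of "deriv bump_sum z" "deriv (bump_term k) z"] \<rho>
    by (simp add: distrib_left[symmetric] mult_left_mono norm_minus_commute norm_triangle_sub)
  ultimately show ?thesis using main unfolding \<rho>_def by linarith
qed

lemma bump_sum_active_points:
  obtains w where "\<And>k. w k \<in> ball 0 1" "\<And>k. w k ^ frq k = of_real (1 - eps k)" "w \<longlonglongrightarrow> cis \<theta>"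
proof
  define \<rho> where "\<rho> k = root (frq k) (1 - eps k)" for k
  \<comment> \<open>The largest multiple of \<open>2 * pi / frq k\<close> not exceeding
    \<open>\<theta>\<close>; multiples of this angle disappear under the power
    \<open>frq k\<close>.\<close>
  define a where "a k = 2 * pi * real_of_int \<lfloor>\<theta> * real (frq k) / (2 * pi)\<rfloor> / real (frq k)" for k
  define w where "w k = of_real (\<rho> k) * cis (a k)" for k
  have e: "0 \<le> 1 - eps k" "1 - eps k < 1" for k using eps_pos[of k] eps_le[of k] by auto
  have \<rho>: "0 \<le> \<rho> k" "\<rho> k < 1" "\<rho> k ^ frq k = 1 - eps k" for k
    using e[of k] frq_pos[of k] by (auto simp: \<rho>_def)
  show "w k \<in> ball 0 1" for k using \<rho>[of k] by (simp add: w_def norm_mult)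
  show "w k ^ frq k = of_real (1 - eps k)" for k
  proof -
    have "real (frq k) * a k = 2 * pi * real_of_int \<lfloor>\<theta> * real (frq k) / (2 * pi)\<rfloor>"
      unfolding a_def using frq_pos[of k] by (intro nonzero_mult_div_cancel_left[of "real (frq k)", folded times_divide_eq_right]) simp
    then have "cis (a k) ^ frq k = cis (2 * pi * real_of_int \<lfloor>\<theta> * real (frq k) / (2 * pi)\<rfloor>)"
      by (simp only: Complex.DeMoivre)
    also have "\<dots> = 1" by (rule cis_multiple_2pi) simp
    finally show ?thesis unfolding w_def power_mult_distrib using \<rho>(3)[of k] by (simp flip: of_real_power)
  qed
  have inv: "(\<lambda>k. 1 / real (frq k)) \<longlonglongrightarrow> 0"
  proof (rule real_tendsto_sandwich[OF _ _ tendsto_const])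
    show "(\<lambda>k. (1 / 64) ^ k :: real) \<longlonglongrightarrow> 0" by (rule LIMSEQ_power_zero) simp
    have "64 ^ k \<le> frq k" for k unfolding frq_def by (intro power_increasing) (auto simp: power2_eq_square)
    then have "real (64 ^ k) \<le> real (frq k)" for k by (simp only: of_nat_le_iff)
    then have "1 / real (frq k) \<le> (1 / 64) ^ k" for k
      using frq_pos[of k] by (simp add: power_one_over field_simps)
    then show "\<forall>\<^sub>F k in sequentially. 1 / real (frq k) \<le> (1 / 64) ^ k" by simp
  qed auto
  have "(\<lambda>k. a k - \<theta>) \<longlonglongrightarrow> 0"
  proof (rule Lim_null_comparison)
    show "\<forall>\<^sub>F k in sequentially. norm (a k - \<theta>) \<le> 2 * pi * (1 / real (frq k))"
    proof (rule always_eventually, rule allI)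
      fix k
      define y where "y = \<theta> * real (frq k) / (2 * pi)"
      have "\<theta> = 2 * pi * y / real (frq k)" using frq_pos[of k] by (simp add: y_def)
      then have "a k - \<theta> = 2 * pi / real (frq k) * (real_of_int \<lfloor>y\<rfloor> - y)"
        unfolding a_def y_def[symmetric] by (simp add: diff_divide_distrib right_diff_distrib)
      moreover have "\<bar>real_of_int \<lfloor>y\<rfloor> - y\<bar> \<le> 1" by linarith
      ultimately show "norm (a k - \<theta>) \<le> 2 * pi * (1 / real (frq k))"
        using mult_left_mono[of "\<bar>real_of_int \<lfloor>y\<rfloor> - y\<bar>" 1 "2 * pi / real (frq k)"] by (simp add: abs_mult)
    qed
    show "(\<lambda>k. 2 * pi * (1 / real (frq k))) \<longlonglongrightarrow> 0"
      using tendsto_mult_right_zero[OF inv] by blast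
  qed
  then have a: "a \<longlonglongrightarrow> \<theta>" by (simp add: LIM_zero_iff)
  have ez: "eps \<longlonglongrightarrow> 0" by (rule summable_LIMSEQ_zero[OF eps_summable])
  have "(\<lambda>k. 1 - \<rho> k) \<longlonglongrightarrow> 0"
  proof (rule real_tendsto_sandwich[OF _ _ tendsto_const ez])
    have "1 - \<rho> k \<le> eps k" for k
    proof -
      have "\<rho> k ^ frq k \<le> \<rho> k ^ 1" using \<rho>[of k] frq_pos[of k] by (intro power_decreasing) auto
      then show ?thesis using \<rho>(3)[of k] by simp
    qed
    then show "\<forall>\<^sub>F k in sequentially. 1 - \<rho> k \<le> eps k" by simp
    show "\<forall>\<^sub>F k in sequentially. 0 \<le> 1 - \<rho> k" using \<rho>(2) by (simp add: less_imp_le)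
  qed
  then have r: "\<rho> \<longlonglongrightarrow> 1" using tendsto_diff[OF tendsto_const[of 1]] by fastforce
  have "(\<lambda>k. cis (a k)) \<longlonglongrightarrow> cis \<theta>"
    by (rule continuous_on_tendsto_compose[of UNIV cis, OF _ a]) (auto intro!: continuous_intros)
  from tendsto_mult[OF tendsto_of_real[OF r, where ?'a = complex] this]
  show "w \<longlonglongrightarrow> cis \<theta>" unfolding w_def[abs_def] by simp
qed

section \<open>Outerness\<close>

text \<open>The Schwarz formula. With \<open>(\<zeta> + z) / (\<zeta> - z) = 2 * \<zeta> / (\<zeta>
  - z) - 1\<close> the integrand splits into a Cauchy integral of \<open>g\<close>, the same with
  \<open>cnj g\<close>, and \<open>Re g\<close>. The second is the conjugate of the mean of
  \<open>g u / (1 - cnj z * u)\<close>, which is holomorphic and has the value \<open>g 0\<close> at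
  0.\<close>

lemma schwarz_integral:
  assumes cont: "continuous_on (cball 0 1) g" and hol: "g holomorphic_on ball 0 1" and z: "norm z < 1"
  shows "((\<lambda>t. (cis t + z) / (cis t - z) * of_real (Re (g (cis t)))) has_integral
    (2 * of_real pi * (g z - \<i> * of_real (Im (g 0))))) {0..2*pi}"
proof -
  have nz: "cis t - z \<noteq> 0" for t using z by auto
  have I1: "((\<lambda>t. g (cis t) * cis t / (cis t - z)) has_integral 2 * of_real pi * g z) {0..2*pi}"
    using cauchy_circle_integral[OF cont hol z, of 0] by simp
  have I3: "((\<lambda>t. g (cis t)) has_integral 2 * of_real pi * g 0) {0..2*pi}"
    using cauchy_circle_integral[OF cont hol, of 0 0] by simp
  have nz': "1 - cnj z * u \<noteq> 0" if "norm u \<le> 1" for u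
  proof
    assume "1 - cnj z * u = 0"
    then have "norm z * norm u = 1" by (metis complex_mod_cnj norm_mult norm_one right_minus_eq)
    moreover have "norm z * norm u \<le> norm z" using that by (simp add: mult_left_le)
    ultimately show False using z by simp
  qed
  have "((\<lambda>t. g (cis t) / (1 - cnj z * cis t)) has_integral 2 * of_real pi * g 0) {0..2*pi}"
  proof -
    let ?h = "\<lambda>u. g u / (1 - cnj z * u)"
    have "continuous_on (cball 0 1) ?h" "?h holomorphic_on ball 0 1"
      using nz' by (auto intro!: continuous_intros holomorphic_intros cont hol)
    from cauchy_circle_integral[OF this, of 0 0] show ?thesis by simp
  qed
  then have "((\<lambda>t. cnj (g (cis t) / (1 - cnj z * cis t))) has_integral cnj (2 * of_real pi * g 0)) {0..2*pi}"
    by (simp only: has_integral_cnj[unfolded o_def])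
  moreover have "cnj (g (cis t) / (1 - cnj z * cis t)) = cnj (g (cis t)) * cis t / (cis t - z)" for t
  proof -
    have "cnj (1 - cnj z * cis t) = (cis t - z) / cis t"
      by (simp add: cis_cnj diff_divide_distrib divide_inverse[of z])
    then show ?thesis by simp
  qed
  ultimately have I2: "((\<lambda>t. cnj (g (cis t)) * cis t / (cis t - z)) has_integral 2 * of_real pi * cnj (g 0)) {0..2*pi}"
    by simp
  have I4: "((\<lambda>t. of_real (Re (g (cis t)))) has_integral complex_of_real (Re (2 * of_real pi * g 0))) {0..2*pi}"
    by (intro has_integral_of_real has_integral_Re I3)
  have "(\<lambda>t. (cis t + z) / (cis t - z) * of_real (Re (g (cis t)))) =
     (\<lambda>t. g (cis t) * cis t / (cis t - z) + cnj (g (cis t)) * cis t / (cis t - z) - of_real (Re (g (cis t))))"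
  proof
    fix t
    have "(cis t + z) / (cis t - z) = 2 * cis t / (cis t - z) - 1"
      using nz[of t] by (simp add: divide_simps)
    moreover have "g (cis t) * cis t / (cis t - z) + cnj (g (cis t)) * cis t / (cis t - z) =
        of_real (Re (g (cis t))) * (2 * cis t / (cis t - z))"
      by (simp only: add_divide_distrib[symmetric] distrib_right[symmetric] complex_add_cnj) simp
    ultimately show "(cis t + z) / (cis t - z) * of_real (Re (g (cis t))) =
      g (cis t) * cis t / (cis t - z) + cnj (g (cis t)) * cis t / (cis t - z) - of_real (Re (g (cis t)))"
      by (simp only: left_diff_distrib mult.commute[of "2 * cis t / (cis t - z)"] mult_1_left)
  qed
  moreover have "2 * of_real pi * g z + 2 * of_real pi * cnj (g 0) - complex_of_real (Re (2 * of_real pi * g 0)) =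
     2 * of_real pi * (g z - \<i> * of_real (Im (g 0)))"
    by (simp add: complex_eq_iff algebra_simps)
  ultimately show ?thesis
    using has_integral_diff[OF has_integral_add[OF I1 I2] I4] by simp
qed

lemma bump_continuous:
  assumes "e > 0"
  shows "continuous_on (cball 0 1) (bump e N)" "bump e N holomorphic_on ball 0 1"
  unfolding bump_def[abs_def] using bump_denom(3)[OF assms]
  by (auto intro!: continuous_intros holomorphic_intros)

text \<open>With height \<open>e ^ 2\<close> the bound is linear in \<open>e\<close>, hence summable
  for the heights \<open>eps k\<close>. It combines \<open>2 * e * b \<le> b ^ 2 + e ^ 2\<close>
  with \<open>bump_Re\<close> and the mean value property of the real part.\<close>

lemma bump_L1:
  assumes e: "e > 0" and N: "N > 0"
  shows "(LINT t:{0..2*pi}|lborel. norm (bump (e\<^sup>2) N (cis t))) \<le> 2 * pi * e"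
proof -
  have e2: "e\<^sup>2 > 0" using e by simp
  note c = bump_continuous[OF e2, of N]
  have cc: "continuous_on {0..2*pi} (\<lambda>t. bump (e\<^sup>2) N (cis t))"
    by (intro continuous_on_compose2[OF c(1)] continuous_intros) auto
  have i: "((\<lambda>t. bump (e\<^sup>2) N (cis t)) has_integral 2 * of_real pi * bump (e\<^sup>2) N 0) {0..2*pi}"
    using cauchy_circle_integral[OF c, of 0 0] by simp
  have siR: "set_integrable lborel {0..2*pi} (\<lambda>t. Re (bump (e\<^sup>2) N (cis t)))"
    and siN: "set_integrable lborel {0..2*pi} (\<lambda>t. norm (bump (e\<^sup>2) N (cis t)))"
    by (intro borel_integrable_atLeastAtMost' continuous_intros cc)+
  have c1: "set_integrable lborel {0..2*pi} (\<lambda>t::real. e / 2)"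
    by (intro borel_integrable_atLeastAtMost' continuous_intros)
  have R: "(LINT t:{0..2*pi}|lborel. Re (bump (e\<^sup>2) N (cis t))) = 2 * pi * (e\<^sup>2 / (1 + e\<^sup>2))"
  proof -
    have "bump (e\<^sup>2) N 0 = of_real (e\<^sup>2 / (1 + e\<^sup>2))" using N by (simp add: bump_def)
    then have "Re (2 * of_real pi * bump (e\<^sup>2) N 0) = 2 * pi * (e\<^sup>2 / (1 + e\<^sup>2))"
      by (simp del: of_real_divide of_real_add)
    then show ?thesis
      using set_borel_integral_eq_integral(2)[OF siR] integral_unique[OF has_integral_Re[OF i]] by simp
  qed
  have "(LINT t:{0..2*pi}|lborel. norm (bump (e\<^sup>2) N (cis t))) \<le>
      (LINT t:{0..2*pi}|lborel. 1 / (2 * e) * Re (bump (e\<^sup>2) N (cis t)) + e / 2)"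
  proof (rule set_integral_mono[OF siN])
    show "set_integrable lborel {0..2*pi} (\<lambda>t. 1 / (2 * e) * Re (bump (e\<^sup>2) N (cis t)) + e / 2)"
      by (intro set_integral_add set_integrable_mult_right siR c1)
    fix t :: real
    define b where "b = norm (bump (e\<^sup>2) N (cis t))"
    have "2 * e * b \<le> b\<^sup>2 + e\<^sup>2" using sum_squares_ge_zero[of "b - e" 0] by (simp add: power2_eq_square algebra_simps)
    also have "\<dots> \<le> Re (bump (e\<^sup>2) N (cis t)) + e\<^sup>2"
      using bump_Re[OF e2, of "cis t" N] by (simp add: b_def)
    finally show "norm (bump (e\<^sup>2) N (cis t)) \<le> 1 / (2 * e) * Re (bump (e\<^sup>2) N (cis t)) + e / 2"
      unfolding b_def[symmetric] using e by (simp add: field_simps power2_eq_square)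
  qed
  also have "\<dots> = 1 / (2 * e) * (2 * pi * (e\<^sup>2 / (1 + e\<^sup>2))) + pi * e"
  proof -
    have "(LINT t:{0..2*pi}|lborel. 1 / (2 * e) * Re (bump (e\<^sup>2) N (cis t)) + e / 2) =
        (LINT t:{0..2*pi}|lborel. 1 / (2 * e) * Re (bump (e\<^sup>2) N (cis t))) + (LINT t:{0..2*pi}|lborel. e / 2)"
      by (intro set_integral_add set_integrable_mult_right siR c1)
    also have "(LINT t:{0..2*pi}|lborel. e / 2) = pi * e" by (simp add: set_lebesgue_integral_def)
    finally show ?thesis by (simp only: set_integral_mult_right R)
  qed
  also have "\<dots> \<le> 1 / (2 * e) * (2 * pi * e\<^sup>2) + pi * e"
    using e divide_left_mono[of 1 "1 + e\<^sup>2" "e\<^sup>2"]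
    by (intro add_right_mono mult_left_mono) (auto simp: add_pos_nonneg)
  also have "\<dots> = 2 * pi * e" using e by (simp add: power2_eq_square)
  finally show ?thesis .
qed

text \<open>The partial sums \<open>p n\<close> are continuous on the closed disc with real part at
  least 1, so \<open>Ln (p n z)\<close> is given by the Schwarz formula from its boundary values.
  Dominated convergence on the circle, with the integrable majorant \<open>d\<close>, carries the
  representation over to \<open>bump_sum\<close>.\<close>

lemma bump_sum_outer: "outer bump_sum"
proof -
  define I where "I = {0..2*pi::real}"
  define \<beta> where "\<beta> k t = bump_term k (cis t)" for k t
  have ccont: "continuous_on (cball 0 1) (bump_term k)" for k
    unfolding bump_term_def by (intro bump_continuous eps_pos)
  have chol: "bump_term k holomorphic_on ball 0 1" for k
    unfolding bump_term_def by (intro bump_continuous eps_pos)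
  have \<beta>cont: "continuous_on UNIV (\<beta> k)" for k
    unfolding \<beta>_def by (intro continuous_on_compose2[OF ccont] continuous_intros) auto
  then have [measurable]: "\<beta> k \<in> borel_measurable borel" for k by (rule borel_measurable_continuous_onI)
  have Imeas [measurable]: "I \<in> sets borel" by (simp add: I_def)
  define b where "b k t = indicator I t * norm (\<beta> k t)" for k t
  have bint: "integrable lborel (b k)" for k
  proof -
    have "set_integrable lborel I (\<lambda>t. norm (\<beta> k t))" unfolding I_def
      by (intro borel_integrable_atLeastAtMost' continuous_intros continuous_on_subset[OF \<beta>cont]) auto
    then show ?thesis by (simp add: set_integrable_def b_def[abs_def])
  qed
  have b0: "0 \<le> b k t" for k t by (simp add: b_def)
  have bI: "(LINT t|lborel. b k t) \<le> 2 * pi * (1 / 4) ^ Suc k" for k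
    using bump_L1[of "(1 / 4) ^ Suc k" "frq k"] frq_pos[of k]
    by (simp add: b_def[abs_def] \<beta>_def bump_term_def eps_sqrt set_lebesgue_integral_def I_def)
  have gsum: "summable (\<lambda>k. 2 * pi * (1 / 4) ^ Suc k :: real)"
    by (intro summable_mult) (simp add: summable_Suc_iff summable_geometric)
  have bIsum: "summable (\<lambda>k. LINT t|lborel. norm (b k t))"
    by (rule summable_comparison_test'[OF gsum, of 0])
       (use bI b0 in \<open>simp add: abs_of_nonneg integral_nonneg\<close>)
  \<comment> \<open>The series of \<open>L1\<close> norms converges, so monotone convergence makes
    the sum of the nonnegative functions finite almost everywhere.\<close>
  have AEs: "AE t in lborel. summable (\<lambda>k. b k t)"
  proof -
    have "(\<integral>\<^sup>+t. (\<Sum>k. ennreal (b k t)) \<partial>lborel) = (\<Sum>k. \<integral>\<^sup>+t. ennreal (b k t) \<partial>lborel)"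
      using bint by (intro nn_integral_suminf) auto
    also have "\<dots> = (\<Sum>k. ennreal (LINT t|lborel. b k t))"
      using bint b0 by (simp add: nn_integral_eq_integral)
    also have "\<dots> = ennreal (\<Sum>k. LINT t|lborel. b k t)"
      using bIsum b0 by (intro suminf_ennreal2) (auto simp: integral_nonneg)
    finally have "(\<integral>\<^sup>+t. (\<Sum>k. ennreal (b k t)) \<partial>lborel) \<noteq> \<infinity>" by simp
    then have "AE t in lborel. (\<Sum>k. ennreal (b k t)) \<noteq> \<infinity>"
      using bint by (intro nn_integral_PInf_AE) auto
    then show ?thesis
      by eventually_elim (use b0 in \<open>auto intro: summable_suminf_not_top\<close>)
  qed
  define d where "d t = (\<Sum>k. b k t)" for t
  have dint: "integrable lborel d" unfolding d_def[abs_def]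
    using AEs b0 by (intro integrable_suminf bint bIsum) (auto simp: abs_of_nonneg)
  define p where "p n z = 1 + (\<Sum>k<n. bump_term k z)" for n z
  define un where "un n t = ln (norm (p n (cis t)))" for n t
  \<comment> \<open>On the null set where the boundary series diverges, the infinite sum is an
    arbitrary value without influence on the integrals.\<close>
  define u where "u t = ln (norm (1 + (\<Sum>k. \<beta> k t)))" for t
  have pcont: "continuous_on (cball 0 1) (p n)" and phol: "p n holomorphic_on ball 0 1" for n
    unfolding p_def by (intro continuous_intros holomorphic_intros ccont chol)+
  have pRe: "1 \<le> Re (p n z)" if "norm z \<le> 1" for n z
  proof -
    have "0 \<le> Re (bump_term k z)" for k
      using order_trans[OF zero_le_power2 bump_Re[OF eps_pos that]] by (simp add: bump_term_def)
    then have "0 \<le> (\<Sum>k<n. Re (bump_term k z))" by (intro sum_nonneg) auto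
    then show ?thesis by (simp add: p_def)
  qed
  have pnz: "p n z \<notin> \<real>\<^sub>\<le>\<^sub>0" "p n z \<noteq> 0" "1 \<le> norm (p n z)" if "norm z \<le> 1" for n z
    using pRe[OF that, of n] complex_Re_le_cmod[of "p n z"] by (auto simp: complex_nonpos_Reals_iff)
  have Lcont: "continuous_on (cball 0 1) (\<lambda>z. Ln (p n z))" and Lhol: "(\<lambda>z. Ln (p n z)) holomorphic_on ball 0 1" for n
    using pnz by (auto intro!: continuous_intros holomorphic_intros pcont phol)
  have uncont: "continuous_on UNIV (un n)" for n
  proof -
    have "continuous_on UNIV (\<lambda>t. p n (cis t))"
      by (intro continuous_on_compose2[OF pcont] continuous_intros) auto
    moreover have "norm (p n (cis t)) \<noteq> 0" for t using pnz(2)[of "cis t" n] by simp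
    ultimately show ?thesis unfolding un_def by (intro continuous_intros) auto
  qed
  then have [measurable]: "un n \<in> borel_measurable borel" for n by (rule borel_measurable_continuous_onI)
  have [measurable]: "u \<in> borel_measurable borel"
    unfolding u_def by measurable
  have unlim: "(\<lambda>n. un n t) \<longlonglongrightarrow> u t \<and> (\<forall>n. norm (un n t) \<le> d t) \<and> norm (u t) \<le> d t"
    if "summable (\<lambda>k. b k t)" "t \<in> I" for t
  proof -
    have s: "summable (\<lambda>k. norm (\<beta> k t))" using that by (simp add: b_def)
    have d: "d t = (\<Sum>k. norm (\<beta> k t))" using that by (simp add: d_def b_def)
    have pt: "p n (cis t) = 1 + (\<Sum>k<n. \<beta> k t)" for n by (simp add: p_def \<beta>_def)
    have lim: "(\<lambda>n. 1 + (\<Sum>k<n. \<beta> k t)) \<longlonglongrightarrow> 1 + (\<Sum>k. \<beta> k t)"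
      by (intro tendsto_intros summable_LIMSEQ summable_norm_cancel[OF s])
    have ge: "1 \<le> norm (1 + (\<Sum>k<n. \<beta> k t))" for n using pnz(3)[of "cis t" n] by (simp add: pt)
    then have ge': "1 \<le> norm (1 + (\<Sum>k. \<beta> k t))"
      by (intro LIMSEQ_le_const[OF tendsto_norm[OF lim]]) auto
    have L: "(\<lambda>n. un n t) \<longlonglongrightarrow> u t"
      unfolding un_def u_def pt using ge' by (intro tendsto_intros lim) auto
    have B: "norm (un n t) \<le> d t" for n
    proof -
      have "norm (1 + (\<Sum>k<n. \<beta> k t)) \<le> 1 + (\<Sum>k<n. norm (\<beta> k t))"
        by (rule order_trans[OF norm_triangle_ineq]) (simp add: norm_sum)
      also have "(\<Sum>k<n. norm (\<beta> k t)) \<le> d t" unfolding d by (intro sum_le_suminf s) auto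
      finally have "norm (1 + (\<Sum>k<n. \<beta> k t)) - 1 \<le> d t" by simp
      moreover have "ln (norm (1 + (\<Sum>k<n. \<beta> k t))) \<le> norm (1 + (\<Sum>k<n. \<beta> k t)) - 1"
        using ge[of n] by (intro ln_le_minus_one) auto
      moreover have "0 \<le> ln (norm (1 + (\<Sum>k<n. \<beta> k t)))" using ge[of n] by simp
      ultimately show ?thesis by (simp add: un_def pt)
    qed
    have "norm (u t) \<le> d t" by (intro LIMSEQ_le_const2[OF tendsto_norm[OF L]]) (use B in auto)
    with L B show ?thesis by blast
  qed
  have uint: "set_integrable lborel I u"
    unfolding set_integrable_def
  proof (rule Bochner_Integration.integrable_bound[OF dint])
    show "AE t in lborel. norm (indicator I t *\<^sub>R u t) \<le> norm (d t)"
      using AEs by eventually_elim (use unlim in \<open>force split: split_indicator\<close>)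
  qed simp
  have uabs: "u absolutely_integrable_on {0..2*pi}"
    using uint unfolding set_integrable_def I_def by (subst integrable_completion) auto
  have key: "bump_sum z = 1 * exp (integral {0..2*pi} (\<lambda>t. (cis t + z) / (cis t - z) * of_real (u t)) / of_real (2*pi))"
    if z: "z \<in> ball 0 1" for z
  proof -
    have z1: "norm z < 1" using z by simp
    define K where "K t = (cis t + z) / (cis t - z)" for t
    have nz: "cis t - z \<noteq> 0" for t using z1 by auto
    have Kcont: "continuous_on A K" for A unfolding K_def using nz by (intro continuous_intros) auto
    have [measurable]: "K \<in> borel_measurable borel" using Kcont by (rule borel_measurable_continuous_onI)
    have Kb: "norm (K t) \<le> 2 / (1 - norm z)" for t
    proof -
      have "norm (cis t + z) \<le> 2" using norm_triangle_ineq[of "cis t" z] z1 by simp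
      moreover have "1 - norm z \<le> norm (cis t - z)" using norm_triangle_ineq2[of "cis t" z] by simp
      ultimately show ?thesis unfolding K_def norm_divide using z1 by (intro frac_le) auto
    qed
    \<comment> \<open>\<open>p n 0\<close> is a positive real, so the imaginary constant in the
      Schwarz formula vanishes and the unimodular factor in \<open>outer\<close> is 1.\<close>
    have Ln0: "Im (Ln (p n 0)) = 0" for n
    proof -
      have "bump_term k 0 = of_real (eps k / (1 + eps k))" for k
        using frq_pos[of k] by (simp add: bump_term_def bump_def)
      then have "p n 0 = of_real (1 + (\<Sum>k<n. eps k / (1 + eps k)))" by (simp add: p_def)
      moreover have "0 < 1 + (\<Sum>k<n. eps k / (1 + eps k))"
        by (intro add_pos_nonneg sum_nonneg divide_nonneg_nonneg) (auto intro: less_imp_le[OF eps_pos] add_nonneg_nonneg)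
      ultimately show ?thesis by (simp only: Ln_of_real Im_complex_of_real)
    qed
    have un: "un n t = Re (Ln (p n (cis t)))" for n t
      using pnz(2)[of "cis t" n] by (simp add: un_def)
    have In: "(LINT t:I|lborel. K t * of_real (un n t)) = 2 * of_real pi * Ln (p n z)" for n
    proof -
      have si: "set_integrable lborel I (\<lambda>t. K t * of_real (un n t))"
        unfolding I_def by (intro borel_integrable_atLeastAtMost' continuous_intros Kcont continuous_on_subset[OF uncont]) auto
      have "((\<lambda>t. K t * of_real (un n t)) has_integral 2 * of_real pi * Ln (p n z)) I"
        using schwarz_integral[OF Lcont Lhol z1, of n] by (simp add: un K_def I_def Ln0)
      then show ?thesis using set_borel_integral_eq_integral(2)[OF si] by (simp add: integral_unique)
    qed
    have si: "set_integrable lborel I (\<lambda>t. K t * of_real (u t))"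
      unfolding set_integrable_def
    proof (rule Bochner_Integration.integrable_bound[OF integrable_mult_right[OF dint]])
      show "AE t in lborel. norm (indicator I t *\<^sub>R (K t * of_real (u t))) \<le> norm (2 / (1 - norm z) * d t)"
        using AEs
      proof eventually_elim
        fix t assume s: "summable (\<lambda>k. b k t)"
        show "norm (indicator I t *\<^sub>R (K t * of_real (u t))) \<le> norm (2 / (1 - norm z) * d t)"
        proof (cases "t \<in> I")
          case True
          have "norm (K t) * norm (u t) \<le> 2 / (1 - norm z) * d t"
            using unlim[OF s True] Kb[of t] z1 by (intro mult_mono) auto
          then have "norm (K t) * norm (u t) \<le> norm (2 / (1 - norm z) * d t)"
            unfolding real_norm_def by (rule order_trans[OF _ abs_ge_self])
          then show ?thesis using True by (simp add: norm_mult)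
        qed simp
      qed
    qed measurable
    have "(\<lambda>n. LINT t:I|lborel. K t * of_real (un n t)) \<longlonglongrightarrow> (LINT t:I|lborel. K t * of_real (u t))"
      unfolding set_lebesgue_integral_def
    proof (rule integral_dominated_convergence[where w = "\<lambda>t. 2 / (1 - norm z) * d t"])
      show "integrable lborel (\<lambda>t. 2 / (1 - norm z) * d t)" using dint by simp
      show "AE t in lborel. (\<lambda>n. indicator I t *\<^sub>R (K t * of_real (un n t))) \<longlonglongrightarrow> indicator I t *\<^sub>R (K t * of_real (u t))"
        using AEs
      proof eventually_elim
        fix t assume s: "summable (\<lambda>k. b k t)"
        show "(\<lambda>n. indicator I t *\<^sub>R (K t * of_real (un n t))) \<longlonglongrightarrow> indicator I t *\<^sub>R (K t * of_real (u t))"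
        proof (cases "t \<in> I")
          case True
          then show ?thesis using unlim[OF s True] by (intro tendsto_intros) auto
        qed simp
      qed
      show "AE t in lborel. norm (indicator I t *\<^sub>R (K t * of_real (un n t))) \<le> 2 / (1 - norm z) * d t" for n
        using AEs
      proof eventually_elim
        fix t assume s: "summable (\<lambda>k. b k t)"
        have d0: "0 \<le> d t" unfolding d_def by (intro suminf_nonneg s b0)
        show "norm (indicator I t *\<^sub>R (K t * of_real (un n t))) \<le> 2 / (1 - norm z) * d t"
        proof (cases "t \<in> I")
          case True
          have "norm (K t) * norm (un n t) \<le> 2 / (1 - norm z) * d t"
            using unlim[OF s True] Kb[of t] z1 by (intro mult_mono) auto
          then show ?thesis using True by (simp add: norm_mult)
        qed (use d0 z1 in simp)
      qed
    qed measurable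
    then have "(\<lambda>n. 2 * of_real pi * Ln (p n z)) \<longlonglongrightarrow> integral I (\<lambda>t. K t * of_real (u t))"
      unfolding In using set_borel_integral_eq_integral(2)[OF si] by simp
    then have "(\<lambda>n. exp (2 * of_real pi * Ln (p n z) / of_real (2*pi))) \<longlonglongrightarrow> exp (integral I (\<lambda>t. K t * of_real (u t)) / of_real (2*pi))"
      by (intro tendsto_intros) auto
    moreover have "exp (2 * of_real pi * Ln (p n z) / of_real (2*pi)) = p n z" for n
      using pnz(2)[of z n] z1 by simp
    ultimately have "(\<lambda>n. p n z) \<longlonglongrightarrow> exp (integral I (\<lambda>t. K t * of_real (u t)) / of_real (2*pi))" by simp
    moreover have "(\<lambda>n. p n z) \<longlonglongrightarrow> bump_sum z"
      unfolding p_def bump_sum_def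
      by (intro tendsto_intros summable_LIMSEQ summable_norm_cancel[OF bump_term_summable] z1)
    ultimately show ?thesis using LIMSEQ_unique by (simp add: K_def I_def)
  qed
  show ?thesis unfolding outer_def using uabs key by (intro exI[of _ 1] exI[of _ u]) auto
qed


lemma bump_sum_bloch: "bump_sum \<in> bloch"
  using bump_sum_holomorphic bump_sum_bloch_bound unfolding bloch_def by blast

lemma bump_sum_inverse_Hinf: "(\<lambda>z. 1 / bump_sum z) \<in> Hinf"
proof -
  have ge: "1 \<le> norm (bump_sum z)" if "z \<in> ball 0 1" for z
    using bump_sum_Re_ge_1[OF that] complex_Re_le_cmod[of "bump_sum z"] by linarith
  then have "norm (1 / bump_sum z) \<le> 1" if "z \<in> ball 0 1" for z
    using ge[OF that] by (simp add: norm_divide divide_le_eq_1)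
  then have "bounded ((\<lambda>z. 1 / bump_sum z) ` ball 0 1)" by (intro boundedI[of _ 1]) auto
  moreover have "(\<lambda>z. 1 / bump_sum z) holomorphic_on ball 0 1"
    using ge by (intro holomorphic_intros bump_sum_holomorphic) force
  ultimately show ?thesis by (simp add: Hinf_def)
qed

section \<open>Sequential limits\<close>

text \<open>In the product rule the term with \<open>pderiv Q\<close> calls for a bound on
  \<open>(1 - norm z) * norm (F z)\<close>, and \<open>bloch_growth\<close> provides it.\<close>

lemma bloch_mult_poly:
  assumes F: "F \<in> bloch"
  shows "(\<lambda>z. F z * poly Q z) \<in> bloch"
proof -
  have hF: "F holomorphic_on ball 0 1" using F by (simp add: bloch_def)
  obtain C where C: "\<And>z. z \<in> ball 0 1 \<Longrightarrow> (1 - norm z) * norm (deriv F z) \<le> C"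
    using F unfolding bloch_def by blast
  have "bounded (poly Q ` cball 0 1)" "bounded (poly (pderiv Q) ` cball 0 1)"
    by (intro compact_imp_bounded compact_continuous_image continuous_intros compact_cball)+
  then obtain A B where A: "\<And>z. norm z \<le> 1 \<Longrightarrow> norm (poly Q z) \<le> A"
    and B: "\<And>z. norm z \<le> 1 \<Longrightarrow> norm (poly (pderiv Q) z) \<le> B"
    unfolding bounded_iff by (metis imageI mem_cball_0)
  have C0: "0 \<le> C" using C[of 0] order_trans[OF norm_ge_zero[of "deriv F 0"]] by simp
  have "(1 - norm z) * norm (deriv (\<lambda>z. F z * poly Q z) z) \<le> C * A + (norm (F 0) + C) * B" if z: "z \<in> ball 0 1" for z
  proof -
    have z1: "norm z < 1" using z by simp
    have d: "deriv (\<lambda>z. F z * poly Q z) z = deriv F z * poly Q z + poly (pderiv Q) z * F z"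
      using holomorphic_derivI[OF hF open_ball z]
      by (intro DERIV_imp_deriv) (rule DERIV_mult[OF _ poly_DERIV], auto)
    have "norm (F z) \<le> norm (F 0) + C * norm z / (1 - norm z)"
      using bloch_growth[OF hF C z] norm_triangle_ineq2[of "F z" "F 0"] by linarith
    then have "(1 - norm z) * norm (F z) \<le> (1 - norm z) * (norm (F 0) + C * norm z / (1 - norm z))"
      using z1 by (intro mult_left_mono) auto
    also have "\<dots> = (1 - norm z) * norm (F 0) + C * norm z"
      using z1 by (simp add: distrib_left)
    also have "\<dots> \<le> 1 * norm (F 0) + C * 1"
      using z1 C0 by (intro add_mono mult_right_mono mult_left_mono) auto
    finally have f: "(1 - norm z) * norm (F z) \<le> norm (F 0) + C" by simp
    have "(1 - norm z) * norm (deriv (\<lambda>z. F z * poly Q z) z) \<le>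
       (1 - norm z) * (norm (deriv F z) * norm (poly Q z) + norm (poly (pderiv Q) z) * norm (F z))"
      unfolding d using z1 by (intro mult_left_mono order_trans[OF norm_triangle_ineq]) (auto simp: norm_mult)
    also have "\<dots> = ((1 - norm z) * norm (deriv F z)) * norm (poly Q z) + ((1 - norm z) * norm (F z)) * norm (poly (pderiv Q) z)"
      by (simp add: algebra_simps)
    also have "\<dots> \<le> C * A + (norm (F 0) + C) * B"
      using C[OF z] A[of z] B[of z] f z1 C0 by (intro add_mono mult_mono) auto
    finally show ?thesis .
  qed
  moreover have "(\<lambda>z. F z * poly Q z) holomorphic_on ball 0 1" by (intro holomorphic_intros hF)
  ultimately show ?thesis unfolding bloch_def by blast
qed

text \<open>At the active points the growth of \<^const>\<open>bump_sum\<close> is too slow for the second term of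
  \<open>(bump_sum Q)' = bump_sum' Q + bump_sum Q'\<close> to contribute in the limit, so the Bloch bound controls \<open>Q\<close> on the circle.\<close>

lemma bump_sum_mult_poly_bound:
  assumes C: "\<And>w. w \<in> ball 0 1 \<Longrightarrow> (1 - norm w) * norm (deriv (\<lambda>z. bump_sum z * poly Q z) w) \<le> C"
    and z: "z \<in> ball 0 1"
  shows "norm (poly Q z) \<le> 16 * C"
proof -
  have circle: "norm (poly Q (cis \<theta>)) \<le> 16 * C" for \<theta>
  proof -
    obtain w where w: "\<And>k. w k \<in> ball 0 1" "\<And>k. w k ^ frq k = of_real (1 - eps k)" "w \<longlonglongrightarrow> cis \<theta>"
      using bump_sum_active_points[of \<theta>] by blast
    have wN: "norm (w k) ^ frq k = 1 - eps k" for k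
      using w(2)[of k] norm_power[of "w k" "frq k"] eps_le[of k] by (simp del: of_real_diff)
    \<comment> \<open>This is \<open>(k + 3) / 16 ^ k\<close>: the growth bound \<open>k + 3\<close>
      at \<open>w k\<close> times a bound on \<open>1 - norm (w k) \<le> eps k\<close>.\<close>
    define s where "s k = real k * (1 / 16) ^ k + 3 * (1 / 16 :: real) ^ k" for k
    have s0: "s \<longlonglongrightarrow> 0"
    proof -
      have "s \<longlonglongrightarrow> 0 + 3 * 0" unfolding s_def[abs_def]
        by (intro tendsto_intros powser_times_n_limit_0 LIMSEQ_power_zero) auto
      then show ?thesis by simp
    qed
    have small: "(1 - norm (w k)) * norm (bump_sum (w k)) \<le> s k" for k
    proof -
      have "norm (w k) ^ frq k \<le> norm (w k) ^ 1" using w(1)[of k] frq_pos[of k] by (intro power_decreasing) auto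
      then have "1 - norm (w k) \<le> eps k" using wN[of k] by simp
      also have "\<dots> \<le> (1 / 16) ^ k" unfolding eps_def by (intro power_decreasing) auto
      finally have "(1 - norm (w k)) * norm (bump_sum (w k)) \<le> (1 / 16) ^ k * (real k + 3)"
        using bump_sum_growth[OF w(1)[of k], of k] wN[of k] w(1)[of k] by (intro mult_mono) auto
      then show ?thesis by (simp add: s_def algebra_simps)
    qed
    have ineq: "norm (poly Q (w k)) \<le> 16 * (C + s k * norm (poly (pderiv Q) (w k)))" for k
    proof -
      let ?d = "1 - norm (w k)"
      have d0: "0 \<le> ?d" using w(1)[of k] by simp
      have d: "deriv (\<lambda>z. bump_sum z * poly Q z) (w k) = deriv bump_sum (w k) * poly Q (w k) + poly (pderiv Q) (w k) * bump_sum (w k)"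
        by (intro DERIV_imp_deriv DERIV_mult[OF bump_sum_derivative(1)[OF w(1)] poly_DERIV])
      have "norm (poly Q (w k)) \<le> 16 * ((?d * norm (deriv bump_sum (w k))) * norm (poly Q (w k)))"
        using mult_right_mono[OF bump_sum_active[OF w(1)[of k] w(2)[of k]], of "norm (poly Q (w k))"] by simp
      also have "(?d * norm (deriv bump_sum (w k))) * norm (poly Q (w k)) = ?d * norm (deriv (\<lambda>z. bump_sum z * poly Q z) (w k) - poly (pderiv Q) (w k) * bump_sum (w k))"
        unfolding d by (simp add: norm_mult)
      also have "\<dots> \<le> ?d * (norm (deriv (\<lambda>z. bump_sum z * poly Q z) (w k)) + norm (poly (pderiv Q) (w k) * bump_sum (w k)))"
        by (intro mult_left_mono norm_triangle_ineq4 d0)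
      also have "\<dots> = ?d * norm (deriv (\<lambda>z. bump_sum z * poly Q z) (w k)) + (?d * norm (bump_sum (w k))) * norm (poly (pderiv Q) (w k))"
        by (simp add: algebra_simps norm_mult)
      also have "\<dots> \<le> C + s k * norm (poly (pderiv Q) (w k))"
        by (intro add_mono C w mult_right_mono small) auto
      finally show ?thesis by simp
    qed
    have "(\<lambda>k. 16 * (C + s k * norm (poly (pderiv Q) (w k)))) \<longlonglongrightarrow> 16 * (C + 0 * norm (poly (pderiv Q) (cis \<theta>)))"
      by (intro tendsto_intros s0 w(3))
    moreover have "(\<lambda>k. norm (poly Q (w k))) \<longlonglongrightarrow> norm (poly Q (cis \<theta>))"
      by (intro tendsto_intros w(3))
    ultimately show ?thesis using LIMSEQ_le[OF _ _ exI[of _ 0]] ineq by fastforce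
  qed
  show ?thesis
  proof (rule maximum_modulus_frontier[of "poly Q" "ball 0 1"])
    fix u assume "u \<in> frontier (ball (0::complex) 1)"
    then have "norm u = 1" by (simp add: frontier_ball)
    then have "u = cis (Arg u)" using rcis_cmod_Arg[of u] by (simp add: rcis_def)
    then show "norm (poly Q u) \<le> 16 * C" using circle by metis
  qed (use z in \<open>auto intro!: holomorphic_intros continuous_intros\<close>)
qed

text \<open>Weak-star convergence implies pointwise convergence, as the Cauchy kernel with exponent
  0 represents evaluation at \<open>z\<close>. The uniform bound on the polynomials therefore
  survives in the limit, multiplied by \<open>norm (bump_sum z)\<close>.\<close>

lemma poly_mult_limits_bump_sum_bound:
  assumes "F \<in> poly_mult_limits bump_sum"
  obtains M where "\<And>z. z \<in> ball 0 1 \<Longrightarrow> norm (F z) \<le> M * norm (bump_sum z)"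
proof -
  obtain Q where F: "F \<in> bloch" and Q: "weakstar_tendsto (\<lambda>n z. bump_sum z * poly (Q n) z) F"
    using assms by (auto simp: poly_mult_limits_def)
  have lim: "(\<lambda>n. bloch_pair (\<lambda>z. bump_sum z * poly (Q n) z) g) \<longlonglongrightarrow> bloch_pair F g" if "g \<in> W1" for g
    using Q that by (simp add: weakstar_tendsto_def)
  have Fb: "(\<lambda>z. bump_sum z * poly (Q n) z) \<in> bloch" for n by (intro bloch_mult_poly bump_sum_bloch)
  have "Bseq (\<lambda>n. bloch_pair (\<lambda>z. bump_sum z * poly (Q n) z) g)" if "g \<in> W1" for g
    using lim[OF that] by (intro convergent_imp_Bseq convergentI)
  from bloch_uniform_boundedness[OF Fb this]
  obtain C where C: "\<And>n z. z \<in> ball 0 1 \<Longrightarrow> (1 - norm z) * norm (deriv (\<lambda>z. bump_sum z * poly (Q n) z) z) \<le> C"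
    by blast
  show thesis
  proof (rule that[of "16 * C"])
    fix z :: complex assume z: "z \<in> ball 0 1"
    then have z1: "norm z < 1" by simp
    have "bloch_pair G (\<lambda>u. u ^ 0 / (1 - cnj z * u) ^ Suc 0) = G z" if "G \<in> bloch" for G
      using bloch_pair_cauchy_kernel[of G z 0] that z1 by (simp add: bloch_def)
    with lim[OF cauchy_kernel_W1[OF z1, of 0]] F Fb
    have "(\<lambda>n. bump_sum z * poly (Q n) z) \<longlonglongrightarrow> F z" by simp
    then have "(\<lambda>n. norm (bump_sum z * poly (Q n) z)) \<longlonglongrightarrow> norm (F z)" by (rule tendsto_norm)
    then show "norm (F z) \<le> 16 * C * norm (bump_sum z)"
    proof (rule LIMSEQ_le_const2)
      have "norm (bump_sum z * poly (Q n) z) \<le> 16 * C * norm (bump_sum z)" for n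
        using mult_left_mono[OF bump_sum_mult_poly_bound[OF C z], of "norm (bump_sum z)" n]
        by (simp add: norm_mult mult_ac)
      then show "\<exists>N. \<forall>n\<ge>N. norm (bump_sum z * poly (Q n) z) \<le> 16 * C * norm (bump_sum z)" by blast
    qed
  qed
qed

section \<open>A Bloch function that is not a limit\<close>

lemma Ln_bloch: "(\<lambda>z. Ln (1 - z)) \<in> bloch"
proof -
  have nn: "1 - z \<notin> \<real>\<^sub>\<le>\<^sub>0" if "z \<in> ball 0 1" for z :: complex
    using that complex_Re_le_cmod[of z] by (auto simp: complex_nonpos_Reals_iff)
  have "(1 - norm z) * norm (deriv (\<lambda>z. Ln (1 - z)) z) \<le> 1" if z: "z \<in> ball 0 1" for z
  proof -
    have "((\<lambda>z. Ln (1 - z)) has_field_derivative (inverse (1 - z) * (0 - 1))) (at z)"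
      using nn[OF z] by (auto intro!: derivative_eq_intros)
    then have "norm (deriv (\<lambda>z. Ln (1 - z)) z) = 1 / norm (1 - z)"
      by (simp add: DERIV_imp_deriv norm_inverse divide_inverse)
    moreover have "1 - norm z \<le> norm (1 - z)" using norm_triangle_ineq2[of 1 z] by simp
    ultimately show ?thesis using z by (simp add: divide_le_eq_1)
  qed
  moreover have "(\<lambda>z. Ln (1 - z)) holomorphic_on ball 0 1" using nn by (intro holomorphic_intros) auto
  ultimately show ?thesis unfolding bloch_def by blast
qed

text \<open>At distance \<open>1 / frq K\<close> from 1 the logarithm has size
  \<open>(K + 1) ^ 2 * ln 64\<close>, while \<open>bump_sum\<close> is at most \<open>K + 3\<close>.
  No constant \<open>M\<close> can bridge the quadratic and the linear growth.\<close>

lemma Ln_not_limit: "(\<lambda>z. Ln (1 - z)) \<notin> poly_mult_limits bump_sum"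
proof
  assume "(\<lambda>z. Ln (1 - z)) \<in> poly_mult_limits bump_sum"
  then obtain M where M: "\<And>z. z \<in> ball 0 1 \<Longrightarrow> norm (Ln (1 - z)) \<le> M * norm (bump_sum z)"
    using poly_mult_limits_bump_sum_bound by blast
  have bound: "(real K + 1)\<^sup>2 \<le> \<bar>M\<bar> * (real K + 3)" for K
  proof -
    define N where "N = frq K"
    have N: "64 \<le> N" unfolding N_def frq_def using power_increasing[of 1 "(Suc K)\<^sup>2" "64::nat"] by simp
    \<comment> \<open>At this radius \<open>norm z ^ N = (1 - 1 / N) ^ N\<close> is at most
      \<open>1 / 2\<close>, whatever \<open>K\<close> is, so the hypothesis of
      \<open>bump_sum_growth\<close> holds.\<close>
    define z where "z = complex_of_real (1 - 1 / real N)"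
    have nz: "norm z = 1 - 1 / real N" using N by (simp add: z_def del: of_real_diff)
    have zb: "z \<in> ball 0 1" using N nz by simp
    have "norm z ^ N \<le> 1 / (1 + real N * (1 / real N))"
      unfolding nz using N by (intro bernoulli_upper) auto
    also have "\<dots> = 1 / 2" using N by simp
    finally have "eps K \<le> 1 - norm z ^ frq K" using eps_le[of K] by (simp add: N_def)
    then have g: "norm (bump_sum z) \<le> real K + 3" by (rule bump_sum_growth[OF zb])
    have "1 - z = of_real (1 / real N)" by (simp add: z_def)
    moreover have "0 < 1 / real N" using N by simp
    ultimately have "Ln (1 - z) = of_real (ln (1 / real N))" by (simp only: Ln_of_real)
    then have "norm (Ln (1 - z)) = ln (real N)" using N by (simp add: ln_div)
    also have "ln (real N) = (real K + 1)\<^sup>2 * ln 64"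
      by (simp add: N_def frq_def ln_realpow add.commute)
    finally have L: "norm (Ln (1 - z)) = (real K + 1)\<^sup>2 * ln 64" .
    have "1 \<le> ln (64::real)" using exp_le ln_ge_iff[of 64 1] by simp
    then have "(real K + 1)\<^sup>2 \<le> (real K + 1)\<^sup>2 * ln 64" by simp
    also have "\<dots> \<le> M * norm (bump_sum z)" using M[OF zb] L by simp
    also have "\<dots> \<le> \<bar>M\<bar> * (real K + 3)" using g by (intro mult_mono) auto
    finally show ?thesis .
  qed
  obtain K where K: "3 * \<bar>M\<bar> < real K" using reals_Archimedean2 by blast
  have "\<bar>M\<bar> * (real K + 3) \<le> (3 * \<bar>M\<bar>) * (real K + 1)" by (simp add: algebra_simps)
  also have "\<dots> < (real K + 1) * (real K + 1)" using K by (intro mult_strict_right_mono) auto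
  finally show False using bound[of K] by (simp add: power2_eq_square)
qed

lemma poly_mult_limits_linear:
  assumes f: "f \<in> bloch" and F: "F \<in> poly_mult_limits f" and G: "G \<in> poly_mult_limits f"
  shows "(\<lambda>z. a * F z + G z) \<in> poly_mult_limits f"
proof -
  obtain Q R where Q: "F \<in> bloch" "weakstar_tendsto (\<lambda>n z. f z * poly (Q n) z) F"
    and R: "G \<in> bloch" "weakstar_tendsto (\<lambda>n z. f z * poly (R n) z) G"
    using F G by (auto simp: poly_mult_limits_def)
  have "weakstar_tendsto (\<lambda>n z. f z * poly (smult a (Q n) + R n) z) (\<lambda>z. a * F z + G z)"
    unfolding weakstar_tendsto_def
  proof
    fix g assume g: "g \<in> W1"
    have "(\<lambda>n. a * bloch_pair (\<lambda>z. f z * poly (Q n) z) g + bloch_pair (\<lambda>z. f z * poly (R n) z) g)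
       \<longlonglongrightarrow> a * bloch_pair F g + bloch_pair G g"
      using Q R g by (intro tendsto_intros) (auto simp: weakstar_tendsto_def)
    also have "(\<lambda>n. a * bloch_pair (\<lambda>z. f z * poly (Q n) z) g + bloch_pair (\<lambda>z. f z * poly (R n) z) g) =
       (\<lambda>n. bloch_pair (\<lambda>z. f z * poly (smult a (Q n) + R n) z) g)"
      by (subst bloch_pair_linear_left[symmetric, OF bloch_mult_poly[OF f] bloch_mult_poly[OF f] g])
         (simp add: algebra_simps)
    also have "a * bloch_pair F g + bloch_pair G g = bloch_pair (\<lambda>z. a * F z + G z) g"
      by (rule bloch_pair_linear_left[symmetric, OF Q(1) R(1) g])
    finally show "(\<lambda>n. bloch_pair (\<lambda>z. f z * poly (smult a (Q n) + R n) z) g) \<longlonglongrightarrow> bloch_pair (\<lambda>z. a * F z + G z) g" .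
  qed
  then show ?thesis using bloch_linear[OF Q(1) R(1)] unfolding poly_mult_limits_def
    by (intro CollectI conjI exI[of _ "\<lambda>n. smult a (Q n) + R n"])
qed

lemma poly_mult_limits_zero: "(\<lambda>z. 0) \<in> poly_mult_limits f"
  by (auto simp: poly_mult_limits_def weakstar_tendsto_def bloch_zero intro!: exI[of _ "\<lambda>n. 0"])

theorem theorem1p10:
  shows "\<exists>f. outer f \<and> f \<in> bloch \<and> (\<lambda>z. 1 / f z) \<in> Hinf \<and>
     (\<lambda>z. 0) \<in> poly_mult_limits f \<and>
     (\<forall>F\<in>poly_mult_limits f. \<forall>G\<in>poly_mult_limits f. (\<lambda>z. F z + G z) \<in> poly_mult_limits f) \<and>
     (\<forall>F\<in>poly_mult_limits f. \<forall>a::complex. (\<lambda>z. a * F z) \<in> poly_mult_limits f) \<and>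
     poly_mult_limits f \<subset> bloch"
proof (intro exI[of _ bump_sum] conjI ballI allI)
  show "poly_mult_limits bump_sum \<subset> bloch"
    using Ln_bloch Ln_not_limit by (auto simp: poly_mult_limits_def)
  show "(\<lambda>z. F z + G z) \<in> poly_mult_limits bump_sum"
    if "F \<in> poly_mult_limits bump_sum" "G \<in> poly_mult_limits bump_sum" for F G
    using poly_mult_limits_linear[OF bump_sum_bloch that, of 1] by simp
  show "(\<lambda>z. a * F z) \<in> poly_mult_limits bump_sum" if "F \<in> poly_mult_limits bump_sum" for F a
    using poly_mult_limits_linear[OF bump_sum_bloch that poly_mult_limits_zero, of a] by simp
qed (auto intro: bump_sum_outer bump_sum_bloch bump_sum_inverse_Hinf poly_mult_limits_zero)

end
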